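(* Let $M$ be a Lorentzian surface lying fully in $\mathbb S^4_2(1)\subset \mathbb E^5_2$. Then $M$ is minimal in $\mathbb S^4_2(1)$ with constant Gaussian curvature $K$ and non-zero constant normal curvature $K^D$ if and only if it is (locally) congruent to the surface given by $$x(s,t)=\left(\frac 12 s^2+\frac {27}{40}\langle\alpha'''(t), \alpha'''(t)\rangle\right)\alpha(t)+\frac 32 s\,\alpha'(t)+\frac 32\alpha''(t),$$ where $\alpha$ is a smooth null curve in the light cone $\mathcal{LC}$ of $\mathbb E^5_2$ satisfying $$\langle\alpha''(t), \alpha''(t)\rangle=\frac 49 .$$
   Context: $\mathbb E^5_2$ is $\mathbb R^5$ with the pseudo-Euclidean metric $\langle\cdot,\cdot\rangle = -dx_1^2-dx_2^2+dx_3^2+dx_4^2+dx_5^2$; $\mathbb S^4_2(1)=\{v\in\mathbb E^5_2:\langle v,v\rangle=1\}$; $\mathcal{LC}=\{v\in\mathbb E^5_2:\langle v,v\rangle=0\}$. A non-zero vector $v$ is null if $\langle v,v\rangle=0$; a null curve is a smooth curve $\alpha:I\to\mathbb E^5_2$ ($I$ an open interval) whose velocity $\alpha'$ is everywhere a null (in particular non-zero) vector; here in addition $\langle\alpha,\alpha\rangle=0$. A Lorentzian surface $M$ in $\mathbb S^4_2(1)$ is a smooth (connected) immersed surface whose induced metric has signature $(-,+)$. It lies fully in $\mathbb S^4_2(1)$ if it is not contained in any hyperplane section (proper totally geodesic submanifold) of $\mathbb S^4_2(1)$. $M$ is minimal in $\mathbb S^4_2(1)$ if the mean curvature vector $\hat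 H=\frac12\mathrm{tr}\,\hat h$ vanishes, where $\hat h$ is the second fundamental form of $M$ in $\mathbb S^4_2(1)$. The Gaussian curvature is $K=\frac{R(X,Y,Y,X)}{\langle X,X\rangle\langle Y,Y\rangle-\langle X,Y\rangle^2}$ for $X,Y$ spanning the tangent space. The normal curvature is $K^D=-\langle R^{\hat D}(f_1,f_2)f_3,f_4\rangle$, where $R^{\hat D}$ is the curvature tensor of the normal connection $\hat D$ of $M$ in $\mathbb S^4_2(1)$ and $\{f_1,f_2;f_3,f_4\}$ is a local pseudo-orthonormal frame: $f_1,f_2$ tangent, $f_3,f_4$ normal to $M$ in $\mathbb S^4_2(1)$, $\langle f_1,f_2\rangle=\langle f_3,f_4\rangle=-1$, all other products $\langle f_A,f_B\rangle=0$ ($K^D$ is defined up to sign, depending on orientations; the frame is chosen continuously). Classification statements are local: "congruent" means that, around each point, a neighbourhood in $M$ is, after applying a linear isometry of $\mathbb E^5_2$ and a reparametrization, an open part of the given parametrized surface. *)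

theory Defs
  imports "HOL-Analysis.Analysis"
begin

section \<open>Smooth maps\<close>

abbreviation dir_deriv ::
  "('a::real_normed_vector \<Rightarrow> 'b::real_normed_vector) \<Rightarrow> 'a \<Rightarrow> 'a \<Rightarrow> 'b"
  where "dir_deriv f u v \<equiv> frechet_derivative f (at u) v"

text \<open>\<open>Ck_on k S f\<close> and \<open>smooth_on S f\<close> are meant for open sets \<open>S\<close>.\<close>

fun Ck_on :: "nat \<Rightarrow> 'a::real_normed_vector set \<Rightarrow> ('a \<Rightarrow> 'b::real_normed_vector) \<Rightarrow> bool" where
  "Ck_on 0 S f \<longleftrightarrow> continuous_on S f"
| "Ck_on (Suc k) S f \<longleftrightarrow>
     (\<forall>u\<in>S. f differentiable (at u)) \<and> (\<forall>v. Ck_on k S (\<lambda>u. dir_deriv f u v))"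

definition smooth_on :: "'a::real_normed_vector set \<Rightarrow> ('a \<Rightarrow> 'b::real_normed_vector) \<Rightarrow> bool"
  where "smooth_on S f \<longleftrightarrow> (\<forall>k. Ck_on k S f)"

section \<open>The pseudo-Euclidean space of index 2 and its null curves\<close>

definition pe_inner :: "real^5 \<Rightarrow> real^5 \<Rightarrow> real"  (\<open>\<langle>_, _\<rangle>\<close>)
  where "\<langle>v, w\<rangle> = - v$1 * w$1 - v$2 * w$2 + v$3 * w$3 + v$4 * w$4 + v$5 * w$5"

definition S42 :: "(real^5) set" where "S42 = {v. \<langle>v, v\<rangle> = 1}"

definition light_cone :: "(real^5) set" where "light_cone = {v. \<langle>v, v\<rangle> = 0}"

definition linear_isometry :: "(real^5 \<Rightarrow> real^5) \<Rightarrow> bool"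
  where "linear_isometry A \<longleftrightarrow> linear A \<and> (\<forall>v w. \<langle>A v, A w\<rangle> = \<langle>v, w\<rangle>)"

definition curve_deriv :: "nat \<Rightarrow> (real \<Rightarrow> real^5) \<Rightarrow> real \<Rightarrow> real^5"
  where "curve_deriv k = ((\<lambda>\<alpha> t. vector_derivative \<alpha> (at t)) ^^ k)"

definition null_curve :: "real set \<Rightarrow> (real \<Rightarrow> real^5) \<Rightarrow> bool"
  where "null_curve I \<alpha> \<longleftrightarrow> open I \<and> is_interval I \<and> smooth_on I \<alpha> \<and>
    (\<forall>t\<in>I. curve_deriv 1 \<alpha> t \<noteq> 0 \<and> \<langle>curve_deriv 1 \<alpha> t, curve_deriv 1 \<alpha> t\<rangle> = 0)"

section \<open>Smooth surfaces\<close>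

text \<open>The points of a surface are those of a topology \<open>X\<close>, and its smooth structure is given by an
  atlas \<open>\<A>\<close> of parametrizations \<open>(V, \<psi>)\<close>, that is, of inverses of charts.\<close>

type_synonym 'm patch = "(real^2) set \<times> (real^2 \<Rightarrow> 'm)"

definition topological_patch :: "'m topology \<Rightarrow> 'm patch \<Rightarrow> bool"
  where "topological_patch X = (\<lambda>(V, \<psi>).
    open V \<and> embedding_map (top_of_set V) X \<psi> \<and> openin X (\<psi> ` V))"

definition smooth_transition :: "'m patch \<Rightarrow> 'm patch \<Rightarrow> bool"
  where "smooth_transition = (\<lambda>(V, \<psi>) (W, \<psi>').
    smooth_on {u \<in> V. \<psi> u \<in> \<psi>' ` W} (the_inv_into W \<psi>' \<circ> \<psi>))"

definition smooth_surface :: "'m topology \<Rightarrow> 'm patch set \<Rightarrow> bool"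
  where "smooth_surface X \<A> \<longleftrightarrow>
    Hausdorff_space X \<and> second_countable X \<and> connected_space X \<and> topspace X \<noteq> {} \<and>
    (\<forall>P\<in>\<A>. topological_patch X P) \<and>
    topspace X = (\<Union>(V, \<psi>)\<in>\<A>. \<psi> ` V) \<and>
    (\<forall>P\<in>\<A>. \<forall>Q\<in>\<A>. smooth_transition P Q)"

text \<open>The smooth local parametrizations of the surface, i.e. the maximal atlas.\<close>

definition parametrization ::
  "'m topology \<Rightarrow> 'm patch set \<Rightarrow> (real^2) set \<Rightarrow> (real^2 \<Rightarrow> 'm) \<Rightarrow> bool"
  where "parametrization X \<A> V \<psi> \<longleftrightarrow> topological_patch X (V, \<psi>) \<and>
    (\<forall>P\<in>\<A>. smooth_transition (V, \<psi>) P \<and> smooth_transition P (V, \<psi>))"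

definition immersion :: "'m topology \<Rightarrow> 'm patch set \<Rightarrow> ('m \<Rightarrow> real^5) \<Rightarrow> bool"
  where "immersion X \<A> \<phi> \<longleftrightarrow> (\<forall>V \<psi>. parametrization X \<A> V \<psi> \<longrightarrow>
    smooth_on V (\<phi> \<circ> \<psi>) \<and> (\<forall>u\<in>V. inj (dir_deriv (\<phi> \<circ> \<psi>) u)))"

section \<open>Geometry of a parametrized surface\<close>

text \<open>Throughout, \<open>f\<close> is an immersion of an open subset of the plane. Tangent vectors and
  tangent vector fields are written in coordinates, as \<^typ>\<open>real^2\<close> and
  \<^typ>\<open>real^2 \<Rightarrow> real^2\<close>; the vector of \<^typ>\<open>real^5\<close> represented by \<open>X\<close> at \<open>u\<close>
  is \<open>dir_deriv f u X\<close>.\<close>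

definition first_ff :: "(real^2 \<Rightarrow> real^5) \<Rightarrow> real^2 \<Rightarrow> real^2 \<Rightarrow> real^2 \<Rightarrow> real"
  where "first_ff f u X Y = \<langle>dir_deriv f u X, dir_deriv f u Y\<rangle>"

definition metric :: "(real^2 \<Rightarrow> real^5) \<Rightarrow> real^2 \<Rightarrow> real^2^2"
  where "metric f u = (\<chi> i j. first_ff f u (axis i 1) (axis j 1))"

abbreviation inv_metric :: "(real^2 \<Rightarrow> real^5) \<Rightarrow> real^2 \<Rightarrow> real^2^2"
  where "inv_metric f u \<equiv> matrix_inv (metric f u)"

text \<open>Signature \<open>(-,+)\<close>: there is a pseudo-orthonormal basis of the tangent plane.\<close>

definition lorentzian_at :: "(real^2 \<Rightarrow> real^5) \<Rightarrow> real^2 \<Rightarrow> bool"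
  where "lorentzian_at f u \<longleftrightarrow>
    (\<exists>X Y. first_ff f u X X = -1 \<and> first_ff f u Y Y = 1 \<and> first_ff f u X Y = 0)"

subsection \<open>Gaussian curvature\<close>

definition christoffel :: "(real^2 \<Rightarrow> real^5) \<Rightarrow> real^2 \<Rightarrow> 2 \<Rightarrow> 2 \<Rightarrow> 2 \<Rightarrow> real"
  where "christoffel f u k i j = 1/2 * (\<Sum>l\<in>UNIV. inv_metric f u $ k $ l *
    (dir_deriv (\<lambda>w. metric f w $ j $ l) u (axis i 1)
   + dir_deriv (\<lambda>w. metric f w $ i $ l) u (axis j 1)
   - dir_deriv (\<lambda>w. metric f w $ i $ j) u (axis l 1)))"

definition levi_civita ::
  "(real^2 \<Rightarrow> real^5) \<Rightarrow> (real^2 \<Rightarrow> real^2) \<Rightarrow> (real^2 \<Rightarrow> real^2) \<Rightarrow> real^2 \<Rightarrow> real^2"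
  where "levi_civita f X Y u = dir_deriv Y u (X u) +
    (\<chi> k. \<Sum>i\<in>UNIV. \<Sum>j\<in>UNIV. christoffel f u k i j * X u $ i * Y u $ j)"

definition lie_bracket :: "(real^2 \<Rightarrow> real^2) \<Rightarrow> (real^2 \<Rightarrow> real^2) \<Rightarrow> real^2 \<Rightarrow> real^2"
  where "lie_bracket X Y u = dir_deriv Y u (X u) - dir_deriv X u (Y u)"

definition riemann :: "(real^2 \<Rightarrow> real^5) \<Rightarrow> (real^2 \<Rightarrow> real^2) \<Rightarrow> (real^2 \<Rightarrow> real^2) \<Rightarrow>
    (real^2 \<Rightarrow> real^2) \<Rightarrow> real^2 \<Rightarrow> real^2"
  where "riemann f X Y Z u = levi_civita f X (levi_civita f Y Z) u
    - levi_civita f Y (levi_civita f X Z) u - levi_civita f (lie_bracket X Y) Z u"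

text \<open>The quotient does not depend on the two vectors spanning the tangent plane; the coordinate
  fields are used.\<close>

definition gauss_curvature :: "(real^2 \<Rightarrow> real^5) \<Rightarrow> real^2 \<Rightarrow> real"
  where "gauss_curvature f u = (let X = axis 1 1; Y = axis 2 1 in
    first_ff f u (riemann f (\<lambda>_. X) (\<lambda>_. Y) (\<lambda>_. Y) u) X /
    (first_ff f u X X * first_ff f u Y Y - (first_ff f u X Y)\<^sup>2))"

subsection \<open>Mean curvature and normal curvature of a surface in the pseudosphere\<close>

definition tangent_part :: "(real^2 \<Rightarrow> real^5) \<Rightarrow> real^2 \<Rightarrow> real^5 \<Rightarrow> real^5"
  where "tangent_part f u w = (\<Sum>i\<in>UNIV. \<Sum>j\<in>UNIV.
    (inv_metric f u $ i $ j * \<langle>w, dir_deriv f u (axis i 1)\<rangle>) *\<^sub>R dir_deriv f u (axis j 1))"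

text \<open>The component normal to the surface and tangent to \<open>S42\<close>; note that the position
  vector \<open>f u\<close> is a unit normal of \<open>S42\<close>.\<close>

definition normal_part :: "(real^2 \<Rightarrow> real^5) \<Rightarrow> real^2 \<Rightarrow> real^5 \<Rightarrow> real^5"
  where "normal_part f u w = w - tangent_part f u w - \<langle>w, f u\<rangle> *\<^sub>R f u"

definition second_ff :: "(real^2 \<Rightarrow> real^5) \<Rightarrow> real^2 \<Rightarrow> real^2 \<Rightarrow> real^2 \<Rightarrow> real^5"
  where "second_ff f u X Y = normal_part f u (dir_deriv (\<lambda>w. dir_deriv f w Y) u X)"

definition mean_curvature :: "(real^2 \<Rightarrow> real^5) \<Rightarrow> real^2 \<Rightarrow> real^5"
  where "mean_curvature f u = (1/2) *\<^sub>R (\<Sum>i\<in>UNIV. \<Sum>j\<in>UNIV.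
    inv_metric f u $ i $ j *\<^sub>R second_ff f u (axis i 1) (axis j 1))"

definition normal_conn ::
  "(real^2 \<Rightarrow> real^5) \<Rightarrow> (real^2 \<Rightarrow> real^2) \<Rightarrow> (real^2 \<Rightarrow> real^5) \<Rightarrow> real^2 \<Rightarrow> real^5"
  where "normal_conn f X \<xi> u = normal_part f u (dir_deriv \<xi> u (X u))"

definition normal_riemann :: "(real^2 \<Rightarrow> real^5) \<Rightarrow> (real^2 \<Rightarrow> real^2) \<Rightarrow> (real^2 \<Rightarrow> real^2) \<Rightarrow>
    (real^2 \<Rightarrow> real^5) \<Rightarrow> real^2 \<Rightarrow> real^5"
  where "normal_riemann f X Y \<xi> u = normal_conn f X (normal_conn f Y \<xi>) u
    - normal_conn f Y (normal_conn f X \<xi>) u - normal_conn f (lie_bracket X Y) \<xi> u"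

text \<open>In a frame \<open>(X1, X2, n3, n4)\<close> the tangent fields are given in coordinates, so that
  \<open>f1\<close> and \<open>f2\<close> are the images of \<open>X1\<close> and \<open>X2\<close> under the differential of \<open>f\<close>.\<close>

definition adapted_frame :: "(real^2 \<Rightarrow> real^5) \<Rightarrow> (real^2) set \<Rightarrow> (real^2 \<Rightarrow> real^2) \<Rightarrow>
    (real^2 \<Rightarrow> real^2) \<Rightarrow> (real^2 \<Rightarrow> real^5) \<Rightarrow> (real^2 \<Rightarrow> real^5) \<Rightarrow> bool"
  where "adapted_frame f V X1 X2 n3 n4 \<longleftrightarrow>
    smooth_on V X1 \<and> smooth_on V X2 \<and> smooth_on V n3 \<and> smooth_on V n4 \<and>
    (\<forall>u\<in>V. let f1 = dir_deriv f u (X1 u); f2 = dir_deriv f u (X2 u); f3 = n3 u; f4 = n4 u in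
      \<langle>f1, f2\<rangle> = -1 \<and> \<langle>f1, f1\<rangle> = 0 \<and> \<langle>f2, f2\<rangle> = 0 \<and>
      \<langle>f3, f4\<rangle> = -1 \<and> \<langle>f3, f3\<rangle> = 0 \<and> \<langle>f4, f4\<rangle> = 0 \<and>
      \<langle>f1, f3\<rangle> = 0 \<and> \<langle>f1, f4\<rangle> = 0 \<and> \<langle>f2, f3\<rangle> = 0 \<and> \<langle>f2, f4\<rangle> = 0 \<and>
      \<langle>f3, f u\<rangle> = 0 \<and> \<langle>f4, f u\<rangle> = 0)"

definition normal_curvature :: "(real^2 \<Rightarrow> real^5) \<Rightarrow> (real^2 \<Rightarrow> real^2) \<Rightarrow>
    (real^2 \<Rightarrow> real^2) \<Rightarrow> (real^2 \<Rightarrow> real^5) \<Rightarrow> (real^2 \<Rightarrow> real^5) \<Rightarrow> real^2 \<Rightarrow> real"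
  where "normal_curvature f X1 X2 n3 n4 u = - \<langle>normal_riemann f X1 X2 n3 u, n4 u\<rangle>"

section \<open>Lorentzian surfaces in the pseudosphere\<close>

definition lorentzian_surface_in_S42 ::
  "'m topology \<Rightarrow> 'm patch set \<Rightarrow> ('m \<Rightarrow> real^5) \<Rightarrow> bool"
  where "lorentzian_surface_in_S42 X \<A> \<phi> \<longleftrightarrow>
    smooth_surface X \<A> \<and> immersion X \<A> \<phi> \<and> \<phi> ` topspace X \<subseteq> S42 \<and>
    (\<forall>V \<psi>. parametrization X \<A> V \<psi> \<longrightarrow> (\<forall>u\<in>V. lorentzian_at (\<phi> \<circ> \<psi>) u))"

text \<open>The totally geodesic hyperplane sections of \<open>S42\<close> are its intersections with the
  hyperplanes through the origin, degenerate ones included.\<close>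

definition lies_fully :: "'m topology \<Rightarrow> ('m \<Rightarrow> real^5) \<Rightarrow> bool"
  where "lies_fully X \<phi> \<longleftrightarrow>
    \<not> (\<exists>n. n \<noteq> 0 \<and> \<phi> ` topspace X \<subseteq> S42 \<inter> {v. \<langle>n, v\<rangle> = 0})"

definition minimal_surface :: "'m topology \<Rightarrow> 'm patch set \<Rightarrow> ('m \<Rightarrow> real^5) \<Rightarrow> bool"
  where "minimal_surface X \<A> \<phi> \<longleftrightarrow> (\<forall>V \<psi>. parametrization X \<A> V \<psi> \<longrightarrow>
    (\<forall>u\<in>V. mean_curvature (\<phi> \<circ> \<psi>) u = 0))"

definition has_constant_gauss_curvature ::
  "'m topology \<Rightarrow> 'm patch set \<Rightarrow> ('m \<Rightarrow> real^5) \<Rightarrow> real \<Rightarrow> bool"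
  where "has_constant_gauss_curvature X \<A> \<phi> K \<longleftrightarrow> (\<forall>V \<psi>. parametrization X \<A> V \<psi> \<longrightarrow>
    (\<forall>u\<in>V. gauss_curvature (\<phi> \<circ> \<psi>) u = K))"

text \<open>Interchanging \<open>f3\<close> and \<open>f4\<close> reverses the sign of the normal curvature, so its value
  refers to a choice of local frames.\<close>

definition has_constant_normal_curvature ::
  "'m topology \<Rightarrow> 'm patch set \<Rightarrow> ('m \<Rightarrow> real^5) \<Rightarrow> real \<Rightarrow> bool"
  where "has_constant_normal_curvature X \<A> \<phi> KD \<longleftrightarrow> (\<forall>p\<in>topspace X. \<exists>V \<psi> X1 X2 n3 n4.
    parametrization X \<A> V \<psi> \<and> p \<in> \<psi> ` V \<and> adapted_frame (\<phi> \<circ> \<psi>) V X1 X2 n3 n4 \<and>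
    (\<forall>u\<in>V. normal_curvature (\<phi> \<circ> \<psi>) X1 X2 n3 n4 u = KD))"

text \<open>The point \<open>p\<close> has a neighbourhood \<open>\<psi> ` V\<close> in the surface that becomes, after a linear
  isometry \<open>A\<close> and in the parameters \<open>(s, t) \<in> V\<close>, an open part of the surface \<open>x\<close> with
  parameter domain \<open>D\<close>.\<close>

definition congruent_near :: "'m topology \<Rightarrow> 'm patch set \<Rightarrow> ('m \<Rightarrow> real^5) \<Rightarrow> 'm \<Rightarrow>
    (real \<times> real) set \<Rightarrow> (real \<Rightarrow> real \<Rightarrow> real^5) \<Rightarrow> bool"
  where "congruent_near X \<A> \<phi> p D x \<longleftrightarrow> (\<exists>A V \<psi>. linear_isometry A \<and>
    parametrization X \<A> V \<psi> \<and> p \<in> \<psi> ` V \<and>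
    (\<forall>u\<in>V. (u$1, u$2) \<in> D \<and> A (\<phi> (\<psi> u)) = x (u$1) (u$2)))"

end

theory Submission
  imports Defs
begin

text \<open>In a null frame \<open>F1, F2, n3, n4\<close>, minimality means that \<open>h(X1, X2) = 0\<close>. If \<open>a3, a4\<close> and
  \<open>b3, b4\<close> are the components of \<open>h(X1, X1)\<close> and \<open>h(X2, X2)\<close> along \<open>n3, n4\<close>, then
  \<open>K = 1 + a3 b4 + a4 b3\<close> and \<open>K\<^sup>D = a3 b4 - a4 b3\<close>. If both curvatures are constant, so are the two
  products, and the equations of Codazzi, Gauss and Ricci give \<open>2 K + K\<^sup>D = 0\<close> if \<open>a3 b4 \<noteq> 0\<close> and
  \<open>2 K - K\<^sup>D = 0\<close> if \<open>a4 b3 \<noteq> 0\<close>. As \<open>K\<^sup>D \<noteq> 0\<close>, after interchanging the normals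
  \<open>a3 b4 = -2/3\<close> and \<open>a4 b3 = 0\<close>; locally one of \<open>a4\<close>, \<open>b3\<close> vanishes, say \<open>a4\<close>. The direction of
  \<open>n3\<close> is then constant along \<open>X1\<close>, and rescaling the frame makes \<open>\<alpha> = a3 n3\<close> a null curve
  in the light cone whose derivatives express the immersion.

  Conversely, the generated surface carries the null frame with \<open>n3 = \<alpha>\<close>, \<open>F1\<close> the derivative in \<open>s\<close>,
  for which \<open>a3 = 1\<close>, \<open>a4 = 0\<close> and \<open>b4 = -2/3\<close>, so that \<open>K = 1/3\<close> and \<open>K\<^sup>D = -2/3\<close>; the Gauss
  equation and the tensoriality of \<open>h\<close> transfer minimality and \<open>K\<close> to every parametrization.\<close>

section \<open>Smooth maps\<close>

text \<open>The relation \<open>2 K + K\<^sup>D = 0\<close> is an integrability condition. A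
  constant product \<open>a3 b4 \<noteq> 0\<close> turns the Codazzi equation for \<open>b4\<close>
  along \<open>X1\<close> into one for \<open>a3\<close>, so both derivatives of
  \<open>log a3\<close> are known, \<open>2 w1 - m1\<close> and \<open>2 w2 - m2\<close>, and their
  commutator combines the Gauss and Ricci equations. With p = a3 b4 and q = a4 b3 the two relations
  are 2 + 3 p + q = 0 for nonzero p and 2 + p + 3 q = 0 for nonzero q. Together they force p = q,
  that is, zero normal curvature; so one product is 0 and the other -2/3. Two obstacles remain: a
  zero product of smooth functions need not have a factor vanishing near the point, and null
  coordinates would require flows. Quotients of linear functionals of a null normal answer both.
  Where \<open>a4 = 0\<close> the direction of \<open>n3\<close> is constant along
  \<open>X1\<close>, and it moves along \<open>X2\<close> because \<open>b4 \<noteq> 0\<close>; such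
  a quotient is a coordinate, and the inverse function theorem replaces the flows. The constants 1/2
  and 27/40 come from solving \<open>\<langle>F2, F2\<rangle> = 0\<close> for the derivative of the
  coordinate s along \<open>X2\<close>; 4/9 is the square of a3 b4.\<close>

lemma dir_deriv_eqI: "(f has_derivative f') (at u) \<Longrightarrow> dir_deriv f u v = f' v"
  using frechet_derivative_at by metis

lemma dir_deriv_cong:
  assumes "open S" "u \<in> S" "\<And>w. w \<in> S \<Longrightarrow> f w = g w"
  shows "dir_deriv f u = dir_deriv g u"
proof -
  have "(f has_derivative D) (at u) \<longleftrightarrow> (g has_derivative D) (at u)" for D
    using has_derivative_transform_within_open[OF _ assms(1,2)] assms(3) by metis
  then show ?thesis
    unfolding frechet_derivative_def by simp
qed

lemma dir_deriv_transfer: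
  "open S \<Longrightarrow> u \<in> S \<Longrightarrow> (\<And>w. w \<in> S \<Longrightarrow> f w = g w) \<Longrightarrow> dir_deriv f u v = dir_deriv g u v"
  by (rule fun_cong[OF dir_deriv_cong])

lemma differentiable_cong:
  assumes "open S" "u \<in> S" "\<And>w. w \<in> S \<Longrightarrow> f w = g w"
  shows "f differentiable (at u) \<longleftrightarrow> g differentiable (at u)"
  unfolding differentiable_def
  using has_derivative_transform_within_open[OF _ assms(1,2)] assms(3) by metis

lemma Ck_on_cong:
  assumes "open S" "\<And>w. w \<in> S \<Longrightarrow> f w = g w"
  shows "Ck_on k S f \<longleftrightarrow> Ck_on k S g"
  using assms(2)
proof (induction k arbitrary: f g)
  case 0
  then show ?case by (simp cong: continuous_on_cong)
next
  case (Suc k)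
  have "Ck_on k S (\<lambda>u. dir_deriv f u v) \<longleftrightarrow> Ck_on k S (\<lambda>u. dir_deriv g u v)" for v
    using dir_deriv_cong[OF assms(1) _ Suc.prems] by (intro Suc.IH) auto
  moreover have "f differentiable (at u) \<longleftrightarrow> g differentiable (at u)" if "u \<in> S" for u
    using differentiable_cong[OF assms(1) that Suc.prems] by simp
  ultimately show ?case by simp
qed

lemma Ck_on_SucD: "Ck_on (Suc k) S f \<Longrightarrow> Ck_on k S f"
proof (induction k arbitrary: f)
  case 0
  then show ?case
    by (metis Ck_on.simps continuous_at_imp_continuous_on differentiable_imp_continuous_within)
next
  case (Suc k)
  then show ?case by (metis Ck_on.simps(2))
qed

lemma Ck_on_subset: "Ck_on k S f \<Longrightarrow> T \<subseteq> S \<Longrightarrow> Ck_on k T f"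
  by (induction k arbitrary: f) (auto intro: continuous_on_subset)

lemma Ck_on_const: "Ck_on k S (\<lambda>_. c)"
proof (induction k arbitrary: c)
  case (Suc k)
  then show ?case by simp
qed simp

lemma Ck_on_linear:
  assumes "bounded_linear f"
  shows "Ck_on k S f"
proof (cases k)
  case 0
  then show ?thesis using assms by (simp add: linear_continuous_on)
next
  case (Suc m)
  have "(\<lambda>u. dir_deriv f u v) = (\<lambda>u. f v)" for v
    using bounded_linear_imp_has_derivative[OF assms] dir_deriv_eqI by blast
  then show ?thesis
    using Suc assms by (simp add: Ck_on_const bounded_linear_imp_differentiable)
qed

lemma Ck_on_add:
  assumes "open S" "Ck_on k S f" "Ck_on k S g"
  shows "Ck_on k S (\<lambda>u. f u + g u)"
  using assms(2,3)
proof (induction k arbitrary: f g)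
  case 0
  then show ?case by (simp add: continuous_on_add)
next
  case (Suc k)
  have "dir_deriv (\<lambda>w. f w + g w) u v = dir_deriv f u v + dir_deriv g u v" if "u \<in> S" for u v
    using Suc.prems that by (intro dir_deriv_eqI has_derivative_add)
      (auto simp: frechet_derivative_works)
  then have "Ck_on k S (\<lambda>u. dir_deriv (\<lambda>w. f w + g w) u v)" for v
    using Suc.IH[of "\<lambda>u. dir_deriv f u v" "\<lambda>u. dir_deriv g u v"] Suc.prems
      Ck_on_cong[OF assms(1), of "\<lambda>u. dir_deriv (\<lambda>w. f w + g w) u v"] by auto
  then show ?case using Suc.prems by auto
qed

text \<open>Scalar multiples, products and \<open>pe_inner\<close> are all instances, so the product
  rule is iterated once for all of them: the derivative is a sum of two values of \<open>B\<close>,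
  each covered by the induction hypothesis.\<close>

lemma Ck_on_bilinear:
  assumes "bounded_bilinear B" "open S" "Ck_on k S f" "Ck_on k S g"
  shows "Ck_on k S (\<lambda>u. B (f u) (g u))"
  using assms(3,4)
proof (induction k arbitrary: f g)
  case 0
  then show ?case using bounded_bilinear.continuous_on[OF assms(1)] by auto
next
  case (Suc k)
  have D: "((\<lambda>w. B (f w) (g w)) has_derivative
      (\<lambda>v. B (f u) (dir_deriv g u v) + B (dir_deriv f u v) (g u))) (at u)" if "u \<in> S" for u
    using Suc.prems that by (intro bounded_bilinear.FDERIV[OF assms(1)])
      (auto simp: frechet_derivative_works)
  have "Ck_on k S (\<lambda>u. dir_deriv (\<lambda>w. B (f w) (g w)) u v)" for v
  proof (subst Ck_on_cong[OF assms(2)])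
    show "dir_deriv (\<lambda>w. B (f w) (g w)) u v = B (f u) (dir_deriv g u v) + B (dir_deriv f u v) (g u)"
      if "u \<in> S" for u
      using dir_deriv_eqI[OF D[OF that]] .
    show "Ck_on k S (\<lambda>u. B (f u) (dir_deriv g u v) + B (dir_deriv f u v) (g u))"
      using Suc.prems Ck_on_SucD[OF Suc.prems(1)] Ck_on_SucD[OF Suc.prems(2)]
      by (intro Ck_on_add assms(2) Suc.IH) auto
  qed
  moreover have "(\<lambda>w. B (f w) (g w)) differentiable (at u)" if "u \<in> S" for u
    using D[OF that] by (auto simp: differentiable_def)
  ultimately show ?case by simp
qed

lemma Ck_on_sum:
  assumes "open S" "finite J" "\<And>j. j \<in> J \<Longrightarrow> Ck_on k S (f j)"
  shows "Ck_on k S (\<lambda>u. \<Sum>j\<in>J. f j u)"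
  using assms(2,3)
proof (induction J rule: finite_induct)
  case empty
  then show ?case by (simp add: Ck_on_const)
next
  case (insert j J)
  then show ?case using Ck_on_add[OF assms(1), of k "f j" "\<lambda>u. \<Sum>j\<in>J. f j u"] by simp
qed

text \<open>\<open>Ck_on\<close> speaks of derivatives in constant directions. A derivative in a
  varying direction, as in the chain rule or along a vector field, becomes by this expansion a
  combination of such derivatives with varying coefficients.\<close>

lemma linear_apply_Basis:
  fixes x :: "'a::euclidean_space"
  assumes "linear L"
  shows "L x = (\<Sum>b\<in>Basis. (x \<bullet> b) *\<^sub>R L b)"
proof -
  have "L x = L (\<Sum>b\<in>Basis. (x \<bullet> b) *\<^sub>R b)" by (simp add: euclidean_representation)
  also have "\<dots> = (\<Sum>b\<in>Basis. (x \<bullet> b) *\<^sub>R L b)"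
    by (simp add: linear_sum[OF assms] linear_cmul[OF assms])
  finally show ?thesis .
qed

lemma Ck_on_compose_linear:
  assumes "bounded_linear L" "open S" "Ck_on k S f"
  shows "Ck_on k S (\<lambda>u. L (f u))"
  using assms(3)
proof (induction k arbitrary: f)
  case 0
  then show ?case using assms(1) by (simp add: bounded_linear.continuous_on)
next
  case (Suc k)
  have D: "((\<lambda>w. L (f w)) has_derivative (\<lambda>v. L (dir_deriv f u v))) (at u)" if "u \<in> S" for u
    using Suc.prems that bounded_linear.has_derivative[OF assms(1)]
    by (auto simp: frechet_derivative_works)
  have "Ck_on k S (\<lambda>u. dir_deriv (\<lambda>w. L (f w)) u v)" for v
    using Suc Ck_on_cong[OF assms(2), of "\<lambda>u. dir_deriv (\<lambda>w. L (f w)) u v", OF dir_deriv_eqI[OF D]]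
    by auto
  then show ?case using D by (auto simp: differentiable_def)
qed

lemma Ck_on_compose:
  fixes f :: "'a::real_normed_vector \<Rightarrow> 'b::euclidean_space"
    and g :: "'b \<Rightarrow> 'c::real_normed_vector"
  assumes "open S" "open T" "f ` S \<subseteq> T" "Ck_on k S f" "Ck_on k T g"
  shows "Ck_on k S (\<lambda>u. g (f u))"
  using assms(4,5)
proof (induction k arbitrary: g)
  case 0
  then show ?case using continuous_on_compose2 assms(3) by auto
next
  case (Suc k)
  have D: "((\<lambda>w. g (f w)) has_derivative (\<lambda>v. dir_deriv g (f u) (dir_deriv f u v))) (at u)"
    if "u \<in> S" for u
  proof -
    have "(f has_derivative dir_deriv f u) (at u)" "(g has_derivative dir_deriv g (f u)) (at (f u))"
      using Suc.prems that assms(3) by (auto simp: frechet_derivative_works)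
    then show ?thesis by (rule has_derivative_compose)
  qed
  have eq: "dir_deriv (\<lambda>w. g (f w)) u v =
      (\<Sum>b\<in>Basis. (dir_deriv f u v \<bullet> b) *\<^sub>R dir_deriv g (f u) b)" if "u \<in> S" for u v
  proof -
    have "linear (dir_deriv g (f u))"
      using Suc.prems that assms(3) by (auto intro!: linear_frechet_derivative)
    then show ?thesis
      using dir_deriv_eqI[OF D[OF that]] linear_apply_Basis by metis
  qed
  have "Ck_on k S (\<lambda>u. \<Sum>b\<in>Basis. (dir_deriv f u v \<bullet> b) *\<^sub>R dir_deriv g (f u) b)" for v
    using Suc.prems Ck_on_SucD[OF Suc.prems(1)]
    by (intro Ck_on_sum Ck_on_bilinear[OF bounded_bilinear_scaleR] assms(1)
        Ck_on_compose_linear[OF bounded_linear_inner_left] Suc.IH) auto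
  then have "Ck_on k S (\<lambda>u. dir_deriv (\<lambda>w. g (f w)) u v)" for v
    using Ck_on_cong[OF assms(1), of "\<lambda>u. dir_deriv (\<lambda>w. g (f w)) u v", OF eq] by blast
  then show ?case using D by (auto simp: differentiable_def)
qed

lemma Ck_on_inverse:
  fixes f :: "'a::real_normed_vector \<Rightarrow> real"
  assumes "open S" "\<And>u. u \<in> S \<Longrightarrow> f u \<noteq> 0" "Ck_on k S f"
  shows "Ck_on k S (\<lambda>u. inverse (f u))"
  using assms(3)
proof (induction k)
  case 0
  then show ?case using assms(2) by (simp add: continuous_on_inverse)
next
  case (Suc k)
  have D: "((\<lambda>w. inverse (f w)) has_derivative
      (\<lambda>v. - (inverse (f u) * dir_deriv f u v * inverse (f u)))) (at u)" if "u \<in> S" for u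
  proof (rule Deriv.has_derivative_inverse)
    show "(f has_derivative dir_deriv f u) (at u)"
      using Suc.prems that by (simp add: frechet_derivative_works)
  qed (use assms(2) that in simp)
  have "Ck_on k S (\<lambda>u. - (inverse (f u) * dir_deriv f u v * inverse (f u)))" for v
  proof -
    have "Ck_on k S (\<lambda>u. inverse (f u))" using Suc.IH Ck_on_SucD[OF Suc.prems] .
    moreover have "Ck_on k S (\<lambda>u. dir_deriv f u v)" using Suc.prems by simp
    ultimately have "Ck_on k S (\<lambda>u. inverse (f u) * dir_deriv f u v * inverse (f u))"
      by (intro Ck_on_bilinear[OF bounded_bilinear_mult] assms(1))
    then show ?thesis
      using Ck_on_compose_linear[OF bounded_linear_minus[OF bounded_linear_ident] assms(1)] by blast
  qed
  then have "Ck_on k S (\<lambda>u. dir_deriv (\<lambda>w. inverse (f w)) u v)" for v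
    using Ck_on_cong[OF assms(1), of "\<lambda>u. dir_deriv (\<lambda>w. inverse (f w)) u v", OF dir_deriv_eqI[OF D]]
    by blast
  then show ?case using D by (auto simp: differentiable_def)
qed

lemma smooth_on_imp_Ck_on: "smooth_on S f \<Longrightarrow> Ck_on k S f"
  by (simp add: smooth_on_def)

lemma smooth_on_cong: "open S \<Longrightarrow> (\<And>w. w \<in> S \<Longrightarrow> f w = g w) \<Longrightarrow> smooth_on S f \<longleftrightarrow> smooth_on S g"
  unfolding smooth_on_def using Ck_on_cong by blast

lemma smooth_on_subset: "smooth_on S f \<Longrightarrow> T \<subseteq> S \<Longrightarrow> smooth_on T f"
  unfolding smooth_on_def using Ck_on_subset by blast

lemma smooth_on_has_derivative:
  "smooth_on S f \<Longrightarrow> u \<in> S \<Longrightarrow> (f has_derivative dir_deriv f u) (at u)"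
  using smooth_on_imp_Ck_on[of S f "Suc 0"] by (simp add: frechet_derivative_works)

lemma smooth_on_differentiable: "smooth_on S f \<Longrightarrow> u \<in> S \<Longrightarrow> f differentiable (at u)"
  using smooth_on_has_derivative by (auto simp: differentiable_def)

lemma smooth_on_continuous_on: "smooth_on S f \<Longrightarrow> continuous_on S f"
  using smooth_on_imp_Ck_on[of S f 0] by simp

lemma smooth_on_linear_dir_deriv: "smooth_on S f \<Longrightarrow> u \<in> S \<Longrightarrow> linear (dir_deriv f u)"
  using smooth_on_differentiable linear_frechet_derivative by blast

lemma smooth_on_dir_deriv_const: "smooth_on S f \<Longrightarrow> smooth_on S (\<lambda>u. dir_deriv f u v)"
  unfolding smooth_on_def by (metis Ck_on.simps(2))

lemma smooth_on_const: "smooth_on S (\<lambda>_. c)"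
  unfolding smooth_on_def using Ck_on_const by blast

lemma smooth_on_linear: "bounded_linear f \<Longrightarrow> smooth_on S f"
  unfolding smooth_on_def using Ck_on_linear by blast

lemma smooth_on_ident: "smooth_on S (\<lambda>u. u)"
  by (simp add: smooth_on_linear bounded_linear_ident)

lemma smooth_on_add: "open S \<Longrightarrow> smooth_on S f \<Longrightarrow> smooth_on S g \<Longrightarrow> smooth_on S (\<lambda>u. f u + g u)"
  unfolding smooth_on_def using Ck_on_add by blast

lemma smooth_on_bilinear: "bounded_bilinear B \<Longrightarrow> open S \<Longrightarrow> smooth_on S f \<Longrightarrow> smooth_on S g \<Longrightarrow>
    smooth_on S (\<lambda>u. B (f u) (g u))"
  unfolding smooth_on_def using Ck_on_bilinear by blast

lemma smooth_on_compose_linear: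
  "bounded_linear L \<Longrightarrow> open S \<Longrightarrow> smooth_on S f \<Longrightarrow> smooth_on S (\<lambda>u. L (f u))"
  unfolding smooth_on_def using Ck_on_compose_linear by blast

lemma smooth_on_compose:
  fixes f :: "'a::real_normed_vector \<Rightarrow> 'b::euclidean_space"
  shows "smooth_on T g \<Longrightarrow> open T \<Longrightarrow> open S \<Longrightarrow> smooth_on S f \<Longrightarrow> f ` S \<subseteq> T \<Longrightarrow>
    smooth_on S (\<lambda>u. g (f u))"
  unfolding smooth_on_def using Ck_on_compose by blast

lemma smooth_on_inverse:
  fixes f :: "'a::real_normed_vector \<Rightarrow> real"
  shows "open S \<Longrightarrow> smooth_on S f \<Longrightarrow> (\<And>u. u \<in> S \<Longrightarrow> f u \<noteq> 0) \<Longrightarrow> smooth_on S (\<lambda>u. inverse (f u))"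
  unfolding smooth_on_def using Ck_on_inverse by blast

lemma smooth_on_scaleR: "open S \<Longrightarrow> smooth_on S f \<Longrightarrow> smooth_on S g \<Longrightarrow> smooth_on S (\<lambda>u. f u *\<^sub>R g u)"
  by (rule smooth_on_bilinear[OF bounded_bilinear_scaleR])

lemma smooth_on_mult:
  fixes f :: "'a::real_normed_vector \<Rightarrow> real"
  shows "open S \<Longrightarrow> smooth_on S f \<Longrightarrow> smooth_on S g \<Longrightarrow> smooth_on S (\<lambda>u. f u * g u)"
  by (rule smooth_on_bilinear[OF bounded_bilinear_mult])

lemma smooth_on_minus: "open S \<Longrightarrow> smooth_on S f \<Longrightarrow> smooth_on S (\<lambda>u. - f u)"
  by (rule smooth_on_compose_linear[OF bounded_linear_minus[OF bounded_linear_ident]])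

lemma smooth_on_diff: "open S \<Longrightarrow> smooth_on S f \<Longrightarrow> smooth_on S g \<Longrightarrow> smooth_on S (\<lambda>u. f u - g u)"
  using smooth_on_add[of S f "\<lambda>u. - g u"] smooth_on_minus[of S g] by simp

lemma smooth_on_divide:
  fixes f :: "'a::real_normed_vector \<Rightarrow> real"
  shows "open S \<Longrightarrow> smooth_on S f \<Longrightarrow> smooth_on S g \<Longrightarrow> (\<And>u. u \<in> S \<Longrightarrow> g u \<noteq> 0) \<Longrightarrow>
    smooth_on S (\<lambda>u. f u / g u)"
  unfolding divide_inverse by (intro smooth_on_mult smooth_on_inverse)

lemma smooth_on_power:
  fixes f :: "'a::real_normed_vector \<Rightarrow> real"
  shows "open S \<Longrightarrow> smooth_on S f \<Longrightarrow> smooth_on S (\<lambda>u. f u ^ n)"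
  by (induction n) (auto intro: smooth_on_const smooth_on_mult)

lemma smooth_on_sum:
  "open S \<Longrightarrow> finite J \<Longrightarrow> (\<And>j. j \<in> J \<Longrightarrow> smooth_on S (f j)) \<Longrightarrow> smooth_on S (\<lambda>u. \<Sum>j\<in>J. f j u)"
  unfolding smooth_on_def using Ck_on_sum by blast

lemma smooth_on_vec_nth: "open S \<Longrightarrow> smooth_on S f \<Longrightarrow> smooth_on S (\<lambda>u. f u $ i)"
  by (rule smooth_on_compose_linear[OF bounded_linear_vec_nth])

lemma smooth_on_dir_deriv:
  fixes X :: "'a::euclidean_space \<Rightarrow> 'a"
  assumes "open S" "smooth_on S f" "smooth_on S X"
  shows "smooth_on S (\<lambda>u. dir_deriv f u (X u))"
proof (subst smooth_on_cong[OF assms(1)])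
  show "dir_deriv f u (X u) = (\<Sum>b\<in>Basis. (X u \<bullet> b) *\<^sub>R dir_deriv f u b)" if "u \<in> S" for u
    using linear_apply_Basis smooth_on_linear_dir_deriv[OF assms(2) that] by blast
  show "smooth_on S (\<lambda>u. \<Sum>b\<in>Basis. (X u \<bullet> b) *\<^sub>R dir_deriv f u b)"
    using assms by (intro smooth_on_sum smooth_on_scaleR smooth_on_dir_deriv_const
        smooth_on_compose_linear[OF bounded_linear_inner_left]) auto
qed

section \<open>Symmetry of second derivatives\<close>

lemma has_vector_derivative_along_line:
  assumes "A differentiable (at (y + x *\<^sub>R e))"
  shows "((\<lambda>x. A (y + x *\<^sub>R e)) has_vector_derivative dir_deriv A (y + x *\<^sub>R e) e) (at x within T)"
proof -
  have "((\<lambda>x. y + x *\<^sub>R e) has_derivative (\<lambda>r. r *\<^sub>R e)) (at x within T)"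
    by (auto intro!: derivative_eq_intros)
  from has_derivative_compose[OF this assms[unfolded frechet_derivative_works]] show ?thesis
    by (simp add: has_vector_derivative_def linear_cmul[OF linear_frechet_derivative[OF assms]])
qed

text \<open>The second difference over a parallelogram does not depend on the order of
  \<open>v\<close> and \<open>w\<close>. The mean value theorem, first in direction \<open>v\<close>
  for the increment along \<open>w\<close> and then in direction \<open>w\<close>, turns it into one
  mixed derivative; exchanging \<open>v\<close> and \<open>w\<close> gives the other.\<close>

lemma second_difference_mean_value:
  fixes g :: "'a::real_normed_vector \<Rightarrow> real"
  assumes "open S" "Ck_on 2 S g" "h > 0"
    and inS: "\<And>x y. 0 \<le> x \<Longrightarrow> x \<le> h \<Longrightarrow> 0 \<le> y \<Longrightarrow> y \<le> h \<Longrightarrow> u + x *\<^sub>R v + y *\<^sub>R w \<in> S"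
  obtains \<xi> \<eta> where "0 < \<xi>" "\<xi> < h" "0 < \<eta>" "\<eta> < h"
    "g (u + h *\<^sub>R v + h *\<^sub>R w) - g (u + h *\<^sub>R v) - g (u + h *\<^sub>R w) + g u =
      h\<^sup>2 * dir_deriv (\<lambda>z. dir_deriv g z v) (u + \<xi> *\<^sub>R v + \<eta> *\<^sub>R w) w"
proof -
  have dg: "g differentiable (at z)" "(\<lambda>z. dir_deriv g z v) differentiable (at z)" if "z \<in> S" for z
    using assms(2) that by (simp_all add: numeral_2_eq_2)
  have real_derivative: "((\<lambda>x. A (z + x *\<^sub>R e)) has_real_derivative dir_deriv A (z + x *\<^sub>R e) e) (at x)"
    if "A differentiable (at (z + x *\<^sub>R e))" for A :: "'a \<Rightarrow> real" and z x e
    using has_vector_derivative_along_line[OF that]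
    by (simp add: has_real_derivative_iff_has_vector_derivative)
  have inS': "u + h *\<^sub>R w + x *\<^sub>R v \<in> S" "u + x *\<^sub>R v \<in> S" if "0 \<le> x" "x \<le> h" for x
    using inS[OF that, of h] inS[OF that, of 0] assms(3) by (simp_all add: algebra_simps)
  let ?F = "\<lambda>x. g (u + h *\<^sub>R w + x *\<^sub>R v) - g (u + x *\<^sub>R v)"
  have 1: "(?F has_real_derivative dir_deriv g (u + h *\<^sub>R w + x *\<^sub>R v) v - dir_deriv g (u + x *\<^sub>R v) v) (at x)"
    if "0 \<le> x" "x \<le> h" for x
    by (intro DERIV_diff real_derivative dg inS' that)
  obtain \<xi> where \<xi>: "0 < \<xi>" "\<xi> < h"
    "?F h - ?F 0 = (h - 0) * (dir_deriv g (u + h *\<^sub>R w + \<xi> *\<^sub>R v) v - dir_deriv g (u + \<xi> *\<^sub>R v) v)"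
    using MVT2[OF assms(3) 1] by blast
  let ?G = "\<lambda>y. dir_deriv g (u + \<xi> *\<^sub>R v + y *\<^sub>R w) v"
  have 2: "(?G has_real_derivative dir_deriv (\<lambda>z. dir_deriv g z v) (u + \<xi> *\<^sub>R v + y *\<^sub>R w) w) (at y)"
    if "0 \<le> y" "y \<le> h" for y
    using inS[OF _ _ that, of \<xi>] \<xi> by (intro real_derivative[of "\<lambda>z. dir_deriv g z v"] dg) simp
  obtain \<eta> where \<eta>: "0 < \<eta>" "\<eta> < h" "?G h - ?G 0 = (h - 0) * dir_deriv (\<lambda>z. dir_deriv g z v) (u + \<xi> *\<^sub>R v + \<eta> *\<^sub>R w) w"
    using MVT2[OF assms(3) 2] by blast
  show thesis
  proof (rule that[OF \<xi>(1,2) \<eta>(1,2)])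
    have "g (u + h *\<^sub>R v + h *\<^sub>R w) - g (u + h *\<^sub>R v) - g (u + h *\<^sub>R w) + g u = ?F h - ?F 0"
      by (simp add: add_ac)
    also have "\<dots> = h * (?G h - ?G 0)" using \<xi>(3) by (simp add: add_ac)
    finally show "g (u + h *\<^sub>R v + h *\<^sub>R w) - g (u + h *\<^sub>R v) - g (u + h *\<^sub>R w) + g u =
      h\<^sup>2 * dir_deriv (\<lambda>z. dir_deriv g z v) (u + \<xi> *\<^sub>R v + \<eta> *\<^sub>R w) w"
      unfolding \<eta>(3) by (simp add: power2_eq_square)
  qed
qed

lemma dir_deriv_commute_real:
  fixes g :: "'a::real_normed_vector \<Rightarrow> real"
  assumes "open S" "Ck_on 2 S g" "u \<in> S"
  shows "dir_deriv (\<lambda>z. dir_deriv g z v) u w = dir_deriv (\<lambda>z. dir_deriv g z w) u v"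
proof (rule ccontr)
  let ?P = "\<lambda>z. dir_deriv (\<lambda>z. dir_deriv g z v) z w"
  let ?Q = "\<lambda>z. dir_deriv (\<lambda>z. dir_deriv g z w) z v"
  assume neq: "?P u \<noteq> ?Q u"
  \<comment> \<open>Half the gap: two values that are within \<open>e\<close> of the two limits
    cannot coincide.\<close>
  define e where "e = \<bar>?P u - ?Q u\<bar> / 2"
  have e: "e > 0" using neq by (simp add: e_def)
  have "continuous_on S ?P" "continuous_on S ?Q"
    using assms(2) by (simp_all add: numeral_2_eq_2)
  then have "(?P \<longlongrightarrow> ?P u) (nhds u)" "(?Q \<longlongrightarrow> ?Q u) (nhds u)"
    using assms(1,3) continuous_on_eq_continuous_at[OF assms(1)]
    by (auto simp: isCont_def tendsto_at_iff_tendsto_nhds)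
  then have "\<forall>\<^sub>F z in nhds u. dist (?P z) (?P u) < e \<and> dist (?Q z) (?Q u) < e \<and> z \<in> S"
    using e assms(1,3) 
    by (intro eventually_conj tendstoD eventually_nhds_in_open) auto
  then obtain d where d: "d > 0"
    and near: "\<And>z. dist z u < d \<Longrightarrow> dist (?P z) (?P u) < e \<and> dist (?Q z) (?Q u) < e \<and> z \<in> S"
    unfolding eventually_nhds_metric by blast
  \<comment> \<open>This size keeps the whole parallelogram inside the ball of radius
    \<open>d\<close>; the summand 1 covers the case \<open>v = w = 0\<close>.\<close>
  define h where "h = d / (norm v + norm w + 1)"
  have h: "h > 0" and hd: "h * (norm v + norm w) < d"
  proof -
    have pos: "norm v + norm w + 1 > 0" by (simp add: add_nonneg_pos)
    then show "h > 0" using d by (simp add: h_def)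
    then have "h * (norm v + norm w) < h * (norm v + norm w + 1)" by simp
    also have "\<dots> = d" using pos by (simp add: h_def)
    finally show "h * (norm v + norm w) < d" .
  qed
  have dz: "dist (u + x *\<^sub>R v + y *\<^sub>R w) u < d" if "0 \<le> x" "x \<le> h" "0 \<le> y" "y \<le> h" for x y
  proof -
    have "dist (u + x *\<^sub>R v + y *\<^sub>R w) u = norm (x *\<^sub>R v + y *\<^sub>R w)"
      by (simp add: dist_norm algebra_simps)
    also have "\<dots> \<le> x * norm v + y * norm w"
      using norm_triangle_ineq[of "x *\<^sub>R v" "y *\<^sub>R w"] that by simp
    also have "\<dots> \<le> h * norm v + h * norm w"
      using that by (intro add_mono mult_right_mono) auto
    finally show ?thesis using hd by (simp add: algebra_simps)
  qed
  have inS: "u + x *\<^sub>R v + y *\<^sub>R w \<in> S" if "0 \<le> x" "x \<le> h" "0 \<le> y" "y \<le> h" for x y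
    using near[OF dz[OF that]] by blast
  have inS': "u + x *\<^sub>R w + y *\<^sub>R v \<in> S" if "0 \<le> x" "x \<le> h" "0 \<le> y" "y \<le> h" for x y
    using inS[OF that(3,4,1,2)] by (simp add: algebra_simps)
  obtain x y where xy: "0 < x" "x < h" "0 < y" "y < h"
    "g (u + h *\<^sub>R v + h *\<^sub>R w) - g (u + h *\<^sub>R v) - g (u + h *\<^sub>R w) + g u = h\<^sup>2 * ?P (u + x *\<^sub>R v + y *\<^sub>R w)"
    using second_difference_mean_value[OF assms(1,2) h inS] .
  obtain x' y' where xy': "0 < x'" "x' < h" "0 < y'" "y' < h"
    "g (u + h *\<^sub>R w + h *\<^sub>R v) - g (u + h *\<^sub>R w) - g (u + h *\<^sub>R v) + g u = h\<^sup>2 * ?Q (u + x' *\<^sub>R w + y' *\<^sub>R v)"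
    using second_difference_mean_value[OF assms(1,2) h inS'] .
  have "h\<^sup>2 * ?P (u + x *\<^sub>R v + y *\<^sub>R w) = h\<^sup>2 * ?Q (u + y' *\<^sub>R v + x' *\<^sub>R w)"
    using xy(5) xy'(5) by (simp add: algebra_simps)
  then have "?P (u + x *\<^sub>R v + y *\<^sub>R w) = ?Q (u + y' *\<^sub>R v + x' *\<^sub>R w)" using h by simp
  moreover have "dist (?P (u + x *\<^sub>R v + y *\<^sub>R w)) (?P u) < e"
    using near dz xy by (meson less_imp_le)
  moreover have "dist (?Q (u + y' *\<^sub>R v + x' *\<^sub>R w)) (?Q u) < e"
    using near dz xy' by (meson less_imp_le)
  ultimately show False unfolding e_def dist_real_def by (simp add: abs_if split: if_splits)
qed

lemma dir_deriv_commute: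
  fixes g :: "'a::real_normed_vector \<Rightarrow> 'b::euclidean_space"
  assumes "open S" "smooth_on S g" "u \<in> S"
  shows "dir_deriv (\<lambda>z. dir_deriv g z v) u w = dir_deriv (\<lambda>z. dir_deriv g z w) u v"
proof (rule euclidean_eqI)
  fix b :: 'b
  have 1: "dir_deriv (\<lambda>z. k z \<bullet> b) z v = dir_deriv k z v \<bullet> b" if "smooth_on S k" "z \<in> S"
    for k z v
    by (intro dir_deriv_eqI has_derivative_inner_left smooth_on_has_derivative[OF that])
  have 2: "dir_deriv (\<lambda>z. dir_deriv (\<lambda>z. g z \<bullet> b) z v) u w = dir_deriv (\<lambda>z. dir_deriv g z v) u w \<bullet> b" for v w
    using 1[OF smooth_on_dir_deriv_const[OF assms(2)] assms(3)]
    by (subst dir_deriv_cong[OF assms(1,3) 1[OF assms(2)]])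
  have "Ck_on 2 S (\<lambda>z. g z \<bullet> b)"
    using assms by (intro smooth_on_imp_Ck_on smooth_on_compose_linear[OF bounded_linear_inner_left])
  then show "dir_deriv (\<lambda>z. dir_deriv g z v) u w \<bullet> b = dir_deriv (\<lambda>z. dir_deriv g z w) u v \<bullet> b"
    using dir_deriv_commute_real[OF assms(1) _ assms(3), of _ v w] 2 by metis
qed

section \<open>Directional derivatives of algebraic expressions\<close>

lemma dir_deriv_has_derivative: "f differentiable (at u) \<Longrightarrow> (f has_derivative dir_deriv f u) (at u)"
  by (simp add: frechet_derivative_works)

lemma dir_deriv_add:
  "f differentiable (at u) \<Longrightarrow> g differentiable (at u) \<Longrightarrow>
    dir_deriv (\<lambda>w. f w + g w) u v = dir_deriv f u v + dir_deriv g u v"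
  by (intro dir_deriv_eqI has_derivative_add dir_deriv_has_derivative)

lemma dir_deriv_diff:
  "f differentiable (at u) \<Longrightarrow> g differentiable (at u) \<Longrightarrow>
    dir_deriv (\<lambda>w. f w - g w) u v = dir_deriv f u v - dir_deriv g u v"
  by (intro dir_deriv_eqI has_derivative_diff dir_deriv_has_derivative)

lemma dir_deriv_bilinear:
  assumes "bounded_bilinear B" "f differentiable (at u)" "g differentiable (at u)"
  shows "dir_deriv (\<lambda>w. B (f w) (g w)) u v = B (f u) (dir_deriv g u v) + B (dir_deriv f u v) (g u)"
  using bounded_bilinear.FDERIV[OF assms(1) dir_deriv_has_derivative[OF assms(2)]
      dir_deriv_has_derivative[OF assms(3)]]
  by (rule dir_deriv_eqI)

lemma dir_deriv_scaleR:
  "f differentiable (at u) \<Longrightarrow> g differentiable (at u) \<Longrightarrow>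
    dir_deriv (\<lambda>w. f w *\<^sub>R g w) u v = f u *\<^sub>R dir_deriv g u v + dir_deriv f u v *\<^sub>R g u"
  by (rule dir_deriv_bilinear[OF bounded_bilinear_scaleR])

lemma dir_deriv_mult:
  fixes f :: "'a::real_normed_vector \<Rightarrow> real"
  shows "f differentiable (at u) \<Longrightarrow> g differentiable (at u) \<Longrightarrow>
    dir_deriv (\<lambda>w. f w * g w) u v = f u * dir_deriv g u v + dir_deriv f u v * g u"
  by (rule dir_deriv_bilinear[OF bounded_bilinear_mult])

lemma dir_deriv_divide:
  fixes f :: "'a::real_normed_vector \<Rightarrow> real"
  assumes "f differentiable (at u)" "g differentiable (at u)" "g u \<noteq> 0"
  shows "dir_deriv (\<lambda>w. f w / g w) u v = (dir_deriv f u v * g u - f u * dir_deriv g u v) / (g u)\<^sup>2"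
proof -
  have "dir_deriv (\<lambda>w. f w / g w) u v =
      - f u * (inverse (g u) * dir_deriv g u v * inverse (g u)) + dir_deriv f u v / g u"
    by (intro dir_deriv_eqI has_derivative_divide[OF dir_deriv_has_derivative[OF assms(1)]
          dir_deriv_has_derivative[OF assms(2)] assms(3)])
  then show ?thesis
    using assms(3) by (simp add: field_simps power2_eq_square)
qed

lemma dir_deriv_linear: "bounded_linear L \<Longrightarrow> f differentiable (at u) \<Longrightarrow>
    dir_deriv (\<lambda>w. L (f w)) u v = L (dir_deriv f u v)"
  using bounded_linear.has_derivative[OF _ dir_deriv_has_derivative] by (rule dir_deriv_eqI)

lemma dir_deriv_compose:
  assumes "g differentiable (at (f u))" "f differentiable (at u)"
  shows "dir_deriv (\<lambda>w. g (f w)) u v = dir_deriv g (f u) (dir_deriv f u v)"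
  using has_derivative_compose[OF dir_deriv_has_derivative[OF assms(2)]
      dir_deriv_has_derivative[OF assms(1)]]
  by (rule dir_deriv_eqI)

section \<open>The pseudo-Euclidean inner product\<close>

lemma bounded_bilinear_pe_inner: "bounded_bilinear pe_inner"
  unfolding bilinear_conv_bounded_bilinear[symmetric] bilinear_def
  by (auto intro!: linearI simp: pe_inner_def algebra_simps)

lemmas pe_inner_simps =
  bounded_bilinear.add_left[OF bounded_bilinear_pe_inner]
  bounded_bilinear.add_right[OF bounded_bilinear_pe_inner]
  bounded_bilinear.diff_left[OF bounded_bilinear_pe_inner]
  bounded_bilinear.diff_right[OF bounded_bilinear_pe_inner]
  bounded_bilinear.minus_left[OF bounded_bilinear_pe_inner]
  bounded_bilinear.minus_right[OF bounded_bilinear_pe_inner]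
  bounded_bilinear.scaleR_left[OF bounded_bilinear_pe_inner]
  bounded_bilinear.scaleR_right[OF bounded_bilinear_pe_inner]
  bounded_bilinear.zero_left[OF bounded_bilinear_pe_inner]
  bounded_bilinear.zero_right[OF bounded_bilinear_pe_inner]

lemma pe_inner_commute: "\<langle>v, w\<rangle> = \<langle>w, v\<rangle>"
  by (simp add: pe_inner_def mult.commute)

lemma smooth_on_pe_inner: "open S \<Longrightarrow> smooth_on S f \<Longrightarrow> smooth_on S g \<Longrightarrow> smooth_on S (\<lambda>u. \<langle>f u, g u\<rangle>)"
  by (rule smooth_on_bilinear[OF bounded_bilinear_pe_inner])

lemma dir_deriv_pe_inner:
  "f differentiable (at u) \<Longrightarrow> g differentiable (at u) \<Longrightarrow>
    dir_deriv (\<lambda>w. \<langle>f w, g w\<rangle>) u v = \<langle>f u, dir_deriv g u v\<rangle> + \<langle>dir_deriv f u v, g u\<rangle>"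
  by (rule dir_deriv_bilinear[OF bounded_bilinear_pe_inner])

lemma exhaust_5:
  fixes i :: 5
  shows "i = 1 \<or> i = 2 \<or> i = 3 \<or> i = 4 \<or> i = 5"
proof (induct i)
  case (of_int z)
  then have "z = 0 \<or> z = 1 \<or> z = 2 \<or> z = 3 \<or> z = 4" by (simp, arith)
  then show ?case by auto
qed

lemma forall_5: "(\<forall>i::5. P i) \<longleftrightarrow> P 1 \<and> P 2 \<and> P 3 \<and> P 4 \<and> P 5"
  by (metis exhaust_5)

lemma pe_inner_nondegenerate:
  assumes "\<And>w. \<langle>v, w\<rangle> = 0"
  shows "v = 0"
proof -
  have "v $ i = 0" for i
    using assms[of "axis i 1"] exhaust_5[of i] by (auto simp: pe_inner_def axis_def)
  then show ?thesis by (simp add: vec_eq_iff)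
qed

definition null_frame :: "real^5 \<Rightarrow> real^5 \<Rightarrow> real^5 \<Rightarrow> real^5 \<Rightarrow> real^5 \<Rightarrow> bool"
  where "null_frame f1 f2 f3 f4 f \<longleftrightarrow>
      \<langle>f1, f2\<rangle> = -1 \<and> \<langle>f1, f1\<rangle> = 0 \<and> \<langle>f2, f2\<rangle> = 0 \<and>
      \<langle>f3, f4\<rangle> = -1 \<and> \<langle>f3, f3\<rangle> = 0 \<and> \<langle>f4, f4\<rangle> = 0 \<and>
      \<langle>f1, f3\<rangle> = 0 \<and> \<langle>f1, f4\<rangle> = 0 \<and> \<langle>f2, f3\<rangle> = 0 \<and> \<langle>f2, f4\<rangle> = 0 \<and>
      \<langle>f1, f\<rangle> = 0 \<and> \<langle>f2, f\<rangle> = 0 \<and> \<langle>f3, f\<rangle> = 0 \<and> \<langle>f4, f\<rangle> = 0 \<and> \<langle>f, f\<rangle> = 1"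

lemma null_frame_inner:
  assumes "null_frame f1 f2 f3 f4 f"
  shows "\<langle>f1, f2\<rangle> = -1" "\<langle>f2, f1\<rangle> = -1" "\<langle>f1, f1\<rangle> = 0" "\<langle>f2, f2\<rangle> = 0"
    "\<langle>f3, f4\<rangle> = -1" "\<langle>f4, f3\<rangle> = -1" "\<langle>f3, f3\<rangle> = 0" "\<langle>f4, f4\<rangle> = 0"
    "\<langle>f1, f3\<rangle> = 0" "\<langle>f3, f1\<rangle> = 0" "\<langle>f1, f4\<rangle> = 0" "\<langle>f4, f1\<rangle> = 0"
    "\<langle>f2, f3\<rangle> = 0" "\<langle>f3, f2\<rangle> = 0" "\<langle>f2, f4\<rangle> = 0" "\<langle>f4, f2\<rangle> = 0"
    "\<langle>f1, f\<rangle> = 0" "\<langle>f, f1\<rangle> = 0" "\<langle>f2, f\<rangle> = 0" "\<langle>f, f2\<rangle> = 0"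
    "\<langle>f3, f\<rangle> = 0" "\<langle>f, f3\<rangle> = 0" "\<langle>f4, f\<rangle> = 0" "\<langle>f, f4\<rangle> = 0" "\<langle>f, f\<rangle> = 1"
  using assms unfolding null_frame_def by (auto simp: pe_inner_commute)

text \<open>The basis dual to a null pair consists of its members interchanged and negated, which is
  why the coefficients cross over. The products recover all five coordinates, so the five vectors
  are independent and hence span the space.\<close>

lemma null_frame_expand:
  assumes "null_frame f1 f2 f3 f4 f"
  shows "v = - \<langle>v, f2\<rangle> *\<^sub>R f1 - \<langle>v, f1\<rangle> *\<^sub>R f2 - \<langle>v, f4\<rangle> *\<^sub>R f3 - \<langle>v, f3\<rangle> *\<^sub>R f4 + \<langle>v, f\<rangle> *\<^sub>R f"
proof -
  note prods = null_frame_inner[OF assms]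
  define L :: "real^5 \<Rightarrow> real^5" where
    "L c = c$1 *\<^sub>R f1 + c$2 *\<^sub>R f2 + c$3 *\<^sub>R f3 + c$4 *\<^sub>R f4 + c$5 *\<^sub>R f" for c
  have lin: "linear L"
    by (rule linearI) (simp_all add: L_def algebra_simps)
  have coef: "c$1 = - \<langle>L c, f2\<rangle>" "c$2 = - \<langle>L c, f1\<rangle>" "c$3 = - \<langle>L c, f4\<rangle>" "c$4 = - \<langle>L c, f3\<rangle>"
    "c$5 = \<langle>L c, f\<rangle>" for c
    by (simp_all add: L_def pe_inner_simps prods)
  have "inj L"
  proof (rule injI)
    fix c d assume "L c = L d"
    then have "c$1 = d$1" "c$2 = d$2" "c$3 = d$3" "c$4 = d$4" "c$5 = d$5"
      by (metis coef)+
    then show "c = d" by (simp add: vec_eq_iff forall_5)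
  qed
  then have "surj L" using linear_injective_imp_surjective lin by blast
  then obtain c where c: "v = L c" by blast
  have "v = c$1 *\<^sub>R f1 + c$2 *\<^sub>R f2 + c$3 *\<^sub>R f3 + c$4 *\<^sub>R f4 + c$5 *\<^sub>R f"
    using c L_def by simp
  then show ?thesis unfolding coef[of c] c[symmetric] by simp
qed

lemma null_frame_eqI:
  assumes "null_frame f1 f2 f3 f4 f" "\<langle>v, f1\<rangle> = \<langle>w, f1\<rangle>" "\<langle>v, f2\<rangle> = \<langle>w, f2\<rangle>" "\<langle>v, f3\<rangle> = \<langle>w, f3\<rangle>"
    "\<langle>v, f4\<rangle> = \<langle>w, f4\<rangle>" "\<langle>v, f\<rangle> = \<langle>w, f\<rangle>"
  shows "v = w"
  using null_frame_expand[OF assms(1), of v] null_frame_expand[OF assms(1), of w] assms(2-) by metis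

text \<open>Injective by nondegeneracy, hence bijective in finite dimension. The inverse serves to
  move an isometry from the surface to the generating curve.\<close>

lemma linear_isometry_inverse:
  assumes "linear_isometry A"
  obtains B where "linear_isometry B" "\<And>v. B (A v) = v" "\<And>v. A (B v) = v"
proof -
  have lin: "linear A" and iso: "\<And>v w. \<langle>A v, A w\<rangle> = \<langle>v, w\<rangle>"
    using assms by (auto simp: linear_isometry_def)
  have "inj A"
    unfolding linear_injective_0[OF lin]
    using pe_inner_nondegenerate iso bounded_bilinear.zero_left[OF bounded_bilinear_pe_inner] by metis
  then have "bij A" using linear_injective_imp_surjective[OF lin] by (simp add: bij_def)
  then have inv: "\<And>v. inv A (A v) = v" "\<And>v. A (inv A v) = v"
    by (auto simp: bij_is_inj bij_is_surj surj_f_inv_f)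
  have "linear (inv A)"
  proof (rule linearI)
    show "inv A (v + w) = inv A v + inv A w" for v w
      using inv linear_add[OF lin] by metis
    show "inv A (c *\<^sub>R v) = c *\<^sub>R inv A v" for c v
      using inv linear_cmul[OF lin] by metis
  qed
  moreover have "\<langle>inv A v, inv A w\<rangle> = \<langle>v, w\<rangle>" for v w
    using iso[of "inv A v" "inv A w"] by (simp add: inv)
  ultimately have "linear_isometry (inv A)" by (simp add: linear_isometry_def)
  then show thesis using that inv by blast
qed

section \<open>Lorentzian patches in the pseudosphere\<close>

text \<open>\<open>matrix_inv\<close> is defined by choice: once the adjugate formula provides a
  two-sided inverse, the chosen matrix is one too, and such an inverse is unique.\<close>

lemma matrix_inv_2:
  fixes M :: "real^2^2"
  assumes "det M \<noteq> 0"
  shows "matrix_inv M $ 1 $ 1 = M$2$2 / det M" "matrix_inv M $ 1 $ 2 = - M$1$2 / det M"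
    "matrix_inv M $ 2 $ 1 = - M$2$1 / det M" "matrix_inv M $ 2 $ 2 = M$1$1 / det M"
proof -
  define d where "d = inverse (det M)"
  have d: "(M$1$1 * M$2$2 - M$1$2 * M$2$1) * d = 1" using assms by (simp add: det_2 d_def)
  define N :: "real^2^2" where
    "N = (\<chi> i j. if i = 1 then if j = 1 then M$2$2 * d else - M$1$2 * d
                 else if j = 1 then - M$2$1 * d else M$1$1 * d)"
  have N: "N$1$1 = M$2$2 * d" "N$1$2 = - M$1$2 * d" "N$2$1 = - M$2$1 * d" "N$2$2 = M$1$1 * d"
    by (simp_all add: N_def)
  have "M$1$1 * N$1$1 + M$1$2 * N$2$1 = 1" "M$1$1 * N$1$2 + M$1$2 * N$2$2 = 0"
    "M$2$1 * N$1$1 + M$2$2 * N$2$1 = 0" "M$2$1 * N$1$2 + M$2$2 * N$2$2 = 1"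
    "N$1$1 * M$1$1 + N$1$2 * M$2$1 = 1" "N$1$1 * M$1$2 + N$1$2 * M$2$2 = 0"
    "N$2$1 * M$1$1 + N$2$2 * M$2$1 = 0" "N$2$1 * M$1$2 + N$2$2 * M$2$2 = 1"
    unfolding N using d by algebra+
  then have "M ** N = mat 1" "N ** M = mat 1"
    by (simp_all add: vec_eq_iff forall_2 matrix_matrix_mult_def sum_2 mat_def)
  then have "M ** matrix_inv M = mat 1 \<and> matrix_inv M ** M = mat 1"
    unfolding matrix_inv_def by (metis (mono_tags, lifting) someI)
  then have "matrix_inv M = N"
    using \<open>N ** M = mat 1\<close> matrix_mul_assoc matrix_mul_lid matrix_mul_rid by metis
  then show "matrix_inv M $ 1 $ 1 = M$2$2 / det M" "matrix_inv M $ 1 $ 2 = - M$1$2 / det M"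
    "matrix_inv M $ 2 $ 1 = - M$2$1 / det M" "matrix_inv M $ 2 $ 2 = M$1$1 / det M"
    by (simp_all add: N d_def divide_inverse)
qed

lemma vec2_expand: "(v::real^2) = v$1 *\<^sub>R axis 1 1 + v$2 *\<^sub>R axis 2 (1::real)"
  by (simp add: vec_eq_iff forall_2 axis_def)

lemma linear_vec2:
  fixes L :: "real^2 \<Rightarrow> 'b::real_vector"
  assumes "linear L"
  shows "L Z = Z$1 *\<^sub>R L (axis 1 1) + Z$2 *\<^sub>R L (axis 2 1)"
  using linear_add[OF assms] linear_cmul[OF assms] vec2_expand[of Z] by metis

text \<open>In coordinates this is the product rule for coefficients times partial derivatives. When
  \<open>g\<close> is the immersion the first term is tangential, so the second fundamental form
  sees only the value of \<open>W\<close> at the point.\<close>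

lemma dir_deriv_along_field:
  fixes g :: "real^2 \<Rightarrow> 'b::real_normed_vector"
  assumes S: "open S" "u \<in> S" and g: "smooth_on S g" and W: "smooth_on S W"
  shows "dir_deriv (\<lambda>w. dir_deriv g w (W w)) u X =
    dir_deriv g u (dir_deriv W u X) + dir_deriv (\<lambda>w. dir_deriv g w (W u)) u X"
proof -
  have diff: "(\<lambda>w. W w $ i) differentiable (at u)" "(\<lambda>w. dir_deriv g w (axis i 1)) differentiable (at u)"
    "(\<lambda>w. W w $ i *\<^sub>R dir_deriv g w (axis i 1)) differentiable (at u)"
    "(\<lambda>w. c *\<^sub>R dir_deriv g w (axis i 1)) differentiable (at u)" for i c
    using S g W by (auto intro!: smooth_on_differentiable[OF _ S(2)] smooth_on_vec_nth
        smooth_on_dir_deriv_const smooth_on_scaleR smooth_on_const)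
  have g2: "dir_deriv g w Z = Z$1 *\<^sub>R dir_deriv g w (axis 1 1) + Z$2 *\<^sub>R dir_deriv g w (axis 2 1)" if "w \<in> S" for w Z
    by (rule linear_vec2[OF smooth_on_linear_dir_deriv[OF g that]])
  have eqs: "dir_deriv (\<lambda>w. dir_deriv g w (W w)) u X =
      dir_deriv (\<lambda>w. W w $ 1 *\<^sub>R dir_deriv g w (axis 1 1) + W w $ 2 *\<^sub>R dir_deriv g w (axis 2 1)) u X"
    "dir_deriv (\<lambda>w. dir_deriv g w (W u)) u X =
      dir_deriv (\<lambda>w. W u $ 1 *\<^sub>R dir_deriv g w (axis 1 1) + W u $ 2 *\<^sub>R dir_deriv g w (axis 2 1)) u X"
    by (rule dir_deriv_transfer[OF S], rule g2, assumption)+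
  have "dir_deriv (\<lambda>w. dir_deriv g w (W w)) u X =
      (W u $ 1 *\<^sub>R dir_deriv (\<lambda>w. dir_deriv g w (axis 1 1)) u X + dir_deriv W u X $ 1 *\<^sub>R dir_deriv g u (axis 1 1))
      + (W u $ 2 *\<^sub>R dir_deriv (\<lambda>w. dir_deriv g w (axis 2 1)) u X + dir_deriv W u X $ 2 *\<^sub>R dir_deriv g u (axis 2 1))"
    unfolding eqs
    by (simp add: dir_deriv_add dir_deriv_scaleR diff
        dir_deriv_linear[OF bounded_linear_vec_nth smooth_on_differentiable[OF W S(2)]])
  moreover have "dir_deriv (\<lambda>w. dir_deriv g w (W u)) u X =
      W u $ 1 *\<^sub>R dir_deriv (\<lambda>w. dir_deriv g w (axis 1 1)) u X + W u $ 2 *\<^sub>R dir_deriv (\<lambda>w. dir_deriv g w (axis 2 1)) u X"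
    unfolding eqs by (simp add: dir_deriv_add dir_deriv_scaleR diff)
  ultimately show ?thesis
    using g2[OF S(2), of "dir_deriv W u X"] by simp
qed

lemma dir_deriv_fields_commute:
  fixes g :: "real^2 \<Rightarrow> 'b::euclidean_space"
  assumes S: "open S" "u \<in> S" and g: "smooth_on S g" and XY: "smooth_on S X" "smooth_on S Y"
  shows "dir_deriv (\<lambda>w. dir_deriv g w (Y w)) u (X u) - dir_deriv (\<lambda>w. dir_deriv g w (X w)) u (Y u)
    = dir_deriv g u (lie_bracket X Y u)"
  using dir_deriv_along_field[OF S g XY(1)] dir_deriv_along_field[OF S g XY(2)]
    dir_deriv_commute[OF S(1) g S(2)] linear_diff[OF smooth_on_linear_dir_deriv[OF g S(2)]]
  by (simp add: lie_bracket_def)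

text \<open>The data left of a surface once a parametrization is fixed; \<open>f\<close> stands for
  \<open>\<phi> \<circ> \<psi>\<close>.\<close>

locale lorentzian_patch =
  fixes V :: "(real^2) set" and f :: "real^2 \<Rightarrow> real^5"
  assumes open_V: "open V"
    and smooth: "smooth_on V f"
    and sphere: "u \<in> V \<Longrightarrow> \<langle>f u, f u\<rangle> = 1"
    and lorentzian: "u \<in> V \<Longrightarrow> lorentzian_at f u"
begin

abbreviation "gram u \<equiv> first_ff f u (axis 1 1) (axis 1 1) * first_ff f u (axis 2 1) (axis 2 1)
  - (first_ff f u (axis 1 1) (axis 2 1))\<^sup>2"

lemma linear_df: "u \<in> V \<Longrightarrow> linear (dir_deriv f u)"
  by (rule smooth_on_linear_dir_deriv[OF smooth])

lemma df_expand: "u \<in> V \<Longrightarrow> dir_deriv f u Z = Z$1 *\<^sub>R dir_deriv f u (axis 1 1) + Z$2 *\<^sub>R dir_deriv f u (axis 2 1)"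
  using linear_add[OF linear_df] linear_cmul[OF linear_df] vec2_expand[of Z] by metis

lemma first_ff_commute: "first_ff f u X Y = first_ff f u Y X"
  by (simp add: first_ff_def pe_inner_commute)

text \<open>A Gram determinant scales by the squared determinant of the coordinates. For a
  pseudo-orthonormal pair the left side is -1, so \<open>gram\<close> cannot vanish; for a null pair
  it is -1 as well.\<close>

lemma gram_change:
  assumes "u \<in> V"
  shows "first_ff f u X X * first_ff f u Y Y - (first_ff f u X Y)\<^sup>2 = (X$1 * Y$2 - X$2 * Y$1)\<^sup>2 * gram u"
  unfolding first_ff_def df_expand[OF assms, of X] df_expand[OF assms, of Y]
  by (simp add: pe_inner_simps pe_inner_commute[of "dir_deriv f u (axis 2 1)" "dir_deriv f u (axis 1 1)"])
    (simp add: algebra_simps power2_eq_square)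

lemma gram_nonzero: "u \<in> V \<Longrightarrow> gram u \<noteq> 0"
proof
  assume u: "u \<in> V" and 0: "gram u = 0"
  obtain X Y where "first_ff f u X X = -1" "first_ff f u Y Y = 1" "first_ff f u X Y = 0"
    using lorentzian[OF u] unfolding lorentzian_at_def by blast
  then show False using gram_change[OF u, of X Y] 0 by simp
qed

lemma det_metric: "det (metric f u) = gram u"
  by (simp add: det_2 metric_def power2_eq_square first_ff_commute[of _ "axis 2 1" "axis 1 1"])

lemma inv_metric_entries:
  assumes "u \<in> V"
  shows "inv_metric f u $ 1 $ 1 = first_ff f u (axis 2 1) (axis 2 1) / gram u"
    "inv_metric f u $ 1 $ 2 = - first_ff f u (axis 1 1) (axis 2 1) / gram u"
    "inv_metric f u $ 2 $ 1 = - first_ff f u (axis 1 1) (axis 2 1) / gram u"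
    "inv_metric f u $ 2 $ 2 = first_ff f u (axis 1 1) (axis 1 1) / gram u"
  using matrix_inv_2[of "metric f u"] gram_nonzero[OF assms] unfolding det_metric
  by (simp_all add: metric_def first_ff_commute[of _ "axis 2 1" "axis 1 1"])

text \<open>\<open>tangent_part\<close> is a vector of the ambient space, whereas Christoffel
  symbols and \<open>levi_civita\<close> work with coordinates.\<close>

definition tangent_coord :: "real^2 \<Rightarrow> real^5 \<Rightarrow> real^2"
  where "tangent_coord u w = (\<chi> i. \<Sum>l\<in>UNIV. inv_metric f u $ i $ l * \<langle>w, dir_deriv f u (axis l 1)\<rangle>)"

lemma tangent_part_eq_df: "u \<in> V \<Longrightarrow> tangent_part f u w = dir_deriv f u (tangent_coord u w)"
proof -
  assume u: "u \<in> V"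
  have "tangent_coord u w $ i = (\<Sum>l\<in>UNIV. inv_metric f u $ i $ l * \<langle>w, dir_deriv f u (axis l 1)\<rangle>)" for i
    by (simp add: tangent_coord_def)
  then show ?thesis
    by (subst df_expand[OF u]) (simp add: tangent_part_def sum_2 inv_metric_entries[OF u] algebra_simps)
qed

lemma inner_tangent_part:
  assumes "u \<in> V"
  shows "\<langle>tangent_part f u w, dir_deriv f u Y\<rangle> = \<langle>w, dir_deriv f u Y\<rangle>"
proof -
  let ?e = "dir_deriv f u (axis 1 1)" and ?f = "dir_deriv f u (axis 2 1)"
  define d where "d = inverse (gram u)"
  have d: "(\<langle>?e, ?e\<rangle> * \<langle>?f, ?f\<rangle> - (\<langle>?e, ?f\<rangle>)\<^sup>2) * d = 1"
    using gram_nonzero[OF assms] by (simp add: first_ff_def d_def)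
  have "\<langle>tangent_part f u w, dir_deriv f u Y\<rangle> =
      Y$1 * (\<langle>?f, ?f\<rangle> * d * \<langle>w, ?e\<rangle> * \<langle>?e, ?e\<rangle> - \<langle>?e, ?f\<rangle> * d * \<langle>w, ?f\<rangle> * \<langle>?e, ?e\<rangle>
        - \<langle>?e, ?f\<rangle> * d * \<langle>w, ?e\<rangle> * \<langle>?e, ?f\<rangle> + \<langle>?e, ?e\<rangle> * d * \<langle>w, ?f\<rangle> * \<langle>?e, ?f\<rangle>)
    + Y$2 * (\<langle>?f, ?f\<rangle> * d * \<langle>w, ?e\<rangle> * \<langle>?e, ?f\<rangle> - \<langle>?e, ?f\<rangle> * d * \<langle>w, ?f\<rangle> * \<langle>?e, ?f\<rangle>
        - \<langle>?e, ?f\<rangle> * d * \<langle>w, ?e\<rangle> * \<langle>?f, ?f\<rangle> + \<langle>?e, ?e\<rangle> * d * \<langle>w, ?f\<rangle> * \<langle>?f, ?f\<rangle>)"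
    unfolding tangent_part_def df_expand[OF assms, of Y]
    by (simp add: sum_2 inv_metric_entries[OF assms] pe_inner_simps divide_inverse flip: d_def)
      (simp add: first_ff_def pe_inner_commute[of ?f ?e] algebra_simps)
  also have "\<dots> = Y$1 * \<langle>w, ?e\<rangle> + Y$2 * \<langle>w, ?f\<rangle>" using d by algebra
  also have "\<dots> = \<langle>w, dir_deriv f u Y\<rangle>" by (simp add: df_expand[OF assms, of Y] pe_inner_simps)
  finally show ?thesis .
qed

text \<open>Below, equations between coordinate vectors are obtained from this by testing the images
  of both sides against all tangent vectors.\<close>

lemma nondegenerate:
  assumes "u \<in> V" "\<And>Y. \<langle>dir_deriv f u Z, dir_deriv f u Y\<rangle> = 0"
  shows "Z = 0"
proof -
  let ?a = "first_ff f u (axis 1 1) (axis 1 1)" and ?b = "first_ff f u (axis 1 1) (axis 2 1)"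
    and ?c = "first_ff f u (axis 2 1) (axis 2 1)"
  have "Z$1 * ?a + Z$2 * ?b = 0" "Z$1 * ?b + Z$2 * ?c = 0"
    using assms(2)[of "axis 1 1"] assms(2)[of "axis 2 1"] unfolding df_expand[OF assms(1), of Z]
    by (simp_all add: pe_inner_simps first_ff_def pe_inner_commute[of "dir_deriv f u (axis 2 1)" "dir_deriv f u (axis 1 1)"])
  then have "Z$1 * gram u = 0" "Z$2 * gram u = 0" by algebra+
  then show ?thesis using gram_nonzero[OF assms(1)] by (simp add: vec_eq_iff forall_2)
qed

lemma tangent_part_unique:
  assumes "u \<in> V" "\<And>Y. \<langle>w - dir_deriv f u Z, dir_deriv f u Y\<rangle> = 0"
  shows "tangent_part f u w = dir_deriv f u Z"
proof -
  have "tangent_coord u w - Z = 0"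
  proof (rule nondegenerate[OF assms(1)])
    fix Y
    have "\<langle>tangent_part f u w - dir_deriv f u Z, dir_deriv f u Y\<rangle> = 0"
      using assms(2)[of Y] inner_tangent_part[OF assms(1)] by (simp add: pe_inner_simps)
    then show "\<langle>dir_deriv f u (tangent_coord u w - Z), dir_deriv f u Y\<rangle> = 0"
      using linear_diff[OF linear_df[OF assms(1)]] tangent_part_eq_df[OF assms(1)] by metis
  qed
  then show ?thesis using tangent_part_eq_df[OF assms(1)] by simp
qed

lemma inner_df_f: "u \<in> V \<Longrightarrow> \<langle>dir_deriv f u Y, f u\<rangle> = 0"
proof -
  assume u: "u \<in> V"
  have "dir_deriv (\<lambda>w. \<langle>f w, f w\<rangle>) u Y = dir_deriv (\<lambda>w. 1) u Y"
    using dir_deriv_cong[OF open_V u sphere] by simp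
  then show ?thesis
    using dir_deriv_pe_inner[OF smooth_on_differentiable[OF smooth u] smooth_on_differentiable[OF smooth u], of Y]
    by (simp add: pe_inner_commute)
qed

lemma inner_second_deriv_f:
  assumes u: "u \<in> V"
  shows "\<langle>dir_deriv (\<lambda>w. dir_deriv f w Y) u X, f u\<rangle> = - first_ff f u X Y"
proof -
  have "dir_deriv (\<lambda>w. \<langle>dir_deriv f w Y, f w\<rangle>) u X = dir_deriv (\<lambda>w. 0) u X"
    using dir_deriv_cong[OF open_V u inner_df_f] by simp
  then show ?thesis
    using dir_deriv_pe_inner[OF smooth_on_differentiable[OF smooth_on_dir_deriv_const[OF smooth] u]
        smooth_on_differentiable[OF smooth u], of Y X]
    by (simp add: first_ff_def pe_inner_commute)
qed

lemma normal_part_orthogonal: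
  assumes "u \<in> V"
  shows "\<langle>normal_part f u w, dir_deriv f u Y\<rangle> = 0" "\<langle>normal_part f u w, f u\<rangle> = 0"
proof -
  show "\<langle>normal_part f u w, dir_deriv f u Y\<rangle> = 0"
    using inner_df_f[OF assms, of Y]
    by (simp add: normal_part_def pe_inner_simps inner_tangent_part[OF assms] pe_inner_commute[of "f u"])
  have "\<langle>tangent_part f u w, f u\<rangle> = 0"
    by (simp add: tangent_part_eq_df[OF assms] inner_df_f[OF assms])
  then show "\<langle>normal_part f u w, f u\<rangle> = 0"
    by (simp add: normal_part_def pe_inner_simps sphere[OF assms])
qed

text \<open>The splitting into a tangential, a radial and a normal component is unique, so a normal
  part can be computed by exhibiting any such splitting.\<close>

lemma normal_part_unique:
  assumes u: "u \<in> V" and eq: "w = dir_deriv f u Z + c *\<^sub>R f u + n"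
    and n: "\<And>Y. \<langle>n, dir_deriv f u Y\<rangle> = 0" "\<langle>n, f u\<rangle> = 0"
  shows "normal_part f u w = n"
proof -
  have "tangent_part f u w = dir_deriv f u Z"
    using n inner_df_f[OF u] by (intro tangent_part_unique[OF u])
      (simp add: eq pe_inner_simps pe_inner_commute[of "f u"])
  moreover have "\<langle>w, f u\<rangle> = c"
    by (simp add: eq pe_inner_simps inner_df_f[OF u] sphere[OF u] n)
  ultimately show ?thesis by (simp add: normal_part_def eq)
qed

lemma linear_normal_part: "linear (normal_part f u)"
  by (rule linearI)
    (simp_all add: normal_part_def tangent_part_def sum_2 pe_inner_simps algebra_simps)

lemma linear_second_deriv: "u \<in> V \<Longrightarrow> linear (dir_deriv (\<lambda>w. dir_deriv f w Y) u)"
  using smooth_on_linear_dir_deriv[OF smooth_on_dir_deriv_const[OF smooth]] .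

lemma second_ff_commute: "u \<in> V \<Longrightarrow> second_ff f u X Y = second_ff f u Y X"
  unfolding second_ff_def using dir_deriv_commute[OF open_V smooth] by metis

lemma linear_second_ff: "u \<in> V \<Longrightarrow> linear (\<lambda>X. second_ff f u X Y)"
  unfolding second_ff_def
  using linear_compose[OF linear_second_deriv linear_normal_part] by (simp add: o_def)

lemma second_ff_bilinear:
  assumes "u \<in> V"
  shows "second_ff f u (a *\<^sub>R X + b *\<^sub>R Y) Z = a *\<^sub>R second_ff f u X Z + b *\<^sub>R second_ff f u Y Z"
    "second_ff f u Z (a *\<^sub>R X + b *\<^sub>R Y) = a *\<^sub>R second_ff f u Z X + b *\<^sub>R second_ff f u Z Y"
proof -
  show *: "second_ff f u (a *\<^sub>R X + b *\<^sub>R Y) Z = a *\<^sub>R second_ff f u X Z + b *\<^sub>R second_ff f u Y Z" for Z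
    using linear_add[OF linear_second_ff[OF assms]] linear_cmul[OF linear_second_ff[OF assms]] by metis
  show "second_ff f u Z (a *\<^sub>R X + b *\<^sub>R Y) = a *\<^sub>R second_ff f u Z X + b *\<^sub>R second_ff f u Z Y"
    using *[of Z] second_ff_commute[OF assms] by metis
qed

lemma first_ff_bilinear:
  assumes "u \<in> V"
  shows "first_ff f u (a *\<^sub>R X + b *\<^sub>R Y) Z = a * first_ff f u X Z + b * first_ff f u Y Z"
    "first_ff f u Z (a *\<^sub>R X + b *\<^sub>R Y) = a * first_ff f u Z X + b * first_ff f u Z Y"
  unfolding first_ff_def
  by (simp_all add: linear_add[OF linear_df[OF assms]] linear_cmul[OF linear_df[OF assms]] pe_inner_simps)

lemma null_basis_expand:
  assumes u: "u \<in> V" and Y: "first_ff f u Y1 Y2 = -1" "first_ff f u Y1 Y1 = 0" "first_ff f u Y2 Y2 = 0"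
  shows "Z = (- first_ff f u Z Y2) *\<^sub>R Y1 + (- first_ff f u Z Y1) *\<^sub>R Y2"
proof -
  let ?D = "Y1$1 * Y2$2 - Y1$2 * Y2$1"
  \<comment> \<open>For a null basis \<open>gram_change\<close> reads
    \<open>-1 = ?D\<^sup>2 * gram u\<close>.\<close>
  have D: "?D \<noteq> 0" using gram_change[OF u, of Y1 Y2] Y by auto
  define d where "d = inverse ?D"
  define p q where "p = (Z$1 * Y2$2 - Z$2 * Y2$1) * d" and "q = (Y1$1 * Z$2 - Y1$2 * Z$1) * d"
  have "?D * d = 1" using D by (simp add: d_def)
  then have "Z$1 = p * Y1$1 + q * Y2$1" "Z$2 = p * Y1$2 + q * Y2$2"
    unfolding p_def q_def by algebra+
  then have "Z = p *\<^sub>R Y1 + q *\<^sub>R Y2" by (simp add: vec_eq_iff forall_2)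
  moreover have "p = - first_ff f u Z Y2" "q = - first_ff f u Z Y1"
    unfolding \<open>Z = p *\<^sub>R Y1 + q *\<^sub>R Y2\<close>
    by (simp_all add: first_ff_bilinear[OF u] Y first_ff_commute[of u Y2 Y1])
  ultimately show ?thesis by metis
qed

text \<open>\<open>p\<close> and \<open>q\<close> are the coordinates of the standard basis vectors
  in the null basis. Mean and Gaussian curvature are defined through the standard basis; these
  formulas carry them over to a null basis, where both become short.\<close>

lemma null_basis_components:
  assumes u: "u \<in> V" and Y: "first_ff f u Y1 Y2 = -1" "first_ff f u Y1 Y1 = 0" "first_ff f u Y2 Y2 = 0"
  obtains p q :: "2 \<Rightarrow> real" where
    "\<And>i j. second_ff f u (axis i 1) (axis j 1) = (p i * p j) *\<^sub>R second_ff f u Y1 Y1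
      + (p i * q j + q i * p j) *\<^sub>R second_ff f u Y1 Y2 + (q i * q j) *\<^sub>R second_ff f u Y2 Y2"
    "\<And>i j. first_ff f u (axis i 1) (axis j 1) = - (p i * q j + q i * p j)"
    "gram u = - (p 1 * q 2 - p 2 * q 1)\<^sup>2"
proof -
  define p q where "p = (\<lambda>i. - first_ff f u (axis i 1) Y2)" and "q = (\<lambda>i. - first_ff f u (axis i 1) Y1)"
  have e: "axis i 1 = p i *\<^sub>R Y1 + q i *\<^sub>R Y2" for i
    unfolding p_def q_def by (rule null_basis_expand[OF assms])
  have g: "first_ff f u (axis i 1) (axis j 1) = - (p i * q j + q i * p j)" for i j
    unfolding e by (simp add: first_ff_bilinear[OF u] first_ff_commute[of u Y2 Y1] Y)
  show thesis
  proof (rule that[OF _ g])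
    show "second_ff f u (axis i 1) (axis j 1) = (p i * p j) *\<^sub>R second_ff f u Y1 Y1
      + (p i * q j + q i * p j) *\<^sub>R second_ff f u Y1 Y2 + (q i * q j) *\<^sub>R second_ff f u Y2 Y2" for i j
      unfolding e by (simp add: second_ff_bilinear[OF u] second_ff_commute[OF u, of Y2 Y1] algebra_simps)
    show "gram u = - (p 1 * q 2 - p 2 * q 1)\<^sup>2"
      unfolding g by (simp add: power2_eq_square algebra_simps)
  qed
qed

text \<open>In a null basis the inverse metric has only the off-diagonal entries -1, so the trace
  consists of two equal mixed terms. The squared determinant of the change of basis cancels against
  \<open>gram u\<close>.\<close>

lemma mean_curvature_null_basis:
  assumes u: "u \<in> V" and Y: "first_ff f u Y1 Y2 = -1" "first_ff f u Y1 Y1 = 0" "first_ff f u Y2 Y2 = 0"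
  shows "mean_curvature f u = - second_ff f u Y1 Y2"
proof -
  let ?A = "second_ff f u Y1 Y1" and ?B = "second_ff f u Y1 Y2" and ?C = "second_ff f u Y2 Y2"
  obtain p q where h: "\<And>i j. second_ff f u (axis i 1) (axis j 1) =
      (p i * p j) *\<^sub>R ?A + (p i * q j + q i * p j) *\<^sub>R ?B + (q i * q j) *\<^sub>R ?C"
    and g: "\<And>i j. first_ff f u (axis i 1) (axis j 1) = - (p i * q j + q i * p j)"
    and gr: "gram u = - (p 1 * q 2 - p 2 * q 1)\<^sup>2"
    using null_basis_components[OF assms] by blast
  then have D: "p 1 * q 2 - p 2 * q 1 \<noteq> 0" using gram_nonzero[OF u] by auto
  have inner: "first_ff f u (axis 2 1) (axis 2 1) *\<^sub>R second_ff f u (axis 1 1) (axis 1 1)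
     - (2 * first_ff f u (axis 1 1) (axis 2 1)) *\<^sub>R second_ff f u (axis 1 1) (axis 2 1)
     + first_ff f u (axis 1 1) (axis 1 1) *\<^sub>R second_ff f u (axis 2 1) (axis 2 1)
    = (2 * (p 1 * q 2 - p 2 * q 1)\<^sup>2) *\<^sub>R ?B"
    unfolding g h by (simp add: vec_eq_iff) (simp add: algebra_simps power2_eq_square)
  have "mean_curvature f u = (1/2 * inverse (gram u)) *\<^sub>R (first_ff f u (axis 2 1) (axis 2 1) *\<^sub>R second_ff f u (axis 1 1) (axis 1 1)
     - (2 * first_ff f u (axis 1 1) (axis 2 1)) *\<^sub>R second_ff f u (axis 1 1) (axis 2 1)
     + first_ff f u (axis 1 1) (axis 1 1) *\<^sub>R second_ff f u (axis 2 1) (axis 2 1))"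
    unfolding mean_curvature_def
    by (simp add: vec_eq_iff sum_2 inv_metric_entries[OF u] second_ff_commute[OF u, of "axis 2 1" "axis 1 1"])
      (simp add: divide_inverse algebra_simps)
  also have "\<dots> = (1/2 * inverse (gram u)) *\<^sub>R ((2 * (p 1 * q 2 - p 2 * q 1)\<^sup>2) *\<^sub>R ?B)"
    unfolding inner ..
  also have "\<dots> = - ?B" using D by (simp add: gr)
  finally show ?thesis .
qed

section \<open>The Levi-Civita connection as a tangential projection, and the Gauss equation\<close>

lemma smooth_first_ff: "smooth_on V (\<lambda>u. first_ff f u X Y)"
  unfolding first_ff_def by (intro smooth_on_pe_inner open_V smooth_on_dir_deriv_const smooth)

lemma smooth_inv_metric: "smooth_on V (\<lambda>u. inv_metric f u $ i $ j)"
proof -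
  have g: "smooth_on V gram"
    by (intro smooth_on_diff smooth_on_mult smooth_on_power smooth_first_ff open_V)
  have *: "smooth_on V (\<lambda>u. first_ff f u X Y / gram u)" "smooth_on V (\<lambda>u. - first_ff f u X Y / gram u)" for X Y
    by (intro smooth_on_divide smooth_on_minus smooth_first_ff g gram_nonzero open_V; assumption)+
  have "i = 1 \<or> i = 2" "j = 1 \<or> j = 2" using exhaust_2 by auto
  then show ?thesis
    using *[of "axis 1 1" "axis 2 1"] *[of "axis 1 1" "axis 1 1"] *[of "axis 2 1" "axis 2 1"]
      smooth_on_cong[OF open_V inv_metric_entries(1)] smooth_on_cong[OF open_V inv_metric_entries(2)]
      smooth_on_cong[OF open_V inv_metric_entries(3)] smooth_on_cong[OF open_V inv_metric_entries(4)]
    by fastforce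
qed

lemma smooth_tangent_coord:
  assumes "smooth_on V w"
  shows "smooth_on V (\<lambda>u. tangent_coord u (w u))"
proof -
  have "smooth_on V (\<lambda>u. \<Sum>l\<in>UNIV. inv_metric f u $ i $ l * \<langle>w u, dir_deriv f u (axis l 1)\<rangle>)" for i
    using assms by (intro smooth_on_sum smooth_on_mult smooth_inv_metric smooth_on_pe_inner open_V
        smooth_on_dir_deriv_const smooth) auto
  then have "smooth_on V (\<lambda>u. tangent_coord u (w u) $ 1 *\<^sub>R axis 1 1 + tangent_coord u (w u) $ 2 *\<^sub>R axis (2::2) (1::real))"
    unfolding tangent_coord_def vec_lambda_beta
    by (intro smooth_on_add smooth_on_scaleR smooth_on_const open_V)
  then show ?thesis using vec2_expand by simp
qed

lemma smooth_second_deriv: "smooth_on V (\<lambda>u. dir_deriv (\<lambda>w. dir_deriv f w Y) u X)"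
  by (intro smooth_on_dir_deriv_const smooth)

lemma dir_deriv_metric:
  assumes u: "u \<in> V"
  shows "dir_deriv (\<lambda>w. metric f w $ i $ j) u Z =
    \<langle>dir_deriv (\<lambda>w. dir_deriv f w (axis i 1)) u Z, dir_deriv f u (axis j 1)\<rangle>
    + \<langle>dir_deriv (\<lambda>w. dir_deriv f w (axis j 1)) u Z, dir_deriv f u (axis i 1)\<rangle>"
  unfolding metric_def vec_lambda_beta first_ff_def
  using dir_deriv_pe_inner[OF smooth_on_differentiable[OF smooth_on_dir_deriv_const[OF smooth] u]
        smooth_on_differentiable[OF smooth_on_dir_deriv_const[OF smooth] u]]
  by (simp add: pe_inner_commute)

text \<open>Koszul formula: differentiating the metric yields six products of second with first
  derivatives of \<open>f\<close>, of which four cancel by symmetry of second derivatives and two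
  agree.\<close>

lemma christoffel_eq:
  assumes u: "u \<in> V"
  shows "christoffel f u k i j = tangent_coord u (dir_deriv (\<lambda>w. dir_deriv f w (axis j 1)) u (axis i 1)) $ k"
proof -
  have c: "dir_deriv (\<lambda>w. dir_deriv f w (axis a 1)) u (axis b 1) = dir_deriv (\<lambda>w. dir_deriv f w (axis b 1)) u (axis a 1)" for a b
    by (rule dir_deriv_commute[OF open_V smooth u])
  have "dir_deriv (\<lambda>w. metric f w $ j $ l) u (axis i 1) + dir_deriv (\<lambda>w. metric f w $ i $ l) u (axis j 1)
      - dir_deriv (\<lambda>w. metric f w $ i $ j) u (axis l 1)
    = 2 * \<langle>dir_deriv (\<lambda>w. dir_deriv f w (axis j 1)) u (axis i 1), dir_deriv f u (axis l 1)\<rangle>" for l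
    unfolding dir_deriv_metric[OF u] using c[of i j] c[of i l] c[of j l] by (simp add: pe_inner_commute)
  then show ?thesis
    unfolding christoffel_def tangent_coord_def by (simp add: sum_distrib_left)
qed

lemma linear_tangent_coord: "linear (tangent_coord u)"
  by (rule linearI) (simp_all add: vec_eq_iff tangent_coord_def sum_2 pe_inner_simps algebra_simps)

lemma second_deriv_expand:
  assumes u: "u \<in> V"
  shows "dir_deriv (\<lambda>w. dir_deriv f w Y) u X =
    (\<Sum>i\<in>UNIV. \<Sum>j\<in>UNIV. (X$i * Y$j) *\<^sub>R dir_deriv (\<lambda>w. dir_deriv f w (axis j 1)) u (axis i 1))"
proof -
  let ?h = "\<lambda>Y X. dir_deriv (\<lambda>w. dir_deriv f w Y) u X"
  have 1: "?h Y X = X$1 *\<^sub>R ?h Y (axis 1 1) + X$2 *\<^sub>R ?h Y (axis 2 1)" for X Y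
    using linear_add[OF linear_second_deriv[OF u]] linear_cmul[OF linear_second_deriv[OF u]] vec2_expand[of X]
    by metis
  have 2: "?h Y X = ?h X Y" for X Y by (rule dir_deriv_commute[OF open_V smooth u])
  have "?h Y X = X$1 *\<^sub>R ?h (axis 1 1) Y + X$2 *\<^sub>R ?h (axis 2 1) Y"
    using 1[of Y X] 2 by simp
  then show ?thesis
    by (simp only: sum_2 1[of _ Y] 2[of "axis 1 1" "axis 2 1"]) (simp add: algebra_simps)
qed

text \<open>Gauss formula: the Christoffel terms are the tangential part of the second derivative of
  \<open>f\<close>, while the derivative of the coefficients of \<open>W\<close> is tangential from
  the start.\<close>

lemma df_levi_civita:
  assumes u: "u \<in> V" and W: "smooth_on V W"
  shows "dir_deriv f u (levi_civita f (\<lambda>_. X) W u) = tangent_part f u (dir_deriv (\<lambda>w. dir_deriv f w (W w)) u X)"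
proof -
  have "(\<chi> k. \<Sum>i\<in>UNIV. \<Sum>j\<in>UNIV. christoffel f u k i j * X $ i * W u $ j)
      = tangent_coord u (dir_deriv (\<lambda>w. dir_deriv f w (W u)) u X)"
    unfolding christoffel_eq[OF u] second_deriv_expand[OF u, of "W u"]
    by (simp add: vec_eq_iff linear_sum[OF linear_tangent_coord] linear_cmul[OF linear_tangent_coord] mult.assoc mult.commute mult.left_commute)
  then have 1: "dir_deriv f u (levi_civita f (\<lambda>_. X) W u) =
      dir_deriv f u (dir_deriv W u X) + tangent_part f u (dir_deriv (\<lambda>w. dir_deriv f w (W u)) u X)"
    unfolding levi_civita_def by (simp add: linear_add[OF linear_df[OF u]] tangent_part_eq_df[OF u])
  have "dir_deriv (\<lambda>w. dir_deriv f w (W w)) u X =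
    dir_deriv f u (dir_deriv W u X) + dir_deriv (\<lambda>w. dir_deriv f w (W u)) u X"
    by (rule dir_deriv_along_field[OF open_V u smooth W])
  moreover have "tangent_part f u (dir_deriv f u Z + w) = dir_deriv f u Z + tangent_part f u w" for Z w
    by (rule tangent_part_unique[OF u, of _ "Z + tangent_coord u w", unfolded linear_add[OF linear_df[OF u]], folded tangent_part_eq_df[OF u]])
       (simp add: pe_inner_simps inner_tangent_part[OF u])
  ultimately show ?thesis using 1 by simp
qed

lemma gauss_equation:
  assumes u: "u \<in> V"
  shows "first_ff f u (riemann f (\<lambda>_. X) (\<lambda>_. Y) (\<lambda>_. Y) u) X =
    first_ff f u X X * first_ff f u Y Y - (first_ff f u X Y)\<^sup>2
    + \<langle>second_ff f u X X, second_ff f u Y Y\<rangle> - \<langle>second_ff f u X Y, second_ff f u X Y\<rangle>"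
proof -
  let ?d2 = "\<lambda>X Y w. dir_deriv (\<lambda>w. dir_deriv f w Y) w X"
  \<comment> \<open>\<open>W\<close> will be the Levi-Civita derivative of constant fields, and
    \<open>\<nu>\<close> is the remaining normal vector in the ambient space. Besides the second
    fundamental form, \<open>\<nu>\<close> has a radial component; its products supply the curvature
    1 of the pseudosphere.\<close>
  define W where "W X Y = (\<lambda>w. tangent_coord w (?d2 X Y w))" for X Y
  define \<nu> where "\<nu> X Y = (\<lambda>w. ?d2 X Y w - dir_deriv f w (W X Y w))" for X Y
  have smW: "smooth_on V (W X Y)" for X Y
    unfolding W_def by (intro smooth_tangent_coord smooth_second_deriv)
  have smdW: "smooth_on V (\<lambda>w. dir_deriv f w (W X Y w))" for X Y
    by (intro smooth_on_dir_deriv open_V smooth smW)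
  have sm\<nu>: "smooth_on V (\<nu> X Y)" for X Y
    unfolding \<nu>_def by (intro smooth_on_diff open_V smooth_second_deriv smdW)
  have \<nu>_df: "\<langle>\<nu> X Y w, dir_deriv f w Q\<rangle> = 0" if "w \<in> V" for X Y Q w
    using inner_tangent_part[OF that] unfolding \<nu>_def W_def tangent_part_eq_df[OF that, symmetric]
    by (simp add: pe_inner_simps)
  have \<nu>_eq: "\<nu> X Y u = second_ff f u X Y - first_ff f u X Y *\<^sub>R f u" for X Y
    using inner_second_deriv_f[OF u]
    by (simp add: \<nu>_def W_def second_ff_def normal_part_def tangent_part_eq_df[OF u])
  have n: "\<langle>second_ff f u X Y, f u\<rangle> = 0" "\<langle>f u, second_ff f u X Y\<rangle> = 0" for X Y
    using normal_part_orthogonal(2)[OF u] by (auto simp: second_ff_def pe_inner_commute)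
  have \<nu>\<nu>: "\<langle>\<nu> X Y u, \<nu> Z Q u\<rangle> = \<langle>second_ff f u X Y, second_ff f u Z Q\<rangle> + first_ff f u X Y * first_ff f u Z Q" for X Y Z Q
    by (simp add: \<nu>_eq pe_inner_simps n sphere[OF u])
  have LC: "levi_civita f (\<lambda>_. X) (\<lambda>_. Y) w = W X Y w" if "w \<in> V" for X Y w
  proof -
    have "levi_civita f (\<lambda>_. X) (\<lambda>_. Y) w - W X Y w = 0"
    proof (rule nondegenerate[OF that])
      fix Q
      have "dir_deriv f w (levi_civita f (\<lambda>_. X) (\<lambda>_. Y) w) = dir_deriv f w (W X Y w)"
        using df_levi_civita[OF that smooth_on_const] tangent_part_eq_df[OF that] by (simp add: W_def)
      then show "\<langle>dir_deriv f w (levi_civita f (\<lambda>_. X) (\<lambda>_. Y) w - W X Y w), dir_deriv f w Q\<rangle> = 0"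
        by (simp add: linear_diff[OF linear_df[OF that]] pe_inner_simps)
    qed
    then show ?thesis by simp
  qed
  \<comment> \<open>The second derivative of \<open>f\<close> is split into \<open>W\<close> and
    \<open>\<nu>\<close> and differentiated once more. As \<open>\<nu>\<close> is orthogonal to the
    surface, its derivative can be moved onto the tangent vector. The third derivative of
    \<open>f\<close> that remains is symmetric and cancels in the curvature tensor.\<close>
  have LC2: "\<langle>dir_deriv f u (levi_civita f (\<lambda>_. X) (levi_civita f (\<lambda>_. Y) (\<lambda>_. Z)) u), dir_deriv f u Q\<rangle>
      = \<langle>dir_deriv (?d2 Y Z) u X, dir_deriv f u Q\<rangle> + \<langle>\<nu> Y Z u, \<nu> X Q u\<rangle>" for X Y Z Q
  proof -
    have "levi_civita f (\<lambda>_. X) (levi_civita f (\<lambda>_. Y) (\<lambda>_. Z)) u = levi_civita f (\<lambda>_. X) (W Y Z) u"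
      unfolding levi_civita_def[of f _ "levi_civita f (\<lambda>_. Y) (\<lambda>_. Z)"] levi_civita_def[of f _ "W Y Z"]
      using dir_deriv_cong[OF open_V u, of "levi_civita f (\<lambda>_. Y) (\<lambda>_. Z)" "W Y Z"] LC u by simp
    then have "\<langle>dir_deriv f u (levi_civita f (\<lambda>_. X) (levi_civita f (\<lambda>_. Y) (\<lambda>_. Z)) u), dir_deriv f u Q\<rangle>
        = \<langle>dir_deriv (\<lambda>w. dir_deriv f w (W Y Z w)) u X, dir_deriv f u Q\<rangle>"
      by (simp add: df_levi_civita[OF u smW] inner_tangent_part[OF u])
    moreover have "dir_deriv (\<lambda>w. dir_deriv f w (W Y Z w)) u X = dir_deriv (?d2 Y Z) u X - dir_deriv (\<nu> Y Z) u X"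
      unfolding \<nu>_def
      by (subst dir_deriv_diff) (auto intro!: smooth_on_differentiable[OF _ u] smooth_second_deriv smdW)
    moreover have "\<langle>dir_deriv (\<nu> Y Z) u X, dir_deriv f u Q\<rangle> = - \<langle>\<nu> Y Z u, ?d2 X Q u\<rangle>"
    proof -
      have "dir_deriv (\<lambda>w. \<langle>\<nu> Y Z w, dir_deriv f w Q\<rangle>) u X = dir_deriv (\<lambda>w. 0) u X"
        using dir_deriv_cong[OF open_V u \<nu>_df] by simp
      then show ?thesis
        using dir_deriv_pe_inner[OF smooth_on_differentiable[OF sm\<nu> u]
            smooth_on_differentiable[OF smooth_on_dir_deriv_const[OF smooth] u], of Y Z Q X] by simp
    qed
    moreover have "\<langle>\<nu> Y Z u, ?d2 X Q u\<rangle> = \<langle>\<nu> Y Z u, \<nu> X Q u\<rangle>"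
      using \<nu>_df[OF u, of Y Z] by (simp add: \<nu>_def[of X Q] pe_inner_simps)
    ultimately show ?thesis by (simp add: pe_inner_simps)
  qed
  have "dir_deriv (?d2 Y Y) u X = dir_deriv (?d2 X Y) u Y"
    using dir_deriv_commute[OF open_V smooth_on_dir_deriv_const[OF smooth] u] .
  moreover have "levi_civita f (lie_bracket (\<lambda>_. X) (\<lambda>_. Y)) (\<lambda>_. Y) u = 0"
    by (simp add: levi_civita_def lie_bracket_def vec_eq_iff)
  ultimately have "first_ff f u (riemann f (\<lambda>_. X) (\<lambda>_. Y) (\<lambda>_. Y) u) X = \<langle>\<nu> Y Y u, \<nu> X X u\<rangle> - \<langle>\<nu> X Y u, \<nu> Y X u\<rangle>"
    unfolding riemann_def first_ff_def
    by (simp add: linear_diff[OF linear_df[OF u]] pe_inner_simps LC2)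
  then show ?thesis
    unfolding \<nu>\<nu> by (simp add: second_ff_commute[OF u, of Y X] first_ff_commute[of u Y X] power2_eq_square
        pe_inner_commute[of "second_ff f u Y Y"])
qed

text \<open>Numerator and denominator scale by the same squared determinant, and the Gram
  determinant of a null basis is -1, which accounts for the signs.\<close>

lemma gauss_curvature_null_basis:
  assumes u: "u \<in> V" and Y: "first_ff f u Y1 Y2 = -1" "first_ff f u Y1 Y1 = 0" "first_ff f u Y2 Y2 = 0"
  shows "gauss_curvature f u = 1 - \<langle>second_ff f u Y1 Y1, second_ff f u Y2 Y2\<rangle>
    + \<langle>second_ff f u Y1 Y2, second_ff f u Y1 Y2\<rangle>"
proof -
  let ?A = "second_ff f u Y1 Y1" and ?B = "second_ff f u Y1 Y2" and ?C = "second_ff f u Y2 Y2"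
  obtain p q where h: "\<And>i j. second_ff f u (axis i 1) (axis j 1) =
      (p i * p j) *\<^sub>R ?A + (p i * q j + q i * p j) *\<^sub>R ?B + (q i * q j) *\<^sub>R ?C"
    and g: "\<And>i j. first_ff f u (axis i 1) (axis j 1) = - (p i * q j + q i * p j)"
    and gr: "gram u = - (p 1 * q 2 - p 2 * q 1)\<^sup>2"
    using null_basis_components[OF assms] by blast
  have "\<langle>second_ff f u (axis 1 1) (axis 1 1), second_ff f u (axis 2 1) (axis 2 1)\<rangle>
      - \<langle>second_ff f u (axis 1 1) (axis 2 1), second_ff f u (axis 1 1) (axis 2 1)\<rangle>
    = (p 1 * q 2 - p 2 * q 1)\<^sup>2 * (\<langle>?A, ?C\<rangle> - \<langle>?B, ?B\<rangle>)"
    unfolding h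
    by (simp add: pe_inner_simps pe_inner_commute[of ?B ?A] pe_inner_commute[of ?C ?A] pe_inner_commute[of ?C ?B])
      (simp add: algebra_simps power2_eq_square)
  then have "first_ff f u (riemann f (\<lambda>_. axis 1 1) (\<lambda>_. axis 2 1) (\<lambda>_. axis 2 1) u) (axis 1 1)
      = gram u * (1 - \<langle>?A, ?C\<rangle> + \<langle>?B, ?B\<rangle>)"
    unfolding gauss_equation[OF u] gr by (simp add: algebra_simps)
  then show ?thesis
    using gram_nonzero[OF u] unfolding gauss_curvature_def Let_def by (simp only:) simp
qed

end

section \<open>Null frames along minimal Lorentzian patches\<close>

text \<open>By \<open>mean_curvature_null_basis\<close> the last assumption is the vanishing of the
  mean curvature, in the form in which it enters the structure equations.\<close>

locale minimal_frame = lorentzian_patch +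
  fixes X1 X2 :: "real^2 \<Rightarrow> real^2" and n3 n4 :: "real^2 \<Rightarrow> real^5"
  assumes adapted: "adapted_frame f V X1 X2 n3 n4"
    and minimal: "u \<in> V \<Longrightarrow> second_ff f u (X1 u) (X2 u) = 0"
begin

abbreviation "D1 g u \<equiv> dir_deriv g u (X1 u)"
abbreviation "D2 g u \<equiv> dir_deriv g u (X2 u)"
abbreviation "F1 \<equiv> (\<lambda>u. dir_deriv f u (X1 u))"
abbreviation "F2 \<equiv> (\<lambda>u. dir_deriv f u (X2 u))"

text \<open>A component along one member of a null pair is minus the product with the other member.
  \<open>w1\<close>, \<open>w2\<close> make up the connection form of the tangent bundle,
  \<open>m1\<close>, \<open>m2\<close> that of the normal bundle.\<close>

definition "w1 u = - \<langle>D1 F1 u, F2 u\<rangle>"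
definition "w2 u = - \<langle>D2 F1 u, F2 u\<rangle>"
definition "a3 u = - \<langle>D1 F1 u, n4 u\<rangle>"
definition "a4 u = - \<langle>D1 F1 u, n3 u\<rangle>"
definition "b3 u = - \<langle>D2 F2 u, n4 u\<rangle>"
definition "b4 u = - \<langle>D2 F2 u, n3 u\<rangle>"
definition "m1 u = - \<langle>D1 n3 u, n4 u\<rangle>"
definition "m2 u = - \<langle>D2 n3 u, n4 u\<rangle>"

lemma smooth_frame: "smooth_on V X1" "smooth_on V X2" "smooth_on V n3" "smooth_on V n4"
  using adapted by (auto simp: adapted_frame_def)

lemma smooth_D: "smooth_on V g \<Longrightarrow> smooth_on V (D1 g)" "smooth_on V g \<Longrightarrow> smooth_on V (D2 g)"
  by (auto intro: smooth_on_dir_deriv open_V smooth_frame)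

lemma smooth_coeffs: "smooth_on V w1" "smooth_on V w2" "smooth_on V a3" "smooth_on V a4"
    "smooth_on V b3" "smooth_on V b4" "smooth_on V m1" "smooth_on V m2"
  unfolding w1_def w2_def a3_def a4_def b3_def b4_def m1_def m2_def
  by (intro smooth_on_minus smooth_on_pe_inner smooth_D smooth smooth_frame open_V)+

lemmas smooth_all = smooth_frame smooth_coeffs smooth smooth_D[OF smooth]

lemma frame: "u \<in> V \<Longrightarrow> null_frame (F1 u) (F2 u) (n3 u) (n4 u) (f u)"
  using adapted inner_df_f sphere by (auto simp: adapted_frame_def null_frame_def Let_def)

lemma inner_constant:
  assumes u: "u \<in> V" and sm: "smooth_on V g" "smooth_on V h" and c: "\<And>w. w \<in> V \<Longrightarrow> \<langle>g w, h w\<rangle> = c"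
  shows "\<langle>dir_deriv g u Z, h u\<rangle> = - \<langle>dir_deriv h u Z, g u\<rangle>"
proof -
  have "dir_deriv (\<lambda>w. \<langle>g w, h w\<rangle>) u Z = dir_deriv (\<lambda>w. c) u Z"
    using dir_deriv_cong[OF open_V u c] by simp
  then show ?thesis
    using dir_deriv_pe_inner[OF smooth_on_differentiable[OF sm(1) u] smooth_on_differentiable[OF sm(2) u], of Z]
    by (simp add: pe_inner_commute)
qed

lemma inner_normal_part:
  assumes u: "u \<in> V" and n: "n = n3 u \<or> n = n4 u"
  shows "\<langle>normal_part f u w, n\<rangle> = \<langle>w, n\<rangle>"
proof -
  have "first_ff f u (X1 u) (X2 u) = -1" "first_ff f u (X1 u) (X1 u) = 0" "first_ff f u (X2 u) (X2 u) = 0"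
    using null_frame_inner[OF frame[OF u]] by (simp_all add: first_ff_def)
  note Z = null_basis_expand[OF u this]
  have "\<langle>dir_deriv f u Z, n\<rangle> = 0" for Z
    by (subst Z, insert n null_frame_inner[OF frame[OF u]])
      (auto simp: linear_add[OF linear_df[OF u]] linear_cmul[OF linear_df[OF u]] linear_diff[OF linear_df[OF u]]
          linear_neg[OF linear_df[OF u]] pe_inner_simps)
  moreover have "\<langle>f u, n\<rangle> = 0" using n null_frame_inner[OF frame[OF u]] by auto
  ultimately show ?thesis
    by (simp add: normal_part_def tangent_part_eq_df[OF u] pe_inner_simps)
qed

lemma normal_second_ff:
  assumes u: "u \<in> V" and W: "smooth_on V W"
  shows "normal_part f u (dir_deriv (\<lambda>w. dir_deriv f w (W w)) u Z) = second_ff f u Z (W u)"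
proof -
  have "normal_part f u (dir_deriv f u Y + w) = normal_part f u w" for Y w
    using normal_part_unique[OF u, of "dir_deriv f u Y" Y 0 0] linear_add[OF linear_normal_part]
    by (simp add: pe_inner_simps)
  then show ?thesis
    unfolding second_ff_def dir_deriv_along_field[OF open_V u smooth W] by blast
qed

lemma inner_second_ff:
  assumes u: "u \<in> V" and W: "smooth_on V W" and n: "n = n3 u \<or> n = n4 u"
  shows "\<langle>dir_deriv (\<lambda>w. dir_deriv f w (W w)) u Z, n\<rangle> = \<langle>second_ff f u Z (W u), n\<rangle>"
  using normal_second_ff[OF u W] inner_normal_part[OF u n] by metis

text \<open>A vector is determined by its five products with the frame. Differentiating the constant
  products of the frame relates those of its derivatives, minimality removes the normal components
  of the mixed derivatives, and the eight coefficients defined above remain.\<close>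

lemma structure_equations:
  assumes u: "u \<in> V"
  shows D1F1: "D1 F1 u = w1 u *\<^sub>R F1 u + a3 u *\<^sub>R n3 u + a4 u *\<^sub>R n4 u"
    and D2F1: "D2 F1 u = w2 u *\<^sub>R F1 u + f u"
    and D1F2: "D1 F2 u = - w1 u *\<^sub>R F2 u + f u"
    and D2F2: "D2 F2 u = - w2 u *\<^sub>R F2 u + b3 u *\<^sub>R n3 u + b4 u *\<^sub>R n4 u"
    and D1n3: "D1 n3 u = m1 u *\<^sub>R n3 u - a4 u *\<^sub>R F2 u"
    and D2n3: "D2 n3 u = m2 u *\<^sub>R n3 u - b4 u *\<^sub>R F1 u"
    and D1n4: "D1 n4 u = - m1 u *\<^sub>R n4 u - a3 u *\<^sub>R F2 u"
    and D2n4: "D2 n4 u = - m2 u *\<^sub>R n4 u - b3 u *\<^sub>R F1 u"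
proof -
  note fr = null_frame_inner[OF frame[OF u]]
  note ic = inner_constant[OF u]
  have F: "smooth_on V F1" "smooth_on V F2" by (intro smooth_D smooth)+
  note sm = smooth smooth_frame F
  have F1: "\<langle>dir_deriv F1 u Z, F1 u\<rangle> = 0" "\<langle>dir_deriv F1 u Z, f u\<rangle> = - \<langle>dir_deriv f u Z, F1 u\<rangle>" for Z
    using ic[OF F(1,1), of 0 Z] ic[OF F(1) smooth, of 0 Z] null_frame_inner[OF frame] by simp_all
  have F2: "\<langle>dir_deriv F2 u Z, F2 u\<rangle> = 0" "\<langle>dir_deriv F2 u Z, f u\<rangle> = - \<langle>dir_deriv f u Z, F2 u\<rangle>"
     "\<langle>dir_deriv F2 u Z, F1 u\<rangle> = - \<langle>dir_deriv F1 u Z, F2 u\<rangle>" for Z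
    using ic[OF F(2,2), of 0 Z] ic[OF F(2) smooth, of 0 Z] ic[OF F(2,1), of "-1" Z] null_frame_inner[OF frame] by simp_all
  have N3: "\<langle>dir_deriv n3 u Z, n3 u\<rangle> = 0" "\<langle>dir_deriv n3 u Z, f u\<rangle> = - \<langle>dir_deriv f u Z, n3 u\<rangle>"
     "\<langle>dir_deriv n3 u Z, F1 u\<rangle> = - \<langle>dir_deriv F1 u Z, n3 u\<rangle>" "\<langle>dir_deriv n3 u Z, F2 u\<rangle> = - \<langle>dir_deriv F2 u Z, n3 u\<rangle>" for Z
    using ic[OF sm(4,4), of 0 Z] ic[OF sm(4,1), of 0 Z] ic[OF sm(4) F(1), of 0 Z] ic[OF sm(4) F(2), of 0 Z]
      null_frame_inner[OF frame] by simp_all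
  have N4: "\<langle>dir_deriv n4 u Z, n4 u\<rangle> = 0" "\<langle>dir_deriv n4 u Z, f u\<rangle> = - \<langle>dir_deriv f u Z, n4 u\<rangle>"
     "\<langle>dir_deriv n4 u Z, F1 u\<rangle> = - \<langle>dir_deriv F1 u Z, n4 u\<rangle>" "\<langle>dir_deriv n4 u Z, F2 u\<rangle> = - \<langle>dir_deriv F2 u Z, n4 u\<rangle>"
     "\<langle>dir_deriv n4 u Z, n3 u\<rangle> = - \<langle>dir_deriv n3 u Z, n4 u\<rangle>" for Z
    using ic[OF sm(5,5), of 0 Z] ic[OF sm(5,1), of 0 Z] ic[OF sm(5) F(1), of 0 Z] ic[OF sm(5) F(2), of 0 Z]
      ic[OF sm(5,4), of "-1" Z] null_frame_inner[OF frame] by simp_all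
  have H: "\<langle>D2 F1 u, n3 u\<rangle> = 0" "\<langle>D2 F1 u, n4 u\<rangle> = 0" "\<langle>D1 F2 u, n3 u\<rangle> = 0" "\<langle>D1 F2 u, n4 u\<rangle> = 0"
    using inner_second_ff[OF u smooth_frame(1)] inner_second_ff[OF u smooth_frame(2)]
      minimal[OF u] second_ff_commute[OF u, of "X2 u" "X1 u"] by (simp_all add: pe_inner_simps)
  have c: "\<langle>D1 F1 u, F2 u\<rangle> = - w1 u" "\<langle>D2 F1 u, F2 u\<rangle> = - w2 u" "\<langle>D1 F1 u, n4 u\<rangle> = - a3 u" "\<langle>D1 F1 u, n3 u\<rangle> = - a4 u"
    "\<langle>D2 F2 u, n4 u\<rangle> = - b3 u" "\<langle>D2 F2 u, n3 u\<rangle> = - b4 u" "\<langle>D1 n3 u, n4 u\<rangle> = - m1 u" "\<langle>D2 n3 u, n4 u\<rangle> = - m2 u"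
    by (simp_all add: w1_def w2_def a3_def a4_def b3_def b4_def m1_def m2_def)
  show "D1 F1 u = w1 u *\<^sub>R F1 u + a3 u *\<^sub>R n3 u + a4 u *\<^sub>R n4 u"
    by (rule null_frame_eqI[OF frame[OF u]]) (simp_all add: F1 c fr pe_inner_simps)
  show "D2 F1 u = w2 u *\<^sub>R F1 u + f u"
    by (rule null_frame_eqI[OF frame[OF u]]) (simp_all add: F1 c H fr pe_inner_simps)
  show "D1 F2 u = - w1 u *\<^sub>R F2 u + f u"
    by (rule null_frame_eqI[OF frame[OF u]]) (simp_all add: F2 c H fr pe_inner_simps)
  show "D2 F2 u = - w2 u *\<^sub>R F2 u + b3 u *\<^sub>R n3 u + b4 u *\<^sub>R n4 u"
    by (rule null_frame_eqI[OF frame[OF u]]) (simp_all add: F2 c H fr pe_inner_simps)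
  show "D1 n3 u = m1 u *\<^sub>R n3 u - a4 u *\<^sub>R F2 u"
    by (rule null_frame_eqI[OF frame[OF u]]) (simp_all add: N3 c H fr pe_inner_simps)
  show "D2 n3 u = m2 u *\<^sub>R n3 u - b4 u *\<^sub>R F1 u"
    by (rule null_frame_eqI[OF frame[OF u]]) (simp_all add: N3 c H fr pe_inner_simps)
  show "D1 n4 u = - m1 u *\<^sub>R n4 u - a3 u *\<^sub>R F2 u"
    by (rule null_frame_eqI[OF frame[OF u]]) (simp_all add: N4 c H fr pe_inner_simps)
  show "D2 n4 u = - m2 u *\<^sub>R n4 u - b3 u *\<^sub>R F1 u"
    by (rule null_frame_eqI[OF frame[OF u]]) (simp_all add: N4 c H fr pe_inner_simps)
qed

section \<open>Integrability: the equations of Gauss, Codazzi and Ricci\<close>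

lemma lie_bracket_frame:
  assumes u: "u \<in> V"
  shows "lie_bracket X1 X2 u = - w2 u *\<^sub>R X1 u - w1 u *\<^sub>R X2 u"
proof -
  have "dir_deriv f u (lie_bracket X1 X2 u) = D1 F2 u - D2 F1 u"
    using dir_deriv_fields_commute[OF open_V u smooth smooth_frame(1,2)] by simp
  \<comment> \<open>The radial terms of the two mixed derivatives cancel.\<close>
  also have "\<dots> = dir_deriv f u (- w2 u *\<^sub>R X1 u - w1 u *\<^sub>R X2 u)"
    by (simp add: D1F2[OF u] D2F1[OF u] linear_diff[OF linear_df[OF u]] linear_cmul[OF linear_df[OF u]]
        linear_neg[OF linear_df[OF u]])
  finally have eq: "dir_deriv f u (lie_bracket X1 X2 u) = dir_deriv f u (- w2 u *\<^sub>R X1 u - w1 u *\<^sub>R X2 u)" .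
  have "lie_bracket X1 X2 u - (- w2 u *\<^sub>R X1 u - w1 u *\<^sub>R X2 u) = 0"
    by (rule nondegenerate[OF u])
      (simp only: linear_diff[OF linear_df[OF u], of "lie_bracket X1 X2 u"] eq diff_self pe_inner_simps)
  then show ?thesis by simp
qed

lemma D_commute:
  fixes g :: "real^2 \<Rightarrow> 'c::euclidean_space"
  assumes u: "u \<in> V" and g: "smooth_on V g"
  shows "D1 (D2 g) u - D2 (D1 g) u = - w2 u *\<^sub>R D1 g u - w1 u *\<^sub>R D2 g u"
  unfolding dir_deriv_fields_commute[OF open_V u g smooth_frame(1,2)] lie_bracket_frame[OF u]
  using smooth_on_linear_dir_deriv[OF g u] by (simp add: linear_diff linear_cmul linear_neg)

text \<open>\<open>D_commute\<close> is applied to \<open>F1\<close>. Its component along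
  \<open>F1\<close>, read off with \<open>F2\<close>, is the Gauss equation; the components along
  \<open>n3\<close> and \<open>n4\<close>, read off with the other normal, are Codazzi
  equations.\<close>

lemma gauss_codazzi:
  assumes u: "u \<in> V"
  shows "D2 w1 u - D1 w2 u - 2 * w1 u * w2 u = 1 + a3 u * b4 u + a4 u * b3 u"
    "D2 a3 u = (2 * w2 u - m2 u) * a3 u" "D2 a4 u = (2 * w2 u + m2 u) * a4 u"
proof -
  note fr = null_frame_inner[OF frame[OF u]]
  note d = smooth_all[THEN smooth_on_differentiable, OF u]
  have s: "(\<lambda>w. w2 w *\<^sub>R F1 w) differentiable (at u)" "(\<lambda>w. w1 w *\<^sub>R F1 w) differentiable (at u)"
      "(\<lambda>w. a3 w *\<^sub>R n3 w) differentiable (at u)" "(\<lambda>w. a4 w *\<^sub>R n4 w) differentiable (at u)"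
      "(\<lambda>w. w1 w *\<^sub>R F1 w + a3 w *\<^sub>R n3 w) differentiable (at u)"
    by (intro smooth_on_differentiable[OF _ u] smooth_on_scaleR smooth_on_add open_V smooth_all)+
  have 1: "D1 (D2 F1) u = w2 u *\<^sub>R D1 F1 u + D1 w2 u *\<^sub>R F1 u + F1 u"
    by (subst dir_deriv_transfer[OF open_V u D2F1]) (simp_all add: dir_deriv_add dir_deriv_scaleR d s)
  have 2: "D2 (D1 F1) u = w1 u *\<^sub>R D2 F1 u + D2 w1 u *\<^sub>R F1 u + (a3 u *\<^sub>R D2 n3 u + D2 a3 u *\<^sub>R n3 u)
      + (a4 u *\<^sub>R D2 n4 u + D2 a4 u *\<^sub>R n4 u)"
    by (subst dir_deriv_transfer[OF open_V u D1F1]) (simp_all add: dir_deriv_add dir_deriv_scaleR d s)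
  note eq = D_commute[OF u smooth_D(1)[OF smooth], unfolded 1 2, unfolded structure_equations[OF u]]
  from arg_cong[OF eq, of "\<lambda>v. \<langle>v, F2 u\<rangle>"]
  show "D2 w1 u - D1 w2 u - 2 * w1 u * w2 u = 1 + a3 u * b4 u + a4 u * b3 u"
    by (simp add: pe_inner_simps fr)
  from arg_cong[OF eq, of "\<lambda>v. \<langle>v, n4 u\<rangle>"]
  show "D2 a3 u = (2 * w2 u - m2 u) * a3 u"
    by (simp add: pe_inner_simps fr) (simp add: algebra_simps)
  from arg_cong[OF eq, of "\<lambda>v. \<langle>v, n3 u\<rangle>"]
  show "D2 a4 u = (2 * w2 u + m2 u) * a4 u"
    by (simp add: pe_inner_simps fr) (simp add: algebra_simps)
qed

text \<open>The component along \<open>n3\<close> of \<open>D_commute\<close> for \<open>n3\<close>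
  itself; the derivatives of the tangential terms contribute the products of second fundamental
  forms.\<close>

lemma ricci:
  assumes u: "u \<in> V"
  shows "D1 m2 u - D2 m1 u + w2 u * m1 u + w1 u * m2 u = a3 u * b4 u - a4 u * b3 u"
proof -
  note fr = null_frame_inner[OF frame[OF u]]
  note d = smooth_all[THEN smooth_on_differentiable, OF u]
  have s: "(\<lambda>w. m2 w *\<^sub>R n3 w) differentiable (at u)" "(\<lambda>w. m1 w *\<^sub>R n3 w) differentiable (at u)"
      "(\<lambda>w. b4 w *\<^sub>R F1 w) differentiable (at u)" "(\<lambda>w. a4 w *\<^sub>R F2 w) differentiable (at u)"
    by (intro smooth_on_differentiable[OF _ u] smooth_on_scaleR open_V smooth_all)+
  have 1: "D1 (D2 n3) u = m2 u *\<^sub>R D1 n3 u + D1 m2 u *\<^sub>R n3 u - (b4 u *\<^sub>R D1 F1 u + D1 b4 u *\<^sub>R F1 u)"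
    by (subst dir_deriv_transfer[OF open_V u D2n3]) (simp_all add: dir_deriv_diff dir_deriv_scaleR d s)
  have 2: "D2 (D1 n3) u = m1 u *\<^sub>R D2 n3 u + D2 m1 u *\<^sub>R n3 u - (a4 u *\<^sub>R D2 F2 u + D2 a4 u *\<^sub>R F2 u)"
    by (subst dir_deriv_transfer[OF open_V u D1n3]) (simp_all add: dir_deriv_diff dir_deriv_scaleR d s)
  note eq = D_commute[OF u smooth_frame(3), unfolded 1 2, unfolded structure_equations[OF u]]
  from arg_cong[OF eq, of "\<lambda>v. \<langle>v, n4 u\<rangle>"]
  show ?thesis
    by (simp add: pe_inner_simps fr algebra_simps)
qed

lemma orthogonal_tangent:
  assumes u: "u \<in> V"
  shows "\<langle>n3 u, dir_deriv f u Y\<rangle> = 0" "\<langle>n4 u, dir_deriv f u Y\<rangle> = 0"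
proof -
  have n: "normal_part f u (dir_deriv f u Y) = 0"
    using normal_part_unique[OF u, of "dir_deriv f u Y" Y 0 0] by (simp add: pe_inner_simps)
  show "\<langle>n3 u, dir_deriv f u Y\<rangle> = 0" "\<langle>n4 u, dir_deriv f u Y\<rangle> = 0"
    using inner_normal_part[OF u, of "n3 u" "dir_deriv f u Y"] inner_normal_part[OF u, of "n4 u" "dir_deriv f u Y"]
    by (simp_all add: n pe_inner_simps pe_inner_commute)
qed

lemma normal_part_frame:
  assumes u: "u \<in> V"
  shows "normal_part f u (x *\<^sub>R F1 u + y *\<^sub>R F2 u + z *\<^sub>R f u + p *\<^sub>R n3 u + q *\<^sub>R n4 u) = p *\<^sub>R n3 u + q *\<^sub>R n4 u"
  by (rule normal_part_unique[OF u, of _ "x *\<^sub>R X1 u + y *\<^sub>R X2 u" z])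
    (simp_all add: linear_add[OF linear_df[OF u]] linear_cmul[OF linear_df[OF u]] pe_inner_simps
      orthogonal_tangent[OF u] null_frame_inner[OF frame[OF u]])

lemma gauss_curvature_frame:
  assumes u: "u \<in> V"
  shows "gauss_curvature f u = 1 + a3 u * b4 u + a4 u * b3 u"
proof -
  note fr = null_frame_inner[OF frame[OF u]]
  have "second_ff f u (X1 u) (X1 u) = a3 u *\<^sub>R n3 u + a4 u *\<^sub>R n4 u"
    using normal_part_frame[OF u, of "w1 u" 0 0 "a3 u" "a4 u"]
    by (simp add: normal_second_ff[OF u smooth_frame(1), symmetric] D1F1[OF u] add.assoc)
  moreover have "second_ff f u (X2 u) (X2 u) = b3 u *\<^sub>R n3 u + b4 u *\<^sub>R n4 u"
    using normal_part_frame[OF u, of 0 "- w2 u" 0 "b3 u" "b4 u"]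
    by (simp add: normal_second_ff[OF u smooth_frame(2), symmetric] D2F2[OF u] add.assoc)
  ultimately show ?thesis
    using gauss_curvature_null_basis[OF u, of "X1 u" "X2 u"] minimal[OF u]
    by (simp add: first_ff_def fr pe_inner_simps)
qed

text \<open>The normal connection only multiplies \<open>n3\<close> by \<open>m1\<close> or
  \<open>m2\<close>. The tangential vectors produced on the way are removed by
  \<open>normal_part\<close>, and what remains is the left side of \<open>ricci\<close>.\<close>

lemma normal_curvature_frame:
  assumes u: "u \<in> V"
  shows "normal_curvature f X1 X2 n3 n4 u = a3 u * b4 u - a4 u * b3 u"
proof -
  note fr = null_frame_inner[OF frame[OF u]]
  note d = smooth_all[THEN smooth_on_differentiable, OF u]
  have c1: "normal_conn f X1 n3 w = m1 w *\<^sub>R n3 w" if "w \<in> V" for w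
    using normal_part_frame[OF that, of 0 "- a4 w" 0 "m1 w" 0]
    by (simp add: normal_conn_def D1n3[OF that])
  have c2: "normal_conn f X2 n3 w = m2 w *\<^sub>R n3 w" if "w \<in> V" for w
    using normal_part_frame[OF that, of "- b4 w" 0 0 "m2 w" 0]
    by (simp add: normal_conn_def D2n3[OF that])
  have "D1 (normal_conn f X2 n3) u = m2 u *\<^sub>R D1 n3 u + D1 m2 u *\<^sub>R n3 u"
    by (subst dir_deriv_transfer[OF open_V u c2]) (simp_all add: dir_deriv_scaleR d)
  then have "D1 (normal_conn f X2 n3) u = 0 *\<^sub>R F1 u + (- (a4 u * m2 u)) *\<^sub>R F2 u + 0 *\<^sub>R f u
      + (m1 u * m2 u + D1 m2 u) *\<^sub>R n3 u + 0 *\<^sub>R n4 u"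
    by (simp add: D1n3[OF u] algebra_simps)
  then have 1: "normal_conn f X1 (normal_conn f X2 n3) u = (m1 u * m2 u + D1 m2 u) *\<^sub>R n3 u"
    unfolding normal_conn_def[of f X1 "normal_conn f X2 n3"] by (simp only: normal_part_frame[OF u]) simp
  have "D2 (normal_conn f X1 n3) u = m1 u *\<^sub>R D2 n3 u + D2 m1 u *\<^sub>R n3 u"
    by (subst dir_deriv_transfer[OF open_V u c1]) (simp_all add: dir_deriv_scaleR d)
  then have "D2 (normal_conn f X1 n3) u = (- (b4 u * m1 u)) *\<^sub>R F1 u + 0 *\<^sub>R F2 u + 0 *\<^sub>R f u
      + (m1 u * m2 u + D2 m1 u) *\<^sub>R n3 u + 0 *\<^sub>R n4 u"
    by (simp add: D2n3[OF u] algebra_simps)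
  then have 2: "normal_conn f X2 (normal_conn f X1 n3) u = (m1 u * m2 u + D2 m1 u) *\<^sub>R n3 u"
    unfolding normal_conn_def[of f X2 "normal_conn f X1 n3"] by (simp only: normal_part_frame[OF u]) simp
  have "dir_deriv n3 u (lie_bracket X1 X2 u) = - w2 u *\<^sub>R D1 n3 u - w1 u *\<^sub>R D2 n3 u"
    unfolding lie_bracket_frame[OF u]
    using smooth_on_linear_dir_deriv[OF smooth_frame(3) u] by (simp add: linear_diff linear_cmul linear_neg)
  then have "dir_deriv n3 u (lie_bracket X1 X2 u) = (w1 u * b4 u) *\<^sub>R F1 u + (w2 u * a4 u) *\<^sub>R F2 u + 0 *\<^sub>R f u
      + (- (w2 u * m1 u + w1 u * m2 u)) *\<^sub>R n3 u + 0 *\<^sub>R n4 u"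
    by (simp add: D1n3[OF u] D2n3[OF u] algebra_simps)
  then have 3: "normal_conn f (lie_bracket X1 X2) n3 u = - (w2 u * m1 u + w1 u * m2 u) *\<^sub>R n3 u"
    unfolding normal_conn_def by (simp only: normal_part_frame[OF u]) simp
  show ?thesis
    unfolding normal_curvature_def normal_riemann_def 1 2 3 ricci[OF u, symmetric]
    by (simp add: pe_inner_simps fr algebra_simps)
qed

end

section \<open>Local inverses and changes of parameters\<close>

lemma linear_plane_det:
  fixes L :: "real^2 \<Rightarrow> real^2"
  assumes "linear L" "inj L"
  shows "L (axis 1 1) $ 1 * L (axis 2 1) $ 2 - L (axis 2 1) $ 1 * L (axis 1 1) $ 2 \<noteq> 0"
proof
  let ?a = "L (axis 1 1) $ 1" and ?b = "L (axis 2 1) $ 1" and ?c = "L (axis 1 1) $ 2" and ?d = "L (axis 2 1) $ 2"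
  assume 0: "?a * ?d - ?b * ?c = 0"
  have nth: "L Z $ 1 = Z$1 * ?a + Z$2 * ?b" "L Z $ 2 = Z$1 * ?c + Z$2 * ?d" for Z
    using linear_vec2[OF assms(1), of Z] by simp_all
  have ker: "Z = 0" if "L Z = 0" for Z
    using that assms linear_injective_0 by blast
  \<comment> \<open>Up to sign the columns of the adjugate: both lie in the kernel when the
    determinant vanishes, and both are zero only if all entries are.\<close>
  define Z1 Z2 :: "real^2" where "Z1 = ?d *\<^sub>R axis 1 1 - ?c *\<^sub>R axis 2 1" and "Z2 = ?b *\<^sub>R axis 1 1 - ?a *\<^sub>R axis 2 1"
  have comp: "Z1$1 = ?d" "Z1$2 = - ?c" "Z2$1 = ?b" "Z2$2 = - ?a"
    by (simp_all add: Z1_def Z2_def axis_def)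
  have "L Z1 $ 1 = 0" "L Z1 $ 2 = 0" "L Z2 $ 1 = 0" "L Z2 $ 2 = 0"
    using nth[of Z1] nth[of Z2] 0 by (simp_all add: comp algebra_simps)
  then have "L Z1 = 0" "L Z2 = 0" by (simp_all add: vec_eq_iff forall_2)
  then have "Z1 = 0" "Z2 = 0" using ker by blast+
  then have "?a = 0" "?b = 0" "?c = 0" "?d = 0" using comp by simp_all
  then have "L (axis 1 1) = 0" by (simp add: vec_eq_iff forall_2)
  then have "axis 1 1 = (0::real^2)" by (rule ker)
  then show False by simp
qed

text \<open>Bootstrap: by Cramer's rule the derivative of \<open>g\<close> is a rational expression
  in the derivatives of \<open>Q\<close> at \<open>g y\<close>, so it is as regular as
  \<open>g\<close>, and each order of differentiability yields the next.\<close>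

lemma smooth_on_inverse_map:
  fixes Q g :: "real^2 \<Rightarrow> real^2"
  assumes T: "open T" and V: "open V" and Q: "smooth_on V Q" and g: "g ` T \<subseteq> V"
    and dg: "\<And>y. y \<in> T \<Longrightarrow> g differentiable (at y)"
    and inv: "\<And>y v. y \<in> T \<Longrightarrow> dir_deriv Q (g y) (dir_deriv g y v) = v"
    and inj: "\<And>y. y \<in> T \<Longrightarrow> inj (dir_deriv Q (g y))"
  shows "smooth_on T g"
proof -
  let ?q = "\<lambda>i j u. dir_deriv Q u (axis j 1) $ i"
  define \<Delta> where "\<Delta> y = ?q 1 1 (g y) * ?q 2 2 (g y) - ?q 1 2 (g y) * ?q 2 1 (g y)" for y
  have gV: "g y \<in> V" if "y \<in> T" for y using g that by blast
  have \<Delta>: "\<Delta> y \<noteq> 0" if "y \<in> T" for y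
    unfolding \<Delta>_def using linear_plane_det[OF smooth_on_linear_dir_deriv[OF Q gV[OF that]] inj[OF that]] by simp
  let ?G = "\<lambda>v y. (inverse (\<Delta> y) * (v$1 * ?q 2 2 (g y) - v$2 * ?q 1 2 (g y))) *\<^sub>R axis (1::2) (1::real)
        + (inverse (\<Delta> y) * (v$2 * ?q 1 1 (g y) - v$1 * ?q 2 1 (g y))) *\<^sub>R axis 2 1"
  have eq: "dir_deriv g y v = ?G v y" if "y \<in> T" for y v
  proof -
    let ?Z = "dir_deriv g y v"
    have "dir_deriv Q (g y) ?Z $ i = ?Z$1 * ?q i 1 (g y) + ?Z$2 * ?q i 2 (g y)" for i
      by (subst linear_vec2[OF smooth_on_linear_dir_deriv[OF Q gV[OF that]]]) simp
    then have "v$1 = ?Z$1 * ?q 1 1 (g y) + ?Z$2 * ?q 1 2 (g y)" "v$2 = ?Z$1 * ?q 2 1 (g y) + ?Z$2 * ?q 2 2 (g y)"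
      unfolding inv[OF that] by blast+
    then have "v$1 * ?q 2 2 (g y) - v$2 * ?q 1 2 (g y) = \<Delta> y * ?Z$1" "v$2 * ?q 1 1 (g y) - v$1 * ?q 2 1 (g y) = \<Delta> y * ?Z$2"
      unfolding \<Delta>_def by algebra+
    then have "?Z$1 = inverse (\<Delta> y) * (v$1 * ?q 2 2 (g y) - v$2 * ?q 1 2 (g y))"
      "?Z$2 = inverse (\<Delta> y) * (v$2 * ?q 1 1 (g y) - v$1 * ?q 2 1 (g y))"
      using \<Delta>[OF that] by simp_all
    then show ?thesis using vec2_expand[of ?Z] by simp
  qed
  have "Ck_on k T g" for k
  proof (induction k)
    case 0
    have "continuous (at y within T) g" if "y \<in> T" for y
      using differentiable_imp_continuous_within[OF dg[OF that]] continuous_at_imp_continuous_at_within by blast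
    then show ?case by (simp add: continuous_on_eq_continuous_within)
  next
    case (Suc k)
    have q: "Ck_on k T (\<lambda>y. ?q i j (g y))" for i j
      by (rule Ck_on_compose[OF T V g Suc, of "?q i j"])
        (intro smooth_on_imp_Ck_on smooth_on_vec_nth smooth_on_dir_deriv_const Q V)
    have mult: "Ck_on k T (\<lambda>y. a y * b y)" if "Ck_on k T a" "Ck_on k T b" for a b :: "real^2 \<Rightarrow> real"
      using Ck_on_bilinear[OF bounded_bilinear_mult T that] .
    have diff: "Ck_on k T (\<lambda>y. a y - b y)" if "Ck_on k T a" "Ck_on k T b" for a b :: "real^2 \<Rightarrow> real"
      using Ck_on_add[OF T that(1) Ck_on_compose_linear[OF bounded_linear_minus[OF bounded_linear_ident] T that(2)]]
      by simp
    have i\<Delta>: "Ck_on k T (\<lambda>y. inverse (\<Delta> y))"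
      by (rule Ck_on_inverse[OF T \<Delta>]) (auto simp: \<Delta>_def intro!: mult diff q)
    have "Ck_on k T (?G v)" for v
      by (intro Ck_on_add[OF T] Ck_on_bilinear[OF bounded_bilinear_scaleR T] Ck_on_const mult diff i\<Delta> q)
    then have "Ck_on k T (\<lambda>y. dir_deriv g y v)" for v
      using Ck_on_cong[OF T, of "\<lambda>y. dir_deriv g y v" "?G v"] eq by blast
    then show ?case using dg by simp
  qed
  then show ?thesis by (simp add: smooth_on_def)
qed

lemma smooth_local_inverse:
  fixes Q :: "real^2 \<Rightarrow> real^2"
  assumes V: "open V" and Q: "smooth_on V Q" and u0: "u0 \<in> V" and inj: "inj (dir_deriv Q u0)"
  obtains U T g where "open U" "u0 \<in> U" "U \<subseteq> V" "open T" "homeomorphism U T Q g" "smooth_on T g"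
    "\<And>y v. y \<in> T \<Longrightarrow> dir_deriv Q (g y) (dir_deriv g y v) = v"
proof -
  \<comment> \<open>\<open>inverse_function_theorem\<close> takes the derivative as a continuous map
    into the bounded linear functions.\<close>
  define Q' where "Q' u = Blinfun (dir_deriv Q u)" for u
  have Q': "blinfun_apply (Q' u) = dir_deriv Q u" if "u \<in> V" for u
    unfolding Q'_def using smooth_on_linear_dir_deriv[OF Q that]
    by (simp add: bounded_linear_Blinfun_apply linear_conv_bounded_linear)
  have lin: "linear (dir_deriv Q u0)" using smooth_on_linear_dir_deriv[OF Q u0] .
  obtain L where L: "linear L" "L \<circ> dir_deriv Q u0 = id"
    using linear_injective_left_inverse[OF lin inj] by blast
  have "continuous_on V (\<lambda>u. Q' u i)" for i
    using smooth_on_continuous_on[OF smooth_on_dir_deriv_const[OF Q]] Q' by (simp cong: continuous_on_cong)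
  then have cont: "continuous_on V Q'"
    by (rule continuous_on_blinfun_componentwise)
  have inv0: "Blinfun L o\<^sub>L Q' u0 = id_blinfun"
    using L Q'[OF u0] by (intro blinfun_eqI)
      (simp add: bounded_linear_Blinfun_apply linear_conv_bounded_linear o_def fun_eq_iff)
  have der: "(Q has_derivative blinfun_apply (Q' u)) (at u)" if "u \<in> V" for u
    unfolding Q'[OF that] by (rule smooth_on_has_derivative[OF Q that])
  obtain U T g g' where *: "open U" "U \<subseteq> V" "u0 \<in> U" "open T" "Q u0 \<in> T" "homeomorphism U T Q g"
    "\<And>y. y \<in> T \<Longrightarrow> (g has_derivative (g' y)) (at y)"
    "\<And>y. y \<in> T \<Longrightarrow> g' y = inv (blinfun_apply (Q' (g y)))"
    "\<And>y. y \<in> T \<Longrightarrow> bij (blinfun_apply (Q' (g y)))"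
    using inverse_function_theorem[OF V der cont u0 inv0] by metis
  have gV: "g y \<in> V" if "y \<in> T" for y
    using *(2,6) that by (auto simp: homeomorphism_def)
  have b: "bij (dir_deriv Q (g y))" if "y \<in> T" for y using *(9)[OF that] Q'[OF gV[OF that]] by simp
  have dg: "dir_deriv g y v = inv (dir_deriv Q (g y)) v" if "y \<in> T" for y v
    using dir_deriv_eqI[OF *(7)[OF that]] *(8)[OF that] Q'[OF gV[OF that]] by simp
  have inv: "dir_deriv Q (g y) (dir_deriv g y v) = v" if "y \<in> T" for y v
    unfolding dg[OF that] using b[OF that] by (simp add: bij_is_surj surj_f_inv_f)
  have "smooth_on T g"
    using gV *(7) bij_is_inj[OF b]
    by (intro smooth_on_inverse_map[OF *(4) V Q _ _ inv]) (auto simp: differentiable_def)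
  then show thesis using that * inv by blast
qed

section \<open>Charts and changes of parameters\<close>

lemma topological_patch_iff:
  "topological_patch X (V, \<psi>) \<longleftrightarrow>
    open V \<and> continuous_map (top_of_set V) X \<psi> \<and> open_map (top_of_set V) X \<psi> \<and> inj_on \<psi> V"
proof
  assume L: "topological_patch X (V, \<psi>)"
  then have V: "open V" and h: "homeomorphic_map (top_of_set V) (subtopology X (\<psi> ` V)) \<psi>" and o: "openin X (\<psi> ` V)"
    by (auto simp: topological_patch_def embedding_map_def)
  have "openin X (\<psi> ` O')" if "openin (top_of_set V) O'" for O'
    using homeomorphic_imp_open_map[OF h] that o by (auto simp: open_map_def openin_open_subtopology)
  then show "open V \<and> continuous_map (top_of_set V) X \<psi> \<and> open_map (top_of_set V) X \<psi> \<and> inj_on \<psi> V"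
    using V homeomorphic_imp_continuous_map[OF h] homeomorphic_imp_injective_map[OF h]
    by (auto simp: open_map_def continuous_map_in_subtopology)
next
  assume R: "open V \<and> continuous_map (top_of_set V) X \<psi> \<and> open_map (top_of_set V) X \<psi> \<and> inj_on \<psi> V"
  then have "openin X (\<psi> ` V)" by (auto simp: open_map_def)
  then show "topological_patch X (V, \<psi>)"
    using R injective_open_imp_embedding_map[of "top_of_set V" X \<psi>] by (auto simp: topological_patch_def)
qed

lemma topological_patchD:
  assumes "topological_patch X (V, \<psi>)"
  shows "open V" "inj_on \<psi> V" "openin X (\<psi> ` V)" "continuous_map (top_of_set V) X \<psi>"
    "\<And>O'. open O' \<Longrightarrow> O' \<subseteq> V \<Longrightarrow> openin X (\<psi> ` O')"
    "\<And>O'. openin X O' \<Longrightarrow> open {u \<in> V. \<psi> u \<in> O'}"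
proof -
  note p = assms[unfolded topological_patch_iff]
  show V: "open V" and "inj_on \<psi> V" and "continuous_map (top_of_set V) X \<psi>" using p by auto
  show O: "openin X (\<psi> ` O')" if "open O'" "O' \<subseteq> V" for O'
    using p that by (auto simp: open_map_def openin_open_eq)
  show "openin X (\<psi> ` V)" using O[OF V] by simp
  show "open {u \<in> V. \<psi> u \<in> O'}" if "openin X O'" for O'
    using openin_continuous_map_preimage[of "top_of_set V" X \<psi> O'] p that V openin_open_trans by fastforce
qed

text \<open>This is how coordinates constructed on an open set of the plane become parameters of the
  surface: \<open>\<psi> \<circ> g\<close> has the inverse \<open>Q\<close> after the inverse of
  \<open>\<psi>\<close>, and both compositions are smooth against the atlas.\<close>

lemma parametrization_compose:
  assumes par: "parametrization X \<A> V \<psi>" and \<A>: "\<And>P. P \<in> \<A> \<Longrightarrow> topological_patch X P"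
    and U: "open U" "U \<subseteq> V" and W: "open W" and hom: "homeomorphism U W Q g"
    and Q: "smooth_on U Q" and g: "smooth_on W g"
  shows "parametrization X \<A> W (\<psi> \<circ> g)"
proof -
  note pat = par[unfolded parametrization_def, THEN conjunct1]
  note V = topological_patchD[OF pat]
  have gW: "g ` W = U" "\<And>y. y \<in> W \<Longrightarrow> Q (g y) = y" "\<And>u. u \<in> U \<Longrightarrow> g (Q u) = u" "Q ` U = W"
    and cont: "continuous_on W g" "continuous_on U Q"
    using hom by (auto simp: homeomorphism_def)
  have injg: "inj_on g W" using gW(2) by (metis inj_on_inverseI)
  have inj: "inj_on (\<psi> \<circ> g) W"
    using injg V(2) U(2) gW(1) by (metis comp_inj_on inj_on_subset)
  have opg: "open (g ` O')" if "open O'" "O' \<subseteq> W" for O'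
  proof -
    have "g ` O' = U \<inter> Q -` O'" using gW that(2) by force
    then show ?thesis using continuous_open_preimage[OF cont(2) U(1) that(1)] by simp
  qed
  have top: "topological_patch X (W, \<psi> \<circ> g)"
    unfolding topological_patch_iff
  proof (intro conjI W inj)
    have "continuous_map (top_of_set W) (top_of_set V) g"
      using cont(1) gW(1) U(2) by (auto simp: continuous_map_in_subtopology)
    then show "continuous_map (top_of_set W) X (\<psi> \<circ> g)"
      using V(4) continuous_map_compose by blast
    show "open_map (top_of_set W) X (\<psi> \<circ> g)"
      unfolding open_map_def
    proof (intro allI impI)
      fix O' assume "openin (top_of_set W) O'"
      then have O': "open O'" "O' \<subseteq> W" using W by (auto simp: openin_open_eq)
      then have "g ` O' \<subseteq> V" using gW(1) U(2) by blast
      then show "openin X ((\<psi> \<circ> g) ` O')"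
        using V(5)[OF opg[OF O']] by (simp add: image_comp)
    qed
  qed
  have "smooth_transition (W, \<psi> \<circ> g) P \<and> smooth_transition P (W, \<psi> \<circ> g)" if P: "P \<in> \<A>" for P
  proof -
    obtain V' \<psi>' where P': "P = (V', \<psi>')" by (cases P)
    note V' = topological_patchD[OF \<A>[OF P, unfolded P']]
    have tr: "smooth_on {u \<in> V. \<psi> u \<in> \<psi>' ` V'} (the_inv_into V' \<psi>' \<circ> \<psi>)"
      "smooth_on {u \<in> V'. \<psi>' u \<in> \<psi> ` V} (the_inv_into V \<psi> \<circ> \<psi>')"
      using par P by (auto simp: parametrization_def smooth_transition_def P')
    have o1: "open {u \<in> V. \<psi> u \<in> \<psi>' ` V'}" by (rule V(6)[OF V'(3)])
    have o2: "open {u \<in> W. (\<psi> \<circ> g) u \<in> \<psi>' ` V'}" by (rule topological_patchD(6)[OF top V'(3)])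
    have o3: "open {u \<in> V'. \<psi>' u \<in> (\<psi> \<circ> g) ` W}" by (rule V'(6)[OF topological_patchD(3)[OF top]])
    have "smooth_on {u \<in> W. (\<psi> \<circ> g) u \<in> \<psi>' ` V'} (\<lambda>u. (the_inv_into V' \<psi>' \<circ> \<psi>) (g u))"
      using U(2) gW(1) by (intro smooth_on_compose[OF tr(1) o1 o2 smooth_on_subset[OF g]]) auto
    then have 1: "smooth_transition (W, \<psi> \<circ> g) P"
      by (simp add: smooth_transition_def P' o_def)
    let ?S = "{u \<in> V'. \<psi>' u \<in> (\<psi> \<circ> g) ` W}"
    have sub: "?S \<subseteq> {u \<in> V'. \<psi>' u \<in> \<psi> ` V}" using U(2) gW(1) by auto
    have inv: "the_inv_into V \<psi> (\<psi>' u) \<in> U \<and> the_inv_into W (\<psi> \<circ> g) (\<psi>' u) = Q (the_inv_into V \<psi> (\<psi>' u))"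
      if "u \<in> ?S" for u
    proof -
      from that have "\<psi>' u \<in> (\<psi> \<circ> g) ` W" by blast
      then obtain y where y: "y \<in> W" "\<psi>' u = \<psi> (g y)" by (metis imageE o_apply)
      have "g y \<in> U" using gW(1) y(1) by blast
      moreover have "the_inv_into V \<psi> (\<psi> (g y)) = g y"
        using the_inv_into_f_f[OF V(2)] \<open>g y \<in> U\<close> U(2) by blast
      moreover have "the_inv_into W (\<psi> \<circ> g) (\<psi> (g y)) = y"
        using the_inv_into_f_f[OF inj y(1)] by simp
      ultimately show ?thesis using gW(2) y by simp
    qed
    have "smooth_on ?S (\<lambda>u. Q ((the_inv_into V \<psi> \<circ> \<psi>') u))"
      using inv by (intro smooth_on_compose[OF Q U(1) o3 smooth_on_subset[OF tr(2) sub]]) auto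
    then have "smooth_on ?S (the_inv_into W (\<psi> \<circ> g) \<circ> \<psi>')"
      using smooth_on_cong[OF o3, of "the_inv_into W (\<psi> \<circ> g) \<circ> \<psi>'" "\<lambda>u. Q ((the_inv_into V \<psi> \<circ> \<psi>') u)"] inv by simp
    then have "smooth_transition P (W, \<psi> \<circ> g)" by (simp add: smooth_transition_def P')
    then show ?thesis using 1 by simp
  qed
  then show ?thesis using top by (simp add: parametrization_def)
qed

text \<open>\<open>parametrization\<close> compares \<open>\<psi>\<close> with the charts of
  \<open>\<A>\<close> only, so the passage between two parametrizations goes through a chart
  \<open>\<xi>\<close> of the atlas around the point.\<close>

lemma parametrization_transition:
  assumes surf: "smooth_surface X \<A>" and par: "parametrization X \<A> V \<psi>" "parametrization X \<A> V' \<psi>'"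
    and u: "u \<in> V'" "\<psi>' u \<in> \<psi> ` V"
  obtains S \<tau> where "open S" "u \<in> S" "S \<subseteq> V'" "smooth_on S \<tau>" "\<tau> ` S \<subseteq> V" "\<And>w. w \<in> S \<Longrightarrow> \<psi> (\<tau> w) = \<psi>' w"
proof -
  have pat: "topological_patch X (V, \<psi>)" "topological_patch X (V', \<psi>')"
    using par by (auto simp: parametrization_def)
  note V = topological_patchD[OF pat(1)] and V' = topological_patchD[OF pat(2)]
  have "\<psi>' u \<in> topspace X" using V'(3) u(1) openin_subset by blast
  then have "\<psi>' u \<in> (\<Union>P\<in>\<A>. snd P ` fst P)" using surf by (simp add: smooth_surface_def case_prod_beta)
  then obtain B \<xi> where P: "(B, \<xi>) \<in> \<A>" "\<psi>' u \<in> \<xi> ` B" by fastforce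
  have "topological_patch X (B, \<xi>)" using surf P(1) by (auto simp: smooth_surface_def)
  note BD = topological_patchD[OF this]
  have t1: "smooth_on {w \<in> V'. \<psi>' w \<in> \<xi> ` B} (the_inv_into B \<xi> \<circ> \<psi>')"
    and t2: "smooth_on {w \<in> B. \<xi> w \<in> \<psi> ` V} (the_inv_into V \<psi> \<circ> \<xi>)"
    using par P(1) by (auto simp: parametrization_def smooth_transition_def)
  define S where "S = {w \<in> V'. \<psi>' w \<in> \<xi> ` B \<inter> \<psi> ` V}"
  have S: "open S" unfolding S_def using V'(6) BD(3) V(3) by blast
  define \<tau> where "\<tau> w = (the_inv_into V \<psi> \<circ> \<xi>) ((the_inv_into B \<xi> \<circ> \<psi>') w)" for w
  have B1: "the_inv_into B \<xi> (\<psi>' w) \<in> B \<and> \<xi> (the_inv_into B \<xi> (\<psi>' w)) = \<psi>' w" if "w \<in> S" for w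
    using that f_the_inv_into_f[OF BD(2)] the_inv_into_into[OF BD(2) _ subset_refl] by (simp add: S_def)
  have V1: "the_inv_into V \<psi> (\<psi>' w) \<in> V \<and> \<psi> (the_inv_into V \<psi> (\<psi>' w)) = \<psi>' w" if "w \<in> S" for w
    using that f_the_inv_into_f[OF V(2)] the_inv_into_into[OF V(2) _ subset_refl] by (simp add: S_def)
  have "smooth_on S \<tau>"
    unfolding \<tau>_def
  proof (rule smooth_on_compose[OF t2 BD(6)[OF V(3)] S smooth_on_subset[OF t1]])
    show "(the_inv_into B \<xi> \<circ> \<psi>') ` S \<subseteq> {w \<in> B. \<xi> w \<in> \<psi> ` V}"
      using B1 by (intro image_subsetI) (simp add: S_def)
  qed (auto simp: S_def)
  moreover have "u \<in> S" using u P(2) by (auto simp: S_def)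
  ultimately show thesis
    using that[of S \<tau>] S V1 B1 by (auto simp: \<tau>_def S_def)
qed

section \<open>Invariance of the curvatures\<close>

lemma (in lorentzian_patch) null_basis_exists:
  assumes "u \<in> V"
  obtains Y1 Y2 where "first_ff f u Y1 Y2 = -1" "first_ff f u Y1 Y1 = 0" "first_ff f u Y2 Y2 = 0"
proof -
  obtain X Y where XY: "first_ff f u X X = -1" "first_ff f u Y Y = 1" "first_ff f u X Y = 0"
    using lorentzian[OF assms] unfolding lorentzian_at_def by blast
  \<comment> \<open>The product of \<open>X + Y\<close> and \<open>X - Y\<close> is -2, which the
    two factors \<open>c\<close> normalize to -1.\<close>
  define c where "c = 1 / sqrt 2"
  have c: "c * c = 1/2" by (simp add: c_def)
  show thesis
  proof (rule that[of "c *\<^sub>R X + c *\<^sub>R Y" "c *\<^sub>R X + (- c) *\<^sub>R Y"])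
  qed (unfold first_ff_bilinear[OF assms] first_ff_commute[of u Y X] XY, insert c, simp_all)
qed

text \<open>Both fundamental forms are pulled back by the derivative of \<open>\<tau>\<close>, which
  is bijective, and in a null basis the two curvatures are expressed by these forms alone.\<close>

lemma curvatures_reparametrized:
  assumes p: "lorentzian_patch V f" and p': "lorentzian_patch V' f'"
    and S: "open S" "S \<subseteq> V'" "u \<in> S" and \<tau>: "smooth_on S \<tau>" "\<tau> ` S \<subseteq> V"
    and f': "\<And>w. w \<in> S \<Longrightarrow> f' w = f (\<tau> w)"
  shows "mean_curvature f' u = mean_curvature f (\<tau> u)" "gauss_curvature f' u = gauss_curvature f (\<tau> u)"
proof -
  interpret P: lorentzian_patch V f by fact
  interpret P': lorentzian_patch V' f' by fact
  let ?d = "dir_deriv \<tau> u"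
  have v: "\<tau> u \<in> V" and u': "u \<in> V'" using S \<tau> by auto
  have d\<tau>: "\<tau> differentiable (at w)" if "w \<in> S" for w using smooth_on_differentiable[OF \<tau>(1) that] .
  have df: "f differentiable (at (\<tau> w))" if "w \<in> S" for w
    using smooth_on_differentiable[OF P.smooth] that \<tau>(2) by blast
  have df': "dir_deriv f' w Y = dir_deriv f (\<tau> w) (dir_deriv \<tau> w Y)" if "w \<in> S" for w Y
    using dir_deriv_transfer[OF S(1) that f'] dir_deriv_compose[of f \<tau> w Y] df[OF that] d\<tau>[OF that] by simp
  have lin: "linear ?d" using smooth_on_linear_dir_deriv[OF \<tau>(1) S(3)] .
  have "inj ?d"
    unfolding linear_injective_0[OF lin]
  proof (intro allI impI)
    fix Z assume "?d Z = 0"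
    then have "dir_deriv f' u Z = 0" using df'[OF S(3)] linear_0[OF P.linear_df[OF v]] by simp
    then show "Z = 0" by (intro P'.nondegenerate[OF u']) (simp add: pe_inner_simps)
  qed
  then have surj: "surj ?d" using linear_injective_imp_surjective[OF lin] by blast
  have ff: "first_ff f' u X Y = first_ff f (\<tau> u) (?d X) (?d Y)" for X Y
    by (simp add: first_ff_def df'[OF S(3)])
  have h: "second_ff f' u X Y = second_ff f (\<tau> u) (?d X) (?d Y)" for X Y
  proof -
    let ?W = "\<lambda>w. dir_deriv \<tau> w Y"
    let ?e = "\<lambda>i w. dir_deriv f (\<tau> w) (axis i 1)"
    have W: "smooth_on S ?W" by (intro smooth_on_dir_deriv_const \<tau>)
    have e: "smooth_on S (?e i)" for i
      using smooth_on_compose[OF smooth_on_dir_deriv_const[OF P.smooth] P.open_V S(1) \<tau>] .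
    have diff: "(\<lambda>w. ?W w $ i) differentiable (at u)" "?e i differentiable (at u)"
        "(\<lambda>w. ?W w $ i *\<^sub>R ?e i w) differentiable (at u)" for i
      by (intro smooth_on_differentiable[OF _ S(3)] smooth_on_scaleR smooth_on_vec_nth S(1) W e)+
    have de: "dir_deriv (?e i) u X = dir_deriv (\<lambda>w. dir_deriv f w (axis i 1)) (\<tau> u) (?d X)" for i
      using dir_deriv_compose[of "\<lambda>w. dir_deriv f w (axis i 1)" \<tau> u X] d\<tau>[OF S(3)]
        smooth_on_differentiable[OF smooth_on_dir_deriv_const[OF P.smooth] v] by simp
    have "dir_deriv (\<lambda>w. dir_deriv f' w Y) u X = dir_deriv (\<lambda>w. ?W w $ 1 *\<^sub>R ?e 1 w + ?W w $ 2 *\<^sub>R ?e 2 w) u X"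
    proof (rule dir_deriv_transfer[OF S(1,3)])
      fix w assume w: "w \<in> S"
      then have "\<tau> w \<in> V" using \<tau>(2) by blast
      then show "dir_deriv f' w Y = ?W w $ 1 *\<^sub>R ?e 1 w + ?W w $ 2 *\<^sub>R ?e 2 w"
        unfolding df'[OF w] by (rule P.df_expand)
    qed
    also have "\<dots> = (?W u $ 1 *\<^sub>R dir_deriv (?e 1) u X + dir_deriv ?W u X $ 1 *\<^sub>R ?e 1 u)
       + (?W u $ 2 *\<^sub>R dir_deriv (?e 2) u X + dir_deriv ?W u X $ 2 *\<^sub>R ?e 2 u)"
      by (simp add: dir_deriv_add dir_deriv_scaleR diff
        dir_deriv_linear[OF bounded_linear_vec_nth smooth_on_differentiable[OF W S(3)]])
    \<comment> \<open>The second derivative of \<open>\<tau>\<close> contributes only a tangent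
      vector and so disappears in the normal part.\<close>
    also have "\<dots> = dir_deriv f (\<tau> u) (dir_deriv ?W u X) + dir_deriv (\<lambda>w. dir_deriv f w (?W u)) (\<tau> u) (?d X)"
    proof -
      have c: "dir_deriv (\<lambda>w. dir_deriv f w Z) (\<tau> u) Y = dir_deriv (\<lambda>w. dir_deriv f w Y) (\<tau> u) Z" for Y Z
        by (rule dir_deriv_commute[OF P.open_V P.smooth v])
      show ?thesis
        unfolding de P.df_expand[OF v, of "dir_deriv ?W u X"] c[of _ "?d X"]
        using linear_vec2[OF P.linear_second_deriv[OF v], of "?d X" "?W u"] by simp
    qed
    finally have "dir_deriv (\<lambda>w. dir_deriv f' w Y) u X =
        dir_deriv f (\<tau> u) (dir_deriv ?W u X) + dir_deriv (\<lambda>w. dir_deriv f w (?d Y)) (\<tau> u) (?d X)" .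
    moreover have "dir_deriv (\<lambda>w. dir_deriv f w (?d Y)) (\<tau> u) (?d X) = tangent_part f (\<tau> u) (dir_deriv (\<lambda>w. dir_deriv f w (?d Y)) (\<tau> u) (?d X))
        + \<langle>dir_deriv (\<lambda>w. dir_deriv f w (?d Y)) (\<tau> u) (?d X), f (\<tau> u)\<rangle> *\<^sub>R f (\<tau> u) + second_ff f (\<tau> u) (?d X) (?d Y)"
      by (simp add: second_ff_def normal_part_def)
    ultimately have "\<exists>Z c. dir_deriv (\<lambda>w. dir_deriv f' w Y) u X =
        dir_deriv f (\<tau> u) Z + c *\<^sub>R f (\<tau> u) + second_ff f (\<tau> u) (?d X) (?d Y)"
      unfolding P.tangent_part_eq_df[OF v]
      by (intro exI[of _ "dir_deriv ?W u X + P.tangent_coord (\<tau> u) (dir_deriv (\<lambda>w. dir_deriv f w (?d Y)) (\<tau> u) (?d X))"]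
          exI[of _ "\<langle>dir_deriv (\<lambda>w. dir_deriv f w (?d Y)) (\<tau> u) (?d X), f (\<tau> u)\<rangle>"])
        (simp only: linear_add[OF P.linear_df[OF v]] add.assoc)
    then obtain Z c where Z: "dir_deriv (\<lambda>w. dir_deriv f' w Y) u X =
        dir_deriv f (\<tau> u) Z + c *\<^sub>R f (\<tau> u) + second_ff f (\<tau> u) (?d X) (?d Y)" by blast
    \<comment> \<open>\<open>normal_part_unique\<close> for \<open>f'\<close> asks for the
      tangential term as an image under the derivative of \<open>f'\<close>.\<close>
    obtain Z' where "Z = ?d Z'" using surj by blast
    then have "dir_deriv (\<lambda>w. dir_deriv f' w Y) u X =
        dir_deriv f' u Z' + c *\<^sub>R f' u + second_ff f (\<tau> u) (?d X) (?d Y)"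
      using Z df'[OF S(3)] f'[OF S(3)] by simp
    then show ?thesis
      unfolding second_ff_def[of f' u]
      by (rule P'.normal_part_unique[OF u'])
        (simp_all add: df'[OF S(3)] f'[OF S(3)] second_ff_def P.normal_part_orthogonal[OF v])
  qed
  obtain Z1 Z2 where Z: "first_ff f (\<tau> u) Z1 Z2 = -1" "first_ff f (\<tau> u) Z1 Z1 = 0" "first_ff f (\<tau> u) Z2 Z2 = 0"
    using P.null_basis_exists[OF v] by blast
  obtain Y1 Y2 where Y: "Z1 = ?d Y1" "Z2 = ?d Y2" using surj by blast
  have Y': "first_ff f' u Y1 Y2 = -1" "first_ff f' u Y1 Y1 = 0" "first_ff f' u Y2 Y2 = 0"
    using Z by (simp_all add: ff Y)
  show "mean_curvature f' u = mean_curvature f (\<tau> u)" "gauss_curvature f' u = gauss_curvature f (\<tau> u)"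
    using P.mean_curvature_null_basis[OF v Z] P'.mean_curvature_null_basis[OF u' Y']
      P.gauss_curvature_null_basis[OF v Z] P'.gauss_curvature_null_basis[OF u' Y'] by (simp_all add: h Y)
qed

section \<open>Curves in the light cone and the surfaces they generate\<close>

lemma curve_deriv_0: "curve_deriv 0 \<alpha> = \<alpha>"
  by (simp add: curve_deriv_def)

lemma curve_deriv_Suc: "curve_deriv (Suc k) \<alpha> t = vector_derivative (curve_deriv k \<alpha>) (at t)"
  by (simp add: curve_deriv_def)

lemma dir_deriv_real:
  fixes c :: "real \<Rightarrow> 'b::real_normed_vector"
  assumes "c differentiable (at t)"
  shows "dir_deriv c t v = v *\<^sub>R vector_derivative c (at t)"
  using frechet_derivative_eq_vector_derivative[OF assms] by (simp add: fun_eq_iff)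

lemma smooth_on_curve_deriv:
  assumes "open I" "smooth_on I \<alpha>"
  shows "smooth_on I (curve_deriv k \<alpha>)"
proof (induction k)
  case 0
  then show ?case using assms(2) by (simp add: curve_deriv_0)
next
  case (Suc k)
  have "dir_deriv (curve_deriv k \<alpha>) t 1 = curve_deriv (Suc k) \<alpha> t" if "t \<in> I" for t
    using dir_deriv_real[OF smooth_on_differentiable[OF Suc that], of 1] by (simp add: curve_deriv_Suc)
  then show ?case
    using smooth_on_dir_deriv_const[OF Suc, of 1]
      smooth_on_cong[OF assms(1), of "\<lambda>t. dir_deriv (curve_deriv k \<alpha>) t 1" "curve_deriv (Suc k) \<alpha>"] by simp
qed

lemma dir_deriv_curve_deriv:
  assumes "open I" "smooth_on I \<alpha>" "t \<in> I"
  shows "dir_deriv (curve_deriv k \<alpha>) t v = v *\<^sub>R curve_deriv (Suc k) \<alpha> t"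
  using dir_deriv_real[OF smooth_on_differentiable[OF smooth_on_curve_deriv[OF assms(1,2)] assms(3)]]
  by (simp add: curve_deriv_Suc)

lemma curve_deriv_eqI:
  assumes I: "open I" and \<alpha>: "smooth_on I \<alpha>"
    and c: "\<And>t. t \<in> I \<Longrightarrow> c 0 t = \<alpha> t" "\<And>k t. t \<in> I \<Longrightarrow> (c k has_vector_derivative c (Suc k) t) (at t)"
  shows "t \<in> I \<Longrightarrow> curve_deriv k \<alpha> t = c k t"
proof (induction k arbitrary: t)
  case 0
  then show ?case by (simp add: curve_deriv_0 c(1))
next
  case (Suc k)
  have "(curve_deriv k \<alpha> has_vector_derivative c (Suc k) t) (at t)"
    using has_vector_derivative_transform_within_open[OF c(2)[OF Suc.prems] I Suc.prems] Suc.IH by metis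
  then show ?case
    using vector_derivative_at by (simp add: curve_deriv_Suc)
qed

lemma curve_deriv_linear:
  assumes I: "open I" and \<alpha>: "smooth_on I \<alpha>" and B: "linear B" and t: "t \<in> I"
  shows "curve_deriv k (\<lambda>t. B (\<alpha> t)) t = B (curve_deriv k \<alpha> t)"
proof (rule curve_deriv_eqI[OF I _ _ _ t])
  have bl: "bounded_linear B" using B by (simp add: linear_conv_bounded_linear)
  show "smooth_on I (\<lambda>t. B (\<alpha> t))" using smooth_on_compose_linear[OF bl I \<alpha>] .
  show "B (curve_deriv 0 \<alpha> t) = B (\<alpha> t)" for t by (simp add: curve_deriv_0)
  show "((\<lambda>t. B (curve_deriv k \<alpha> t)) has_vector_derivative B (curve_deriv (Suc k) \<alpha> t)) (at t)" if "t \<in> I" for k t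
  proof (rule bounded_linear.has_vector_derivative[OF bl])
    show "(curve_deriv k \<alpha> has_vector_derivative curve_deriv (Suc k) \<alpha> t) (at t)"
      using smooth_on_has_derivative[OF smooth_on_curve_deriv[OF I \<alpha>, of k] that]
      by (simp add: has_vector_derivative_def dir_deriv_curve_deriv[OF I \<alpha> that])
  qed
qed

definition generated_surface :: "(real \<Rightarrow> real^5) \<Rightarrow> real \<Rightarrow> real \<Rightarrow> real^5"
  where "generated_surface \<alpha> s t =
    (1/2 * s\<^sup>2 + 27/40 * \<langle>curve_deriv 3 \<alpha> t, curve_deriv 3 \<alpha> t\<rangle>) *\<^sub>R \<alpha> t
    + (3/2 * s) *\<^sub>R curve_deriv 1 \<alpha> t + (3/2) *\<^sub>R curve_deriv 2 \<alpha> t"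

locale cone_curve =
  fixes I :: "real set" and \<alpha> :: "real \<Rightarrow> real^5"
  assumes open_I: "open I" and smooth_\<alpha>: "smooth_on I \<alpha>"
    and cone: "t \<in> I \<Longrightarrow> \<langle>\<alpha> t, \<alpha> t\<rangle> = 0"
    and null: "t \<in> I \<Longrightarrow> \<langle>curve_deriv 1 \<alpha> t, curve_deriv 1 \<alpha> t\<rangle> = 0"
    and unit: "t \<in> I \<Longrightarrow> \<langle>curve_deriv 2 \<alpha> t, curve_deriv 2 \<alpha> t\<rangle> = 4/9"
begin

text \<open>Differentiating a constant product moves a derivative from one factor to the other.
  Repeated use determines all products of the derivatives of orders 0 to 3 except the square of the
  third.\<close>

lemma inner_deriv:
  assumes t: "t \<in> I" and c: "\<And>t. t \<in> I \<Longrightarrow> \<langle>curve_deriv k \<alpha> t, curve_deriv l \<alpha> t\<rangle> = c"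
  shows "\<langle>curve_deriv k \<alpha> t, curve_deriv (Suc l) \<alpha> t\<rangle> = - \<langle>curve_deriv (Suc k) \<alpha> t, curve_deriv l \<alpha> t\<rangle>"
proof -
  have "dir_deriv (\<lambda>t. \<langle>curve_deriv k \<alpha> t, curve_deriv l \<alpha> t\<rangle>) t 1 = dir_deriv (\<lambda>t. c) t 1"
    by (rule dir_deriv_transfer[OF open_I t c])
  then show ?thesis
    using dir_deriv_pe_inner[of "curve_deriv k \<alpha>" t "curve_deriv l \<alpha>" 1]
      smooth_on_differentiable[OF smooth_on_curve_deriv[OF open_I smooth_\<alpha>] t]
    by (simp add: dir_deriv_curve_deriv[OF open_I smooth_\<alpha> t])
qed

lemma inner_00: "t \<in> I \<Longrightarrow> \<langle>curve_deriv 0 \<alpha> t, curve_deriv 0 \<alpha> t\<rangle> = 0"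
  by (simp add: curve_deriv_0 cone)

lemma inner_01: "t \<in> I \<Longrightarrow> \<langle>curve_deriv 0 \<alpha> t, curve_deriv 1 \<alpha> t\<rangle> = 0"
  using inner_deriv[of t 0 0 0] inner_00 by (simp add: pe_inner_commute)

lemma inner_02: "t \<in> I \<Longrightarrow> \<langle>curve_deriv 0 \<alpha> t, curve_deriv 2 \<alpha> t\<rangle> = 0"
  using inner_deriv[of t 0 1 0] inner_01 null by (simp add: numeral_2_eq_2)

lemma inner_12: "t \<in> I \<Longrightarrow> \<langle>curve_deriv 1 \<alpha> t, curve_deriv 2 \<alpha> t\<rangle> = 0"
  using inner_deriv[of t 1 1 0] null by (simp add: numeral_2_eq_2 pe_inner_commute)

lemma inner_03: "t \<in> I \<Longrightarrow> \<langle>curve_deriv 0 \<alpha> t, curve_deriv 3 \<alpha> t\<rangle> = 0"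
  using inner_deriv[of t 0 2 0] inner_02 inner_12 by (simp add: numeral_2_eq_2 numeral_3_eq_3)

lemma inner_13: "t \<in> I \<Longrightarrow> \<langle>curve_deriv 1 \<alpha> t, curve_deriv 3 \<alpha> t\<rangle> = - 4/9"
  using inner_deriv[of t 1 2 0] inner_12 unit by (simp add: numeral_2_eq_2 numeral_3_eq_3)

lemma inner_23: "t \<in> I \<Longrightarrow> \<langle>curve_deriv 2 \<alpha> t, curve_deriv 3 \<alpha> t\<rangle> = 0"
  using inner_deriv[of t 2 2 "4/9"] unit by (simp add: numeral_2_eq_2 numeral_3_eq_3 pe_inner_commute)

lemmas inner_products = inner_00 inner_01 inner_02 inner_03 inner_12 inner_13 inner_23

end

text \<open>The coefficient \<open>G\<close> makes \<open>X2\<close> null, and the second null normal \<open>n4\<close> is obtained from the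
  component \<open>b\<close> of the derivative of \<open>F2\<close> along \<open>X2\<close> that is orthogonal to \<open>F1\<close> and \<open>F2\<close>.\<close>

lemma generated_surface_curvatures:
  assumes cc: "cone_curve I \<alpha>" and lp: "lorentzian_patch V f"
    and VI: "\<And>u. u \<in> V \<Longrightarrow> u$2 \<in> I" and f: "\<And>u. u \<in> V \<Longrightarrow> f u = generated_surface \<alpha> (u$1) (u$2)"
  obtains X1 X2 n3 n4 where "adapted_frame f V X1 X2 n3 n4"
    "\<And>u. u \<in> V \<Longrightarrow> mean_curvature f u = 0" "\<And>u. u \<in> V \<Longrightarrow> gauss_curvature f u = 1/3"
    "\<And>u. u \<in> V \<Longrightarrow> normal_curvature f X1 X2 n3 n4 u = - 2/3"
proof -
  interpret C: cone_curve I \<alpha> by fact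
  interpret P: lorentzian_patch V f by fact
  note oV = P.open_V
  define c where "c k u = curve_deriv k \<alpha> (u $ 2)" for k and u :: "real^2"
  define s where "s u = u $ 1" for u :: "real^2"
  have smc: "smooth_on V (c k)" for k
    unfolding c_def using VI
    by (intro smooth_on_compose[OF smooth_on_curve_deriv[OF C.open_I C.smooth_\<alpha>] C.open_I oV]
        smooth_on_vec_nth smooth_on_ident oV) auto
  have sms: "smooth_on V s" unfolding s_def by (intro smooth_on_vec_nth smooth_on_ident oV)
  have dc: "dir_deriv (c k) u v = v$2 *\<^sub>R c (Suc k) u" if "u \<in> V" for k u v
  proof -
    have n: "dir_deriv (\<lambda>u::real^2. u $ 2) u v = v $ 2" "(\<lambda>u::real^2. u $ 2) differentiable (at u)"
      by (auto intro!: dir_deriv_eqI bounded_linear_imp_has_derivative bounded_linear_imp_differentiable bounded_linear_vec_nth)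
    show ?thesis
      using dir_deriv_compose[OF smooth_on_differentiable[OF smooth_on_curve_deriv[OF C.open_I C.smooth_\<alpha>] VI[OF that]] n(2), of k v]
        dir_deriv_curve_deriv[OF C.open_I C.smooth_\<alpha> VI[OF that], of k]
      by (simp add: c_def[abs_def] n(1))
  qed
  have ds: "dir_deriv s u v = v $ 1" for u v
    unfolding s_def by (intro dir_deriv_eqI bounded_linear_imp_has_derivative bounded_linear_vec_nth)
  have cin: "\<langle>c 0 u, c 0 u\<rangle> = 0" "\<langle>c 0 u, c 1 u\<rangle> = 0" "\<langle>c 0 u, c 2 u\<rangle> = 0" "\<langle>c 0 u, c 3 u\<rangle> = 0"
    "\<langle>c 1 u, c 1 u\<rangle> = 0" "\<langle>c 1 u, c 2 u\<rangle> = 0" "\<langle>c 1 u, c 3 u\<rangle> = - 4/9" "\<langle>c 2 u, c 2 u\<rangle> = 4/9" "\<langle>c 2 u, c 3 u\<rangle> = 0"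
    "\<langle>c 1 u, c 0 u\<rangle> = 0" "\<langle>c 2 u, c 0 u\<rangle> = 0" "\<langle>c 3 u, c 0 u\<rangle> = 0" "\<langle>c 2 u, c 1 u\<rangle> = 0" "\<langle>c 3 u, c 1 u\<rangle> = - 4/9"
    "\<langle>c 3 u, c 2 u\<rangle> = 0" if "u \<in> V" for u
    using C.inner_products[OF VI[OF that]] C.null[OF VI[OF that]] C.unit[OF VI[OF that]]
    by (simp_all add: c_def pe_inner_commute)
  note cin = cin[unfolded One_nat_def]
  define \<kappa> where "\<kappa> u = \<langle>c 3 u, c 3 u\<rangle>" for u
  \<comment> \<open>With the products above, the square of \<open>F2\<close> comes out as
    \<open>1/3 * s\<^sup>2 + 27/20 * \<kappa> - 2 * G\<close>.\<close>
  define G where "G u = 1/6 * (s u)\<^sup>2 + 27/40 * \<kappa> u" for u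
  have sm\<kappa>: "smooth_on V \<kappa>" unfolding \<kappa>_def by (intro smooth_on_pe_inner smc oV)
  have smG: "smooth_on V G" unfolding G_def
    by (intro smooth_on_add smooth_on_mult smooth_on_const smooth_on_power sm\<kappa> sms oV)
  define X1 :: "real^2 \<Rightarrow> real^2" where "X1 = (\<lambda>u. axis 1 1)"
  define X2 :: "real^2 \<Rightarrow> real^2" where "X2 = (\<lambda>u. G u *\<^sub>R axis 1 1 + axis 2 1)"
  have X: "X1 u $ 1 = 1" "X1 u $ 2 = 0" "X2 u $ 1 = G u" "X2 u $ 2 = 1" for u
    by (simp_all add: X1_def X2_def axis_def)
  have smX: "smooth_on V X1" "smooth_on V X2"
    unfolding X1_def X2_def by (intro smooth_on_add smooth_on_scaleR smooth_on_const smG oV)+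
  define F1 where "F1 = (\<lambda>u. dir_deriv f u (X1 u))"
  define F2 where "F2 = (\<lambda>u. dir_deriv f u (X2 u))"
  have smF: "smooth_on V F1" "smooth_on V F2"
    unfolding F1_def F2_def by (intro smooth_on_dir_deriv P.smooth smX oV)+
  have feq: "f u = (1/2 * (s u)\<^sup>2 + 27/40 * \<kappa> u) *\<^sub>R c 0 u + (3/2 * s u) *\<^sub>R c 1 u + (3/2) *\<^sub>R c 2 u" if "u \<in> V" for u
    by (simp add: f[OF that] generated_surface_def \<kappa>_def c_def s_def curve_deriv_0)
  have df: "dir_deriv f u v = (s u * v$1 + 27/40 * dir_deriv \<kappa> u v) *\<^sub>R c 0 u
      + (v$2 * (1/2 * (s u)\<^sup>2 + 27/40 * \<kappa> u) + 3/2 * v$1) *\<^sub>R c 1 u + (3/2 * s u * v$2) *\<^sub>R c 2 u + (3/2 * v$2) *\<^sub>R c 3 u"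
    if u: "u \<in> V" for u v
  proof -
    note d = smc[THEN smooth_on_differentiable, OF u] sms[THEN smooth_on_differentiable, OF u]
      sm\<kappa>[THEN smooth_on_differentiable, OF u]
    let ?\<mu> = "\<lambda>u. 1/2 * (s u * s u) + 27/40 * \<kappa> u"
    have d2: "(\<lambda>u. s u * s u) differentiable (at u)" "(\<lambda>u. 1/2 * (s u * s u)) differentiable (at u)"
        "(\<lambda>u. 27/40 * \<kappa> u) differentiable (at u)" "?\<mu> differentiable (at u)" "(\<lambda>u. 3/2 * s u) differentiable (at u)"
        "(\<lambda>u. ?\<mu> u *\<^sub>R c 0 u) differentiable (at u)" "(\<lambda>u. (3/2 * s u) *\<^sub>R c 1 u) differentiable (at u)"
        "(\<lambda>u. (3/2::real) *\<^sub>R c 2 u) differentiable (at u)"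
        "(\<lambda>u. ?\<mu> u *\<^sub>R c 0 u + (3/2 * s u) *\<^sub>R c 1 u) differentiable (at u)"
      by (intro smooth_on_differentiable[OF _ u] smooth_on_add smooth_on_scaleR smooth_on_mult smooth_on_const
          sm\<kappa> sms smc oV)+
    have "dir_deriv ?\<mu> u v = s u * v$1 + 27/40 * dir_deriv \<kappa> u v"
      by (simp only: dir_deriv_add[OF d2(2,3)] dir_deriv_mult[OF differentiable_const d2(1)]
          dir_deriv_mult[OF d(2,2)] dir_deriv_mult[OF differentiable_const d(3)] ds) simp
    moreover have "dir_deriv (\<lambda>u. 3/2 * s u) u v = 3/2 * v$1"
      by (simp only: dir_deriv_mult[OF differentiable_const d(2)] ds) simp
    moreover have "dir_deriv f u v = dir_deriv (\<lambda>u. ?\<mu> u *\<^sub>R c 0 u + (3/2 * s u) *\<^sub>R c 1 u + (3/2::real) *\<^sub>R c 2 u) u v"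
      by (rule dir_deriv_transfer[OF oV u]) (simp add: feq power2_eq_square)
    ultimately have "dir_deriv f u v = (?\<mu> u *\<^sub>R dir_deriv (c 0) u v + (s u * v$1 + 27/40 * dir_deriv \<kappa> u v) *\<^sub>R c 0 u)
       + ((3/2 * s u) *\<^sub>R dir_deriv (c 1) u v + (3/2 * v$1) *\<^sub>R c 1 u) + (3/2) *\<^sub>R dir_deriv (c 2) u v"
      by (simp add: dir_deriv_add dir_deriv_scaleR d d2)
    then show ?thesis
      by (simp add: dc[OF u] eval_nat_numeral power2_eq_square algebra_simps)
  qed
  have d\<kappa>: "dir_deriv \<kappa> u (axis 1 1) = 0" if u: "u \<in> V" for u
  proof -
    note d = smc[THEN smooth_on_differentiable, OF u]
    show ?thesis unfolding \<kappa>_def by (simp add: dir_deriv_pe_inner d dc[OF u] axis_def pe_inner_simps)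
  qed
  have F1: "F1 u = s u *\<^sub>R c 0 u + (3/2) *\<^sub>R c 1 u" if "u \<in> V" for u
    using df[OF that, of "axis 1 1"] d\<kappa>[OF that] by (simp add: F1_def X1_def axis_def)
  have F2: "F2 u = (s u * G u + 27/40 * dir_deriv \<kappa> u (X2 u)) *\<^sub>R c 0 u
      + (1/2 * (s u)\<^sup>2 + 27/40 * \<kappa> u + 3/2 * G u) *\<^sub>R c 1 u + (3/2 * s u) *\<^sub>R c 2 u + (3/2) *\<^sub>R c 3 u" if "u \<in> V" for u
    using df[OF that, of "X2 u"] by (simp add: F2_def X)
  have F11: "\<langle>F1 u, F1 u\<rangle> = 0" if "u \<in> V" for u
    by (simp add: F1[OF that] pe_inner_simps cin[OF that])
  have F12: "\<langle>F1 u, F2 u\<rangle> = -1" if "u \<in> V" for u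
    by (simp add: F1[OF that] F2[OF that] pe_inner_simps cin[OF that])
  have F22: "\<langle>F2 u, F2 u\<rangle> = 0" if "u \<in> V" for u
    by (simp add: F2[OF that] pe_inner_simps cin[OF that]) (simp add: \<kappa>_def[symmetric] G_def field_simps power2_eq_square)
  have c0: "\<langle>c 0 u, F1 u\<rangle> = 0" "\<langle>c 0 u, F2 u\<rangle> = 0" "\<langle>c 0 u, f u\<rangle> = 0" if "u \<in> V" for u
    by (simp_all add: F1[OF that] F2[OF that] feq[OF that] pe_inner_simps cin[OF that])
  have Ff: "\<langle>F1 u, f u\<rangle> = 0" "\<langle>F2 u, f u\<rangle> = 0" if "u \<in> V" for u
    unfolding F1_def F2_def by (rule P.inner_df_f[OF that])+
  have dF1: "dir_deriv F1 u v = (s u * v$2) *\<^sub>R c 1 u + v$1 *\<^sub>R c 0 u + (3/2 * v$2) *\<^sub>R c 2 u" if u: "u \<in> V" for u v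
  proof -
    note d = smc[THEN smooth_on_differentiable, OF u] sms[THEN smooth_on_differentiable, OF u]
    have d2: "(\<lambda>u. s u *\<^sub>R c 0 u) differentiable (at u)" "(\<lambda>u. (3/2::real) *\<^sub>R c 1 u) differentiable (at u)"
      by (intro smooth_on_differentiable[OF _ u] smooth_on_scaleR smooth_on_const sms smc oV)+
    have "dir_deriv F1 u v = dir_deriv (\<lambda>u. s u *\<^sub>R c 0 u + (3/2::real) *\<^sub>R c 1 u) u v"
      by (rule dir_deriv_transfer[OF oV u F1])
    then show ?thesis
      by (simp add: dir_deriv_add dir_deriv_scaleR d d2 ds dc[OF u] eval_nat_numeral)
  qed
  have D1F1: "dir_deriv F1 u (X1 u) = c 0 u" if "u \<in> V" for u
    by (simp add: dF1[OF that] X)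
  \<comment> \<open>Comparing coefficients of \<open>c 0\<close> forces \<open>G\<close> to be the
    coefficient in \<open>f\<close> minus \<open>s\<^sup>2 / 3\<close>. That this is also the value
    for which \<open>F2\<close> is null singles out the constant 27/40.\<close>
  have D2F1: "dir_deriv F1 u (X2 u) = (- (1/3) * s u) *\<^sub>R F1 u + f u" if "u \<in> V" for u
    unfolding dF1[OF that] X F1[OF that] feq[OF that] G_def
    by (simp add: vec_eq_iff) (simp add: field_simps power2_eq_square)
  define b where "b u = dir_deriv F2 u (X2 u) - (1/3 * s u) *\<^sub>R F2 u" for u
  have smb: "smooth_on V b" unfolding b_def
    by (intro smooth_on_diff smooth_on_dir_deriv smooth_on_scaleR smooth_on_mult smooth_on_const smF smX sms oV)
  have const: "\<langle>dir_deriv F2 u v, h u\<rangle> = - \<langle>F2 u, dir_deriv h u v\<rangle>"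
    if u: "u \<in> V" and h: "smooth_on V h" and e: "\<And>w. w \<in> V \<Longrightarrow> \<langle>F2 w, h w\<rangle> = e" for u h e v
  proof -
    have "dir_deriv (\<lambda>w. \<langle>F2 w, h w\<rangle>) u v = dir_deriv (\<lambda>w. e) u v"
      by (rule dir_deriv_transfer[OF oV u e])
    then show ?thesis
      using dir_deriv_pe_inner[OF smooth_on_differentiable[OF smF(2) u] smooth_on_differentiable[OF h u], of v] by simp
  qed
  \<comment> \<open>The derivative of \<open>F2\<close> contains the fourth derivative of the curve
    and is never expanded; differentiating constant products reduces its products with the frame to
    known derivatives.\<close>
  have D2F2: "\<langle>dir_deriv F2 u (X2 u), F2 u\<rangle> = 0" "\<langle>dir_deriv F2 u (X2 u), F1 u\<rangle> = - (1/3) * s u"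
    "\<langle>dir_deriv F2 u (X2 u), f u\<rangle> = 0" "\<langle>dir_deriv F2 u (X2 u), c 0 u\<rangle> = 2/3" if u: "u \<in> V" for u
  proof -
    show "\<langle>dir_deriv F2 u (X2 u), F2 u\<rangle> = 0"
      using const[OF u smF(2) F22, of "X2 u"] by (simp add: pe_inner_commute)
    have "\<langle>F2 w, F1 w\<rangle> = -1" if "w \<in> V" for w using F12[OF that] by (simp add: pe_inner_commute)
    from const[OF u smF(1) this, of "X2 u"]
    show "\<langle>dir_deriv F2 u (X2 u), F1 u\<rangle> = - (1/3) * s u"
      using F12[OF u] Ff[OF u] by (simp add: D2F1[OF u] pe_inner_simps pe_inner_commute[of "F2 u" "F1 u"])
    show "\<langle>dir_deriv F2 u (X2 u), f u\<rangle> = 0"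
      using const[OF u P.smooth Ff(2), of "X2 u"] F22[OF u] by (simp add: F2_def)
    have "\<langle>F2 w, c 0 w\<rangle> = 0" if "w \<in> V" for w using c0[OF that] by (simp add: pe_inner_commute)
    from const[OF u smc this, of "X2 u"]
    have "\<langle>dir_deriv F2 u (X2 u), c 0 u\<rangle> = - \<langle>F2 u, c 1 u\<rangle>"
      by (simp add: dc[OF u] X)
    also have "c 1 u = (2/3) *\<^sub>R F1 u - (2/3 * s u) *\<^sub>R c 0 u"
      by (simp add: F1[OF u] algebra_simps)
    finally show "\<langle>dir_deriv F2 u (X2 u), c 0 u\<rangle> = 2/3"
      using F12[OF u] c0[OF u] by (simp add: pe_inner_simps pe_inner_commute[of "F2 u"])
  qed
  have bin: "\<langle>b u, F1 u\<rangle> = 0" "\<langle>b u, F2 u\<rangle> = 0" "\<langle>b u, f u\<rangle> = 0" "\<langle>b u, c 0 u\<rangle> = 2/3" if "u \<in> V" for u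
    using D2F2[OF that] F22[OF that] F12[OF that] Ff[OF that] c0[OF that]
    by (simp_all add: b_def pe_inner_simps pe_inner_commute[of "F2 u" "F1 u"] pe_inner_commute[of "F2 u" "c 0 u"])
  \<comment> \<open>Since \<open>b\<close> has product 2/3 with \<open>c 0\<close>, the factor -3/2
    normalizes the product of \<open>c 0\<close> and \<open>n4\<close> to -1; the multiple of
    \<open>c 0\<close> then cancels the square of the first term.\<close>
  define n4 where "n4 u = (- (3/2)) *\<^sub>R b u + (9/8 * \<langle>b u, b u\<rangle>) *\<^sub>R c 0 u" for u
  have smn4: "smooth_on V n4" unfolding n4_def
    by (intro smooth_on_add smooth_on_scaleR smooth_on_mult smooth_on_const smooth_on_pe_inner smb smc oV)
  have n4: "\<langle>c 0 u, n4 u\<rangle> = -1" "\<langle>n4 u, n4 u\<rangle> = 0" "\<langle>F1 u, n4 u\<rangle> = 0" "\<langle>F2 u, n4 u\<rangle> = 0" "\<langle>n4 u, f u\<rangle> = 0" if "u \<in> V" for u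
    using bin[OF that] c0[OF that] cin[OF that]
    by (simp_all add: n4_def pe_inner_simps pe_inner_commute[of "c 0 u" "b u"] pe_inner_commute[of "F1 u"]
        pe_inner_commute[of "F2 u"])
  have adapted: "adapted_frame f V X1 X2 (c 0) n4"
    unfolding adapted_frame_def Let_def
    using smX smc[of 0] smn4 F11 F12 F22 n4 c0 cin
    by (simp add: F1_def[symmetric] F2_def[symmetric] fun_cong[OF F1_def, symmetric] fun_cong[OF F2_def, symmetric]
        pe_inner_commute)
  have ff: "first_ff f u (X1 u) (X2 u) = -1" "first_ff f u (X1 u) (X1 u) = 0" "first_ff f u (X2 u) (X2 u) = 0" if "u \<in> V" for u
    using F11[OF that] F12[OF that] F22[OF that] by (simp_all add: first_ff_def F1_def F2_def)
  have minimal: "second_ff f u (X1 u) (X2 u) = 0" if u: "u \<in> V" for u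
  proof -
    have "second_ff f u (X2 u) (X1 u) = normal_part f u (dir_deriv F1 u (X2 u))"
      by (simp add: second_ff_def F1_def X1_def)
    also have "\<dots> = 0"
    proof (rule P.normal_part_unique[OF u])
      have "F1 u = dir_deriv f u (X1 u)" by (simp add: F1_def)
      then show "dir_deriv F1 u (X2 u) = dir_deriv f u ((- (1/3) * s u) *\<^sub>R X1 u) + 1 *\<^sub>R f u + 0"
        by (simp only: D2F1[OF u] linear_cmul[OF P.linear_df[OF u]]) simp
    qed (simp_all add: pe_inner_simps)
    finally show ?thesis using P.second_ff_commute[OF u] by metis
  qed
  interpret M: minimal_frame V f X1 X2 "c 0" n4
    using adapted minimal by unfold_locales
  have coeffs: "M.a3 u = 1" "M.a4 u = 0" "M.b4 u = - 2/3" if "u \<in> V" for u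
    using D1F1[OF that] n4(1)[OF that] cin(1)[OF that] D2F2(4)[OF that]
    by (simp_all add: M.a3_def M.a4_def M.b4_def F1_def F2_def)
  show thesis
  proof (rule that[OF adapted])
    fix u assume u: "u \<in> V"
    show "mean_curvature f u = 0"
      using P.mean_curvature_null_basis[OF u ff[OF u]] minimal[OF u] by simp
    show "gauss_curvature f u = 1/3" "normal_curvature f X1 X2 (c 0) n4 u = - 2/3"
      using M.gauss_curvature_frame[OF u] M.normal_curvature_frame[OF u] coeffs[OF u] by simp_all
  qed
qed

lemma lorentzian_patch_parametrization:
  assumes "lorentzian_surface_in_S42 X \<A> \<phi>" "parametrization X \<A> V \<psi>"
  shows "lorentzian_patch V (\<phi> \<circ> \<psi>)"
proof
  have pat: "topological_patch X (V, \<psi>)" using assms(2) by (simp add: parametrization_def)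
  show "open V" using topological_patchD(1)[OF pat] .
  show "smooth_on V (\<phi> \<circ> \<psi>)"
    using assms by (auto simp: lorentzian_surface_in_S42_def immersion_def)
  show "\<langle>(\<phi> \<circ> \<psi>) u, (\<phi> \<circ> \<psi>) u\<rangle> = 1" if "u \<in> V" for u
  proof -
    have "\<psi> u \<in> topspace X" using openin_subset[OF topological_patchD(3)[OF pat]] that by blast
    then show ?thesis using assms(1) by (auto simp: lorentzian_surface_in_S42_def S42_def)
  qed
  show "lorentzian_at (\<phi> \<circ> \<psi>) u" if "u \<in> V" for u
    using assms that by (auto simp: lorentzian_surface_in_S42_def)
qed

text \<open>The formula of the surface commutes with linear isometries, so the isometry of the
  congruence is absorbed by replacing \<open>\<alpha>\<close> with its image under the inverse
  isometry.\<close>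

lemma congruent_near_generated_surface:
  assumes surf: "lorentzian_surface_in_S42 X \<A> \<phi>"
    and \<alpha>: "null_curve I \<alpha>" "\<alpha> ` I \<subseteq> light_cone" "\<And>t. t \<in> I \<Longrightarrow> \<langle>curve_deriv 2 \<alpha> t, curve_deriv 2 \<alpha> t\<rangle> = 4/9"
    and cong: "congruent_near X \<A> \<phi> p (UNIV \<times> I) (generated_surface \<alpha>)"
  obtains V \<psi> X1 X2 n3 n4 where "parametrization X \<A> V \<psi>" "p \<in> \<psi> ` V" "adapted_frame (\<phi> \<circ> \<psi>) V X1 X2 n3 n4"
    "\<And>u. u \<in> V \<Longrightarrow> mean_curvature (\<phi> \<circ> \<psi>) u = 0" "\<And>u. u \<in> V \<Longrightarrow> gauss_curvature (\<phi> \<circ> \<psi>) u = 1/3"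
    "\<And>u. u \<in> V \<Longrightarrow> normal_curvature (\<phi> \<circ> \<psi>) X1 X2 n3 n4 u = - 2/3"
proof -
  obtain A V \<psi> where A: "linear_isometry A" and par: "parametrization X \<A> V \<psi>" and p: "p \<in> \<psi> ` V"
    and x: "\<And>u. u \<in> V \<Longrightarrow> u$2 \<in> I" "\<And>u. u \<in> V \<Longrightarrow> A (\<phi> (\<psi> u)) = generated_surface \<alpha> (u$1) (u$2)"
    using cong by (auto simp: congruent_near_def)
  obtain B where B: "linear_isometry B" "\<And>v. B (A v) = v" "\<And>v. A (B v) = v"
    using linear_isometry_inverse[OF A] by blast
  have lin: "linear B" and iso: "\<And>v w. \<langle>B v, B w\<rangle> = \<langle>v, w\<rangle>" using B(1) by (auto simp: linear_isometry_def)
  have I: "open I" "smooth_on I \<alpha>" using \<alpha>(1) by (auto simp: null_curve_def)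
  note cd = curve_deriv_linear[OF I lin]
  have cc: "cone_curve I (\<lambda>t. B (\<alpha> t))"
  proof
    show "smooth_on I (\<lambda>t. B (\<alpha> t))"
      using smooth_on_compose_linear[OF _ I] lin by (simp add: linear_conv_bounded_linear)
  qed (use I \<alpha> in \<open>auto simp: cd iso null_curve_def light_cone_def\<close>)
  have eq: "(\<phi> \<circ> \<psi>) u = generated_surface (\<lambda>t. B (\<alpha> t)) (u$1) (u$2)" if "u \<in> V" for u
    using x(1)[OF that] arg_cong[OF x(2)[OF that], of B]
    by (simp add: B(2) generated_surface_def cd iso linear_add[OF lin] linear_cmul[OF lin])
  obtain X1 X2 n3 n4 where "adapted_frame (\<phi> \<circ> \<psi>) V X1 X2 n3 n4"
    "\<And>u. u \<in> V \<Longrightarrow> mean_curvature (\<phi> \<circ> \<psi>) u = 0" "\<And>u. u \<in> V \<Longrightarrow> gauss_curvature (\<phi> \<circ> \<psi>) u = 1/3"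
    "\<And>u. u \<in> V \<Longrightarrow> normal_curvature (\<phi> \<circ> \<psi>) X1 X2 n3 n4 u = - 2/3"
    using generated_surface_curvatures[OF cc lorentzian_patch_parametrization[OF surf par] x(1) eq] by blast
  then show thesis using that par p by blast
qed

section \<open>Frames of constant curvature\<close>

lemma open_nonzero:
  fixes h :: "'a::real_normed_vector \<Rightarrow> real"
  assumes "open S" "smooth_on S h"
  shows "open {u \<in> S. h u \<noteq> 0}"
proof -
  have "{u \<in> S. h u \<noteq> 0} = S \<inter> h -` (- {0})" by auto
  then show ?thesis
    using continuous_open_preimage[OF smooth_on_continuous_on[OF assms(2)] assms(1), of "- {0}"]
    by (simp add: open_Compl)
qed

context lorentzian_patch
begin

lemma second_ff_scale:
  assumes "u \<in> V"
  shows "second_ff f u (a *\<^sub>R X) (b *\<^sub>R Y) = (a * b) *\<^sub>R second_ff f u X Y"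
  using second_ff_bilinear(1)[OF assms, of a X 0 X] second_ff_bilinear(2)[OF assms, of X b Y 0 Y] by simp

end

context minimal_frame
begin

text \<open>Exchanging both pairs turns \<open>a3\<close>, \<open>a4\<close>, \<open>b3\<close>,
  \<open>b4\<close> into \<open>b4\<close>, \<open>b3\<close>, \<open>a4\<close>, \<open>a3\<close>,
  so the products a3 b4 and a4 b3 are each preserved. Statements about one null direction thereby
  yield those about the other.\<close>

lemma swap12: "minimal_frame V f X2 X1 n4 n3"
proof
  show "adapted_frame f V X2 X1 n4 n3"
    using adapted by (auto simp: adapted_frame_def Let_def pe_inner_commute)
  show "second_ff f u (X2 u) (X1 u) = 0" if "u \<in> V" for u
    using minimal[OF that] second_ff_commute[OF that] by simp
qed

text \<open>Exchanging the normals alone interchanges the products a3 b4 and a4 b3 and reverses the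
  sign of the normal curvature.\<close>

lemma swap34: "minimal_frame V f X1 X2 n4 n3"
proof
  show "adapted_frame f V X1 X2 n4 n3"
    using adapted by (auto simp: adapted_frame_def Let_def pe_inner_commute)
qed (rule minimal)

text \<open>Only the directions of a null basis are determined; a factor on one field and its
  inverse on the other preserve the product -1. The factor 1 gives the restriction of a frame to an
  open subset.\<close>

lemma rescale:
  assumes U: "open U" "U \<subseteq> V" and l: "smooth_on U l" "\<And>u. u \<in> U \<Longrightarrow> l u \<noteq> 0"
  shows "minimal_frame U f (\<lambda>u. l u *\<^sub>R X1 u) (\<lambda>u. inverse (l u) *\<^sub>R X2 u) n3 n4"
proof
  have UV: "u \<in> V" if "u \<in> U" for u using U that by blast
  show "open U" "smooth_on U f" using U smooth_on_subset[OF smooth] by auto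
  show "\<langle>f u, f u\<rangle> = 1" "lorentzian_at f u" if "u \<in> U" for u
    using sphere[OF UV[OF that]] lorentzian[OF UV[OF that]] by auto
  show "second_ff f u (l u *\<^sub>R X1 u) (inverse (l u) *\<^sub>R X2 u) = 0" if "u \<in> U" for u
    using minimal[OF UV[OF that]] by (simp add: second_ff_scale[OF UV[OF that]])
  have "smooth_on U (\<lambda>u. l u *\<^sub>R X1 u)" "smooth_on U (\<lambda>u. inverse (l u) *\<^sub>R X2 u)" "smooth_on U n3" "smooth_on U n4"
    using smooth_frame[THEN smooth_on_subset, OF U(2)] l
    by (auto intro!: smooth_on_scaleR smooth_on_inverse U(1))
  moreover have "dir_deriv f u (c *\<^sub>R Z) = c *\<^sub>R dir_deriv f u Z" if "u \<in> U" for u c Z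
    using linear_cmul[OF linear_df[OF UV[OF that]]] .
  ultimately show "adapted_frame f U (\<lambda>u. l u *\<^sub>R X1 u) (\<lambda>u. inverse (l u) *\<^sub>R X2 u) n3 n4"
    using null_frame_inner[OF frame] UV l(2)
    by (auto simp: adapted_frame_def Let_def pe_inner_simps)
qed

text \<open>For the frame with both pairs exchanged, \<open>w2\<close> and \<open>m2\<close> become
  \<open>- w1\<close> and \<open>- m1\<close>, and its Codazzi equations are the ones wanted
  here.\<close>

lemma codazzi_D1:
  assumes u: "u \<in> V"
  shows "D1 b4 u = (m1 u - 2 * w1 u) * b4 u" "D1 b3 u = (- m1 u - 2 * w1 u) * b3 u"
proof -
  interpret S: minimal_frame V f X2 X1 n4 n3 by (rule swap12)
  note fr = null_frame_inner[OF frame[OF u]]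
  have eqs: "S.a3 = b4" "S.a4 = b3"
    by (simp_all add: fun_eq_iff S.a3_def S.a4_def b4_def b3_def)
  have "S.w2 u = - w1 u" "S.m2 u = - m1 u"
    by (simp_all add: S.w2_def S.m2_def D1F2[OF u] D1n4[OF u] pe_inner_simps fr)
  then show "D1 b4 u = (m1 u - 2 * w1 u) * b4 u" "D1 b3 u = (- m1 u - 2 * w1 u) * b3 u"
    using S.gauss_codazzi(2,3)[OF u] by (simp_all add: eqs algebra_simps)
qed

text \<open>The Codazzi equations know \<open>a3\<close> only along \<open>X2\<close> and
  \<open>b4\<close> only along \<open>X1\<close>; the constant nonzero product supplies the missing
  derivative.\<close>

lemma D1_a3:
  assumes u: "u \<in> V" and c: "\<And>u. u \<in> V \<Longrightarrow> a3 u * b4 u = c" and "c \<noteq> 0"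
  shows "D1 a3 u = (2 * w1 u - m1 u) * a3 u"
proof -
  note d = smooth_all[THEN smooth_on_differentiable, OF u]
  have "D1 (\<lambda>u. a3 u * b4 u) u = D1 (\<lambda>u. c) u"
    by (rule dir_deriv_transfer[OF open_V u c])
  then have "a3 u * D1 b4 u + D1 a3 u * b4 u = 0"
    by (simp add: dir_deriv_mult d)
  then have "(D1 a3 u - (2 * w1 u - m1 u) * a3 u) * b4 u = 0"
    unfolding codazzi_D1(1)[OF u] by (simp add: algebra_simps)
  moreover have "b4 u \<noteq> 0" using c[OF u] \<open>c \<noteq> 0\<close> by auto
  ultimately show ?thesis by simp
qed

lemma constant_product_relation:
  assumes u: "u \<in> V" and c: "\<And>u. u \<in> V \<Longrightarrow> a3 u * b4 u = c" and "c \<noteq> 0"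
  shows "2 * (1 + a3 u * b4 u + a4 u * b3 u) + (a3 u * b4 u - a4 u * b3 u) = 0"
proof -
  note d = smooth_all[THEN smooth_on_differentiable, OF u]
  have d2: "(\<lambda>u. 2 * w2 u) differentiable (at u)" "(\<lambda>u. 2 * w2 u - m2 u) differentiable (at u)"
    "(\<lambda>u. 2 * w1 u) differentiable (at u)" "(\<lambda>u. 2 * w1 u - m1 u) differentiable (at u)"
    by (intro smooth_on_differentiable[OF _ u] smooth_on_diff smooth_on_mult smooth_on_const open_V smooth_all)+
  have 1: "D1 (D2 a3) u = (2 * w2 u - m2 u) * D1 a3 u + (2 * D1 w2 u - D1 m2 u) * a3 u"
    by (subst dir_deriv_transfer[OF open_V u gauss_codazzi(2)])
      (simp_all add: dir_deriv_mult dir_deriv_diff d d2)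
  have "D2 (D1 a3) u = D2 (\<lambda>u. (2 * w1 u - m1 u) * a3 u) u"
    by (rule dir_deriv_transfer[OF open_V u D1_a3[OF _ assms(2,3)]])
  then have 2: "D2 (D1 a3) u = (2 * w1 u - m1 u) * D2 a3 u + (2 * D2 w1 u - D2 m1 u) * a3 u"
    by (simp add: dir_deriv_mult dir_deriv_diff d d2)
  have 3: "D1 a3 u = (2 * w1 u - m1 u) * a3 u" by (rule D1_a3[OF assms])
  have "D1 (D2 a3) u - D2 (D1 a3) u = - w2 u * D1 a3 u - w1 u * D2 a3 u"
    using D_commute[OF u smooth_coeffs(3)] by simp
  \<comment> \<open>The commutator of the logarithmic derivatives of \<open>a3\<close>, sorted into
    the left sides of the Gauss and Ricci equations.\<close>
  then have "(2 * (D2 w1 u - D1 w2 u - 2 * w1 u * w2 u) + (D1 m2 u - D2 m1 u + w2 u * m1 u + w1 u * m2 u)) * a3 u = 0"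
    unfolding 1 2 3 gauss_codazzi(2)[OF u] by (simp add: algebra_simps)
  moreover have "a3 u \<noteq> 0" using c[OF u] \<open>c \<noteq> 0\<close> by auto
  ultimately show ?thesis
    unfolding ricci[OF u] gauss_codazzi(1)[OF u] by simp
qed

lemma constant_curvatures:
  assumes u0: "u0 \<in> V" and K: "\<And>u. u \<in> V \<Longrightarrow> gauss_curvature f u = K"
    and KD: "\<And>u. u \<in> V \<Longrightarrow> normal_curvature f X1 X2 n3 n4 u = KD" "KD \<noteq> 0"
  shows "(\<forall>u\<in>V. a3 u * b4 u = - 2/3 \<and> a4 u * b3 u = 0) \<or> (\<forall>u\<in>V. a3 u * b4 u = 0 \<and> a4 u * b3 u = - 2/3)"
proof -
  interpret S: minimal_frame V f X1 X2 n4 n3 by (rule swap34)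
  have S: "S.a3 = a4" "S.a4 = a3" "S.b3 = b4" "S.b4 = b3"
    by (simp_all add: fun_eq_iff S.a3_def S.a4_def S.b3_def S.b4_def a3_def a4_def b3_def b4_def)
  \<comment> \<open>The two products have sum \<open>K - 1\<close> and difference
    \<open>KD\<close>.\<close>
  define p q where "p = (K - 1 + KD) / 2" and "q = (K - 1 - KD) / 2"
  have pq: "a3 u * b4 u = p" "a4 u * b3 u = q" if "u \<in> V" for u
    using gauss_curvature_frame[OF that] normal_curvature_frame[OF that] K[OF that] KD(1)[OF that]
    by (simp_all add: p_def q_def)
  have p: "2 * (1 + p + q) + (p - q) = 0" if "p \<noteq> 0"
    using constant_product_relation[OF u0 pq(1) that] pq[OF u0] by simp
  have q: "2 * (1 + p + q) + (q - p) = 0" if "q \<noteq> 0"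
    using S.constant_product_relation[OF u0 _ that, unfolded S, OF pq(2)] pq[OF u0] by (simp add: algebra_simps)
  have "p \<noteq> q" using KD(2) by (simp add: p_def q_def)
  then have "p = - 2/3 \<and> q = 0 \<or> p = 0 \<and> q = - 2/3"
    using p q by (cases "p = 0"; cases "q = 0") auto
  then show ?thesis using pq by auto
qed

text \<open>The function \<open>t\<close> is a quotient of two linear functionals of
  \<open>n3\<close>, so it sees only the direction of \<open>n3\<close>, and the coefficients
  \<open>m1\<close>, \<open>m2\<close> drop out of its derivatives. That direction moves along
  \<open>X1\<close> in proportion to \<open>a4\<close> and along \<open>X2\<close> in proportion to
  \<open>b4\<close>. The functionals, products with \<open>F2 u0\<close> and \<open>n4 u0\<close>,
  make the numerator 0 and the denominator -1 at \<open>u0\<close>.\<close>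

lemma ratio_function:
  assumes u0: "u0 \<in> V"
  obtains V0 t P where "open V0" "u0 \<in> V0" "V0 \<subseteq> V" "smooth_on V0 t"
    "\<And>u. u \<in> V0 \<Longrightarrow> D1 t u = a4 u * P u" "D2 t u0 = - b4 u0"
proof -
  define v w where "v = F2 u0" and "w = n4 u0"
  define N D where "N u = \<langle>n3 u, v\<rangle>" and "D u = \<langle>n3 u, w\<rangle>" for u
  define V0 where "V0 = {u \<in> V. D u \<noteq> 0}"
  have sm: "smooth_on V N" "smooth_on V D"
    unfolding N_def D_def by (intro smooth_on_pe_inner smooth_on_const smooth_all open_V)+
  have V0: "open V0" "V0 \<subseteq> V" unfolding V0_def using open_nonzero[OF open_V sm(2)] by auto
  note fr = null_frame_inner[OF frame[OF u0]]
  have u00: "u0 \<in> V0" using u0 fr by (simp add: V0_def D_def w_def)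
  have D: "D u \<noteq> 0" "u \<in> V" if "u \<in> V0" for u using that by (auto simp: V0_def)
  have smt: "smooth_on V0 (\<lambda>u. N u / D u)"
    using D by (intro smooth_on_divide smooth_on_subset[OF sm(1) V0(2)] smooth_on_subset[OF sm(2) V0(2)] V0) auto
  have dN: "dir_deriv N u Z = \<langle>dir_deriv n3 u Z, v\<rangle>" "dir_deriv D u Z = \<langle>dir_deriv n3 u Z, w\<rangle>" if "u \<in> V" for u Z
    unfolding N_def D_def
    using dir_deriv_pe_inner[OF smooth_on_differentiable[OF smooth_frame(3) that], of "\<lambda>_. v"]
      dir_deriv_pe_inner[OF smooth_on_differentiable[OF smooth_frame(3) that], of "\<lambda>_. w"]
    by (simp_all add: pe_inner_simps)
  have dt: "dir_deriv (\<lambda>u. N u / D u) u Z = (\<langle>dir_deriv n3 u Z, v\<rangle> * D u - N u * \<langle>dir_deriv n3 u Z, w\<rangle>) / (D u)\<^sup>2" if "u \<in> V0" for u Z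
    using dir_deriv_divide[OF sm[THEN smooth_on_differentiable, OF D(2)[OF that]] D(1)[OF that]] dN[OF D(2)[OF that]] by simp
  show thesis
  proof (rule that[OF V0(1) u00 V0(2) smt])
    show "D1 (\<lambda>u. N u / D u) u = a4 u * (- (\<langle>F2 u, v\<rangle> * D u - N u * \<langle>F2 u, w\<rangle>) / (D u)\<^sup>2)" if "u \<in> V0" for u
      unfolding dt[OF that] D1n3[OF D(2)[OF that]]
      by (simp add: pe_inner_simps N_def D_def) (simp add: algebra_simps diff_divide_distrib add_divide_distrib)
    show "D2 (\<lambda>u. N u / D u) u0 = - b4 u0"
      unfolding dt[OF u00] D2n3[OF u0]
      by (simp add: pe_inner_simps N_def D_def v_def w_def fr)
  qed
qed

end

section \<open>Local vanishing of one of the coefficients \<open>a4\<close> and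
  \<open>b3\<close>\<close>

lemma closed_segment_memI: "closed_segment y (y + e) \<subseteq> S \<Longrightarrow> x \<in> {0..1} \<Longrightarrow> y + x *\<^sub>R e \<in> S"
  by (erule subsetD) (auto simp: closed_segment_def algebra_simps intro!: exI[of _ x])

text \<open>Along the segment \<open>A\<close> solves a homogeneous linear differential equation;
  multiplied by the exponential of minus an antiderivative of the coefficient, it is
  constant.\<close>

lemma transport_nonzero:
  fixes A \<gamma> :: "'a::real_normed_vector \<Rightarrow> real"
  assumes A: "\<And>y. y \<in> S \<Longrightarrow> A differentiable (at y)"
    and eq: "\<And>y. y \<in> S \<Longrightarrow> dir_deriv A y e = \<gamma> y * A y" and \<gamma>: "continuous_on S \<gamma>"
    and seg: "closed_segment y (y + e) \<subseteq> S" and nz: "A y \<noteq> 0"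
  shows "A (y + e) \<noteq> 0"
proof -
  note inS = closed_segment_memI[OF seg]
  have "continuous_on {0..1} (\<lambda>x. \<gamma> (y + x *\<^sub>R e))"
    using inS by (intro continuous_on_compose2[OF \<gamma>] continuous_intros) auto
  then obtain G where G: "\<And>x. x \<in> {0..1} \<Longrightarrow> (G has_vector_derivative \<gamma> (y + x *\<^sub>R e)) (at x within {0..1})"
    using antiderivative_continuous by blast
  let ?h = "\<lambda>x. A (y + x *\<^sub>R e)"
  have h: "(?h has_real_derivative \<gamma> (y + x *\<^sub>R e) * ?h x) (at x within {0..1})" if "x \<in> {0..1}" for x
    using has_vector_derivative_along_line[OF A[OF inS[OF that]]] eq[OF inS[OF that]]
    by (simp add: has_real_derivative_iff_has_vector_derivative)
  have "((\<lambda>x. ?h x * exp (- G x)) has_real_derivative 0) (at x within {0..1})" if "x \<in> {0..1}" for x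
    using h[OF that] G[OF that] unfolding has_real_derivative_iff_has_vector_derivative[symmetric]
    by (auto intro!: derivative_eq_intros)
  then have "\<exists>c. \<forall>x\<in>{0..1}. ?h x * exp (- G x) = c"
    by (intro has_field_derivative_zero_constant) auto
  then have "?h 0 * exp (- G 0) = ?h 1 * exp (- G 1)" by (metis atLeastAtMost_iff order.refl zero_le_one)
  then show ?thesis using nz by auto
qed

lemma homeomorphism_open_restrict:
  assumes hom: "homeomorphism U T Q g" and "open U" "open W" "W \<subseteq> T"
  shows "open (g ` W)" "g ` W \<subseteq> U" "homeomorphism (g ` W) W Q g"
proof -
  have gQ: "g (Q u) = u" if "u \<in> U" for u using hom that by (auto simp: homeomorphism_def)
  have Qg: "Q (g y) = y" "g y \<in> U" if "y \<in> W" for y using hom that assms(4) by (auto simp: homeomorphism_def)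
  have cont: "continuous_on U Q" using hom by (simp add: homeomorphism_def)
  show sub: "g ` W \<subseteq> U" using Qg by blast
  have "g ` W = U \<inter> Q -` W"
  proof (intro equalityI subsetI)
    fix u assume "u \<in> U \<inter> Q -` W"
    then show "u \<in> g ` W" using gQ by (metis IntD1 IntD2 imageI vimageD)
  qed (use Qg in auto)
  then show "open (g ` W)"
    using continuous_open_preimage[OF cont assms(2,3)] by simp
  have "Q ` g ` W = W" using Qg by (simp add: image_comp)
  then show "homeomorphism (g ` W) W Q g"
    using homeomorphism_of_subsets[OF hom sub assms(4)] by simp
qed

lemma box_axis_line:
  fixes y z :: "real^2"
  assumes "y \<in> box a b" "z \<in> box a b"
  shows "y + (z$1 - y$1) *\<^sub>R axis 1 1 \<in> box a b" "z + (y$2 - z$2) *\<^sub>R axis 2 1 = y + (z$1 - y$1) *\<^sub>R axis 1 1"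
  using assms by (auto simp: mem_box_cart forall_2 axis_def vec_eq_iff)

context minimal_frame
begin

lemma frame_span:
  assumes "u \<in> V"
  shows "\<exists>p q. Z = p *\<^sub>R X1 u + q *\<^sub>R X2 u"
proof -
  have "Z = (- first_ff f u Z (X2 u)) *\<^sub>R X1 u + (- first_ff f u Z (X1 u)) *\<^sub>R X2 u"
    using null_frame_inner[OF frame[OF assms]] by (intro null_basis_expand[OF assms]) (simp_all add: first_ff_def)
  then show ?thesis by blast
qed

text \<open>The zero set of \<open>a4\<close> is invariant under the flow of \<open>X2\<close>, that of \<open>b3\<close> under the flow of
  \<open>X1\<close>. Since \<open>a4 b3 = 0\<close>, the coordinates \<open>\<sigma>\<close>, \<open>\<tau>\<close> below serve as a substitute for
  null coordinates: the unwanted term in \<open>X2 a4\<close> has the factor \<open>b3\<close>, which vanishes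
  wherever \<open>a4\<close> is not stationary.\<close>

lemma one_coefficient_vanishes:
  assumes u0: "u0 \<in> V" and c: "\<And>u. u \<in> V \<Longrightarrow> a3 u * b4 u \<noteq> 0" and 0: "\<And>u. u \<in> V \<Longrightarrow> a4 u * b3 u = 0"
  obtains U where "open U" "u0 \<in> U" "U \<subseteq> V" "(\<forall>u\<in>U. a4 u = 0) \<or> (\<forall>u\<in>U. b3 u = 0)"
proof -
  interpret S: minimal_frame V f X2 X1 n4 n3 by (rule swap12)
  have S: "S.a4 = b3" "S.b4 = a3"
    by (simp_all add: fun_eq_iff S.a4_def S.b4_def b3_def a3_def)
  obtain V0 \<sigma> P where \<sigma>: "open V0" "u0 \<in> V0" "V0 \<subseteq> V" "smooth_on V0 \<sigma>"
    "\<And>u. u \<in> V0 \<Longrightarrow> D1 \<sigma> u = a4 u * P u" "D2 \<sigma> u0 = - b4 u0"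
    using ratio_function[OF u0] by blast
  obtain V0' \<tau> R where \<tau>: "open V0'" "u0 \<in> V0'" "V0' \<subseteq> V" "smooth_on V0' \<tau>"
    "\<And>u. u \<in> V0' \<Longrightarrow> D2 \<tau> u = b3 u * R u" "D1 \<tau> u0 = - a3 u0"
    using S.ratio_function[OF u0] unfolding S by blast
  \<comment> \<open>The product of \<open>D1 \<sigma>\<close> and \<open>D2 \<tau>\<close> contains
    a4 b3 and is therefore zero, so this condition is the nonvanishing of the Jacobian of \<sigma>
    and \<tau> in the frame.\<close>
  define V1 where "V1 = {u \<in> V0 \<inter> V0'. D2 \<sigma> u * D1 \<tau> u \<noteq> 0}"
  have oV0: "open (V0 \<inter> V0')" using \<sigma>(1) \<tau>(1) by blast
  have smX: "smooth_on W X1" "smooth_on W X2" if "W \<subseteq> V" for W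
    using smooth_frame[THEN smooth_on_subset] that by auto
  have sm0: "smooth_on (V0 \<inter> V0') \<sigma>" "smooth_on (V0 \<inter> V0') \<tau>"
    using smooth_on_subset[OF \<sigma>(4)] smooth_on_subset[OF \<tau>(4)] by auto
  have "smooth_on (V0 \<inter> V0') (\<lambda>u. D2 \<sigma> u * D1 \<tau> u)"
    using \<sigma>(3) by (intro smooth_on_mult smooth_on_dir_deriv oV0 sm0 smX) auto
  then have V1: "open V1" unfolding V1_def by (rule open_nonzero[OF oV0])
  have u01: "u0 \<in> V1" using \<sigma>(2,6) \<tau>(2,6) c[OF u0] by (auto simp: V1_def)
  have V1V: "V1 \<subseteq> V" using \<sigma>(3) by (auto simp: V1_def)
  have nz: "D2 \<sigma> u \<noteq> 0" "D1 \<tau> u \<noteq> 0" if "u \<in> V1" for u using that by (auto simp: V1_def)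
  have D: "D1 \<sigma> u = a4 u * P u" "D2 \<tau> u = b3 u * R u" if "u \<in> V1" for u
    using \<sigma>(5) \<tau>(5) that by (auto simp: V1_def)
  have sm1: "smooth_on V1 \<sigma>" "smooth_on V1 \<tau>"
    by (rule sm0[THEN smooth_on_subset], auto simp: V1_def)+
  define Q :: "real^2 \<Rightarrow> real^2" where "Q u = \<sigma> u *\<^sub>R axis 1 1 + \<tau> u *\<^sub>R axis 2 1" for u
  have smQ: "smooth_on V1 Q"
    unfolding Q_def by (intro smooth_on_add smooth_on_scaleR smooth_on_const sm1 V1)
  have dQ: "dir_deriv Q u Z = dir_deriv \<sigma> u Z *\<^sub>R axis 1 1 + dir_deriv \<tau> u Z *\<^sub>R axis 2 1" if u: "u \<in> V1" for u Z
  proof -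
    note d = sm1[THEN smooth_on_differentiable, OF u]
    have d2: "(\<lambda>u. \<sigma> u *\<^sub>R axis 1 1 :: real^2) differentiable (at u)" "(\<lambda>u. \<tau> u *\<^sub>R axis 2 1 :: real^2) differentiable (at u)"
      by (intro smooth_on_differentiable[OF _ u] smooth_on_scaleR smooth_on_const sm1 V1)+
    show ?thesis
      unfolding Q_def by (simp add: dir_deriv_add[OF d2] dir_deriv_scaleR[OF d(1)] dir_deriv_scaleR[OF d(2)])
  qed
  have injQ: "inj (dir_deriv Q u)" if u: "u \<in> V1" for u
    unfolding linear_injective_0[OF smooth_on_linear_dir_deriv[OF smQ u]]
  proof (intro allI impI)
    fix Z assume Z0: "dir_deriv Q u Z = 0"
    have uV: "u \<in> V" using u V1V by blast
    obtain p q where Z: "Z = p *\<^sub>R X1 u + q *\<^sub>R X2 u" using frame_span[OF uV] by blast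
    have lin: "dir_deriv h u Z = p * D1 h u + q * D2 h u" if "smooth_on V1 h" for h :: "real^2 \<Rightarrow> real"
      using smooth_on_linear_dir_deriv[OF that u] by (simp add: Z linear_add linear_cmul)
    have "p * (a4 u * P u) + q * D2 \<sigma> u = 0" "p * D1 \<tau> u + q * (b3 u * R u) = 0"
      using arg_cong[OF Z0, of "\<lambda>v. v $ 1"] arg_cong[OF Z0, of "\<lambda>v. v $ 2"] lin[OF sm1(1)] lin[OF sm1(2)]
      by (simp_all add: dQ[OF u] D[OF u] axis_def)
    moreover have "a4 u * P u * (b3 u * R u) = 0" using 0[OF uV] by auto
    ultimately have "p * (D2 \<sigma> u * D1 \<tau> u) = 0" "q * (D2 \<sigma> u * D1 \<tau> u) = 0" by algebra+
    then show "Z = 0" using nz[OF u] by (simp add: Z)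
  qed
  obtain U T g where *: "open U" "u0 \<in> U" "U \<subseteq> V1" "open T" "homeomorphism U T Q g" "smooth_on T g"
    "\<And>y v. y \<in> T \<Longrightarrow> dir_deriv Q (g y) (dir_deriv g y v) = v"
    using smooth_local_inverse[OF V1 smQ u01 injQ[OF u01]] by blast
  have gU: "g y \<in> U" "g y \<in> V1" "g y \<in> V" if "y \<in> T" for y
    using *(3,5) that V1V by (auto simp: homeomorphism_def)
  define A B where "A y = a4 (g y)" and "B y = b3 (g y)" for y
  have AB: "A y * B y = 0" if "y \<in> T" for y using 0[OF gU(3)[OF that]] by (simp add: A_def B_def)
  have comp: "smooth_on T (\<lambda>y. h (g y))" if "smooth_on V1 h" for h :: "real^2 \<Rightarrow> real"
    using gU by (intro smooth_on_compose[OF that V1 *(4,6)]) auto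
  have smAB: "smooth_on T A" "smooth_on T B"
    unfolding A_def B_def by (intro comp smooth_on_subset[OF _ V1V] smooth_coeffs)+
  \<comment> \<open>Where \<open>k\<close> is nonzero it is so on a whole neighbourhood, on which
    \<open>h\<close> then vanishes identically.\<close>
  have stationary: "dir_deriv h y v = 0" if y: "y \<in> T" and k: "k y \<noteq> 0" and sm: "smooth_on T k"
    and hk: "\<And>y. y \<in> T \<Longrightarrow> h y * k y = 0" for h k :: "real^2 \<Rightarrow> real" and y v
  proof -
    have "dir_deriv h y v = dir_deriv (\<lambda>y. 0) y v"
      by (rule dir_deriv_transfer[OF open_nonzero[OF *(4) sm]]) (use y k hk in auto)
    then show ?thesis by simp
  qed
  have dcomp: "dir_deriv (\<lambda>y. h (g y)) y v = dir_deriv h (g y) (dir_deriv g y v)" if "y \<in> T" "smooth_on V1 h" for h :: "real^2 \<Rightarrow> real" and y v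
    by (rule dir_deriv_compose[OF smooth_on_differentiable[OF that(2) gU(2)[OF that(1)]] smooth_on_differentiable[OF *(6) that(1)]])
  have dg: "dir_deriv g y (dir_deriv Q (g y) Z) = Z" if "y \<in> T" for y Z
    using injQ[OF gU(2)[OF that]] *(7)[OF that] by (meson injD)
  have linAB: "dir_deriv h y (p *\<^sub>R axis 1 1 + q *\<^sub>R axis 2 1) = p * dir_deriv h y (axis 1 1) + q * dir_deriv h y (axis 2 1)"
    if "smooth_on T h" "y \<in> T" for h :: "real^2 \<Rightarrow> real" and y p q
    using smooth_on_linear_dir_deriv[OF that] by (simp add: linear_add linear_cmul)
  define \<gamma> \<delta> where "\<gamma> y = (2 * w2 (g y) + m2 (g y)) / D2 \<sigma> (g y)" and "\<delta> y = (- m1 (g y) - 2 * w1 (g y)) / D1 \<tau> (g y)" for y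
  have smD: "smooth_on V1 (D2 \<sigma>)" "smooth_on V1 (D1 \<tau>)"
    by (intro smooth_on_dir_deriv V1 sm1 smX[OF V1V])+
  have sm\<gamma>: "continuous_on T \<gamma>" "continuous_on T \<delta>"
    unfolding \<gamma>_def \<delta>_def
    by (intro smooth_on_continuous_on smooth_on_divide smooth_on_add smooth_on_diff smooth_on_minus smooth_on_mult
        smooth_on_const comp smD smooth_on_subset[OF _ V1V] smooth_coeffs *(4); simp add: nz gU)+
  have dA: "dir_deriv A y (axis 1 1) = \<gamma> y * A y" if y: "y \<in> T" for y
  proof -
    note g = gU[OF y]
    have "dir_deriv A y (dir_deriv Q (g y) (X2 (g y))) = D2 a4 (g y)"
      unfolding A_def dcomp[OF y smooth_on_subset[OF smooth_coeffs(4) V1V]] dg[OF y] ..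
    then have "D2 \<sigma> (g y) * dir_deriv A y (axis 1 1) + b3 (g y) * R (g y) * dir_deriv A y (axis 2 1)
        = (2 * w2 (g y) + m2 (g y)) * A y"
      unfolding dQ[OF g(2)] linAB[OF smAB(1) y] D[OF g(2)] gauss_codazzi(3)[OF g(3)] A_def .
    moreover have "b3 (g y) * R (g y) * dir_deriv A y (axis 2 1) = 0"
      using stationary[OF y _ smAB(2) AB, of "axis 2 1"] by (cases "B y = 0") (auto simp: B_def)
    ultimately have "D2 \<sigma> (g y) * dir_deriv A y (axis 1 1) = (2 * w2 (g y) + m2 (g y)) * A y" by linarith
    then show ?thesis using nz(1)[OF g(2)] by (simp add: \<gamma>_def field_simps)
  qed
  have dB: "dir_deriv B y (axis 2 1) = \<delta> y * B y" if y: "y \<in> T" for y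
  proof -
    note g = gU[OF y]
    have BA: "B y * A y = 0" if "y \<in> T" for y using AB[OF that] by (simp add: mult.commute)
    have "dir_deriv B y (dir_deriv Q (g y) (X1 (g y))) = D1 b3 (g y)"
      unfolding B_def dcomp[OF y smooth_on_subset[OF smooth_coeffs(5) V1V]] dg[OF y] ..
    then have "a4 (g y) * P (g y) * dir_deriv B y (axis 1 1) + D1 \<tau> (g y) * dir_deriv B y (axis 2 1)
        = (- m1 (g y) - 2 * w1 (g y)) * B y"
      unfolding dQ[OF g(2)] linAB[OF smAB(2) y] D[OF g(2)] codazzi_D1(2)[OF g(3)] B_def .
    moreover have "a4 (g y) * P (g y) * dir_deriv B y (axis 1 1) = 0"
      using stationary[OF y _ smAB(1) BA, of "axis 1 1"] by (cases "A y = 0") (auto simp: A_def)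
    ultimately have "D1 \<tau> (g y) * dir_deriv B y (axis 2 1) = (- m1 (g y) - 2 * w1 (g y)) * B y" by linarith
    then show ?thesis using nz(2)[OF g(2)] by (simp add: \<delta>_def field_simps)
  qed
  have Q0: "Q u0 \<in> T" "g (Q u0) = u0" using *(2,5) by (auto simp: homeomorphism_def)
  obtain a b where box: "box a b \<subseteq> T" "Q u0 \<in> box a b"
    using open_contains_box[OF *(4) Q0(1)] by metis
  have seg: "closed_segment y z \<subseteq> T" if "y \<in> box a b" "z \<in> box a b" for y z
    using closed_segment_subset[OF that convex_box(2)] box(1) by blast
  have "(\<forall>y\<in>box a b. A y = 0) \<or> (\<forall>y\<in>box a b. B y = 0)"
  proof (rule ccontr)
    assume "\<not> ?thesis"
    then obtain y z where y: "y \<in> box a b" "A y \<noteq> 0" and z: "z \<in> box a b" "B z \<noteq> 0" by blast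
    \<comment> \<open>The corner with the first coordinate of \<open>z\<close> and the second of
      \<open>y\<close>: \<open>A\<close> stays nonzero along the horizontal side from
      \<open>y\<close>, and \<open>B\<close> along the vertical side from \<open>z\<close>.\<close>
    define x where "x = y + (z$1 - y$1) *\<^sub>R axis 1 1"
    have x: "x \<in> box a b" "z + (y$2 - z$2) *\<^sub>R axis 2 1 = x"
      using box_axis_line[OF y(1) z(1)] by (simp_all add: x_def)
    have "dir_deriv A w ((z$1 - y$1) *\<^sub>R axis 1 1) = (z$1 - y$1) * \<gamma> w * A w" if "w \<in> T" for w
      using dA[OF that] linear_cmul[OF smooth_on_linear_dir_deriv[OF smAB(1) that]] by simp
    then have "A x \<noteq> 0"
      unfolding x_def using seg[OF y(1) x(1)[unfolded x_def]] sm\<gamma>(1) y(2)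
      by (intro transport_nonzero[of T A _ "\<lambda>w. (z$1 - y$1) * \<gamma> w"] smooth_on_differentiable[OF smAB(1)] continuous_intros)
    moreover have "dir_deriv B w ((y$2 - z$2) *\<^sub>R axis 2 1) = (y$2 - z$2) * \<delta> w * B w" if "w \<in> T" for w
      using dB[OF that] linear_cmul[OF smooth_on_linear_dir_deriv[OF smAB(2) that]] by simp
    then have "B (z + (y$2 - z$2) *\<^sub>R axis 2 1) \<noteq> 0"
      using seg[OF z(1) x(1)] sm\<gamma>(2) z(2)
      by (intro transport_nonzero[of T B _ "\<lambda>w. (y$2 - z$2) * \<delta> w"] smooth_on_differentiable[OF smAB(2)] continuous_intros)
        (simp_all add: x)
    ultimately show False using AB[of x] x box(1) by auto
  qed
  then have "(\<forall>u\<in>g ` box a b. a4 u = 0) \<or> (\<forall>u\<in>g ` box a b. b3 u = 0)"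
    by (auto simp: A_def B_def)
  moreover have "u0 \<in> g ` box a b" using box(2) Q0(2) by (metis imageI)
  moreover have "open (g ` box a b)" "g ` box a b \<subseteq> V"
    using homeomorphism_open_restrict(1,2)[OF *(5,1) open_box box(1)] *(3) V1V by auto
  ultimately show thesis using that by blast
qed

end

section \<open>The normal form\<close>

lemma constant_along_segment:
  fixes A :: "'a::real_normed_vector \<Rightarrow> 'b::real_normed_vector"
  assumes A: "\<And>y. y \<in> S \<Longrightarrow> A differentiable (at y)" and eq: "\<And>y. y \<in> S \<Longrightarrow> dir_deriv A y e = 0"
    and seg: "closed_segment y (y + e) \<subseteq> S"
  shows "A (y + e) = A y"
proof -
  have "((\<lambda>x. A (y + x *\<^sub>R e)) has_derivative (\<lambda>r. 0)) (at x within {0..1})" if "x \<in> {0..1}" for x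
    using has_vector_derivative_along_line[OF A[OF closed_segment_memI[OF seg that]]] eq[OF closed_segment_memI[OF seg that]]
    by (simp add: has_vector_derivative_def)
  then have "\<exists>c. \<forall>x\<in>{0..1}. A (y + x *\<^sub>R e) = c"
    by (intro has_derivative_zero_constant) auto
  then have "A (y + 0 *\<^sub>R e) = A (y + 1 *\<^sub>R e)" by (metis atLeastAtMost_iff order.refl zero_le_one)
  then show ?thesis by simp
qed

text \<open>Congruence stated for a coordinate map alone, without the atlas and with the identity as
  isometry; \<open>g\<close>, with inverse \<open>Q\<close>, is the change of parameters.\<close>

definition generated_near :: "(real^2) set \<Rightarrow> (real^2 \<Rightarrow> real^5) \<Rightarrow> real^2 \<Rightarrow> bool"
  where "generated_near V f u0 \<longleftrightarrow> (\<exists>U W I \<alpha> Q (g :: real^2 \<Rightarrow> real^2).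
    open U \<and> u0 \<in> U \<and> U \<subseteq> V \<and> open W \<and> homeomorphism U W Q g \<and> smooth_on U Q \<and> smooth_on W g \<and>
    null_curve I \<alpha> \<and> \<alpha> ` I \<subseteq> light_cone \<and> (\<forall>\<tau>\<in>I. \<langle>curve_deriv 2 \<alpha> \<tau>, curve_deriv 2 \<alpha> \<tau>\<rangle> = 4/9) \<and>
    (\<forall>y\<in>W. y$2 \<in> I \<and> f (g y) = generated_surface \<alpha> (y$1) (y$2)))"

lemma generated_near_mono: "generated_near U f u0 \<Longrightarrow> U \<subseteq> V \<Longrightarrow> generated_near V f u0"
  unfolding generated_near_def by (elim ex_forward) auto

context minimal_frame
begin

text \<open>With \<open>X1 t = 0\<close> and \<open>X2 t = 1\<close> the connection form gives the second coordinate
  \<open>s = -3 w2\<close>, and the generating curve is the null normal field \<open>a3 n3\<close>, which is parallel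
  in \<open>\<real>\<^sup>5\<close> along \<open>X1\<close>. Its derivatives along \<open>X2\<close> express \<open>F1\<close> and \<open>f\<close>; the remaining unknown
  \<open>X2 s\<close> is determined by \<open>F2\<close> being null.\<close>

lemma straightened_normal_form:
  fixes t :: "real^2 \<Rightarrow> real"
  assumes u0: "u0 \<in> V" and ab: "\<And>u. u \<in> V \<Longrightarrow> a3 u * b4 u = - 2/3" and a40: "\<And>u. u \<in> V \<Longrightarrow> a4 u = 0"
    and smt: "smooth_on V t" and D1t: "\<And>u. u \<in> V \<Longrightarrow> D1 t u = 0" and D2t: "\<And>u. u \<in> V \<Longrightarrow> D2 t u = 1"
  shows "generated_near V f u0"
proof -
  \<comment> \<open>The bracket of \<open>X1\<close> and \<open>X2\<close> annihilates
    \<open>t\<close>, and its coefficient at \<open>X2\<close> is \<open>- w1\<close>.\<close>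
  have w1: "w1 u = 0" if u: "u \<in> V" for u
  proof -
    have "D1 (D2 t) u = D1 (\<lambda>u. 1) u" by (rule dir_deriv_transfer[OF open_V u D2t])
    moreover have "D2 (D1 t) u = D2 (\<lambda>u. 0) u" by (rule dir_deriv_transfer[OF open_V u D1t])
    ultimately show ?thesis
      using D_commute[OF u smt] by (simp add: D1t[OF u] D2t[OF u])
  qed
  \<comment> \<open>This is the Gauss equation with curvature 1 - 2/3; it is the reason for the
    factor -3 in \<open>s\<close>, whose derivative along \<open>X1\<close> becomes 1.\<close>
  have D1w2: "D1 w2 u = - 1/3" if u: "u \<in> V" for u
  proof -
    have "D2 w1 u = D2 (\<lambda>u. 0) u" by (rule dir_deriv_transfer[OF open_V u w1])
    then show ?thesis
      using gauss_codazzi(1)[OF u] ab[OF u] a40[OF u] w1[OF u] by simp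
  qed
  define s where "s u = (- 3) * w2 u" for u
  define \<delta> where "\<delta> = (\<lambda>u. D2 s u)"
  have sms: "smooth_on V s" unfolding s_def by (intro smooth_on_mult smooth_on_const smooth_all open_V)
  have sm\<delta>: "smooth_on V \<delta>" unfolding \<delta>_def by (rule smooth_D[OF sms])
  have ds: "dir_deriv s u Z = - 3 * dir_deriv w2 u Z" if "u \<in> V" for u Z
    unfolding s_def by (subst dir_deriv_mult[OF differentiable_const smooth_on_differentiable[OF smooth_coeffs(2) that]]) simp
  have D1s: "D1 s u = 1" if "u \<in> V" for u using ds[OF that] D1w2[OF that] by simp
  have w2: "w2 u = - (1/3) * s u" for u by (simp add: s_def)
  have D2w2: "D2 w2 u = - (1/3) * \<delta> u" if "u \<in> V" for u using ds[OF that] by (simp add: \<delta>_def)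

  \<comment> \<open>Iterated derivatives along \<open>X2\<close> of the null normal; they will turn
    out to be the derivatives of the curve, read on the surface.\<close>
  define h where "h = rec_nat (\<lambda>u. a3 u *\<^sub>R n3 u) (\<lambda>k g u. D2 g u)"
  have h0: "h 0 = (\<lambda>u. a3 u *\<^sub>R n3 u)" and hS: "h (Suc k) = (\<lambda>u. D2 (h k) u)" for k
    by (simp_all add: h_def)
  have smh: "smooth_on V (h k)" for k
  proof (induction k)
    case 0
    then show ?case unfolding h0 by (intro smooth_on_scaleR smooth_all open_V)
  next
    case (Suc k)
    then show ?case unfolding hS by (rule smooth_D)
  qed
  have dh0: "dir_deriv (h 0) u Z = a3 u *\<^sub>R dir_deriv n3 u Z + dir_deriv a3 u Z *\<^sub>R n3 u" if "u \<in> V" for u Z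
    unfolding h0 by (rule dir_deriv_scaleR[OF smooth_on_differentiable[OF smooth_coeffs(3) that]
          smooth_on_differentiable[OF smooth_frame(3) that]])
  have D1h0: "D1 (h 0) u = 0" if u: "u \<in> V" for u
  proof -
    have "D1 a3 u = (2 * w1 u - m1 u) * a3 u" by (rule D1_a3[OF u ab]) simp_all
    then show ?thesis
      by (simp add: dh0[OF u] D1n3[OF u] a40[OF u] w1[OF u])
  qed
  have h1: "h 1 u = (2 * w2 u) *\<^sub>R h 0 u + (2/3) *\<^sub>R F1 u" if u: "u \<in> V" for u
  proof -
    have "h 1 u = D2 (h 0) u" using hS[of 0] by simp
    also have "\<dots> = (2 * w2 u) *\<^sub>R h 0 u - (a3 u * b4 u) *\<^sub>R F1 u"
      unfolding dh0[OF u] D2n3[OF u] gauss_codazzi(2)[OF u] by (simp add: h0 algebra_simps)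
    finally show ?thesis by (simp add: ab[OF u])
  qed
  have h2: "h 2 u = (2 * w2 u) *\<^sub>R h 1 u + (2 * D2 w2 u) *\<^sub>R h 0 u + (2/3) *\<^sub>R (w2 u *\<^sub>R F1 u + f u)" if u: "u \<in> V" for u
  proof -
    have d: "(\<lambda>u. 2 * w2 u) differentiable (at u)" "h 0 differentiable (at u)" "w2 differentiable (at u)"
      "F1 differentiable (at u)" "(\<lambda>u. (2 * w2 u) *\<^sub>R h 0 u) differentiable (at u)" "(\<lambda>u. (2/3::real) *\<^sub>R F1 u) differentiable (at u)"
      by (intro smooth_on_differentiable[OF _ u] smooth_on_scaleR smooth_on_mult smooth_on_const smooth_all smh open_V)+
    have "h 2 u = D2 (h 1) u" using hS[of 1] by (simp add: numeral_2_eq_2)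
    also have "\<dots> = D2 (\<lambda>u. (2 * w2 u) *\<^sub>R h 0 u + (2/3) *\<^sub>R F1 u) u"
      by (rule dir_deriv_transfer[OF open_V u h1])
    also have "\<dots> = (2 * w2 u) *\<^sub>R D2 (h 0) u + (2 * D2 w2 u) *\<^sub>R h 0 u + (2/3) *\<^sub>R D2 F1 u"
      by (simp only: dir_deriv_add[OF d(5,6)] dir_deriv_scaleR[OF d(1,2)] dir_deriv_scaleR[OF differentiable_const d(4)]
          dir_deriv_mult[OF differentiable_const d(3)]) simp
    finally show ?thesis using hS[of 0] by (simp add: D2F1[OF u])
  qed
  \<comment> \<open>The coefficient of \<open>h 0\<close> when the expression for \<open>h 2\<close>
    is solved for \<open>f\<close>.\<close>
  define \<mu> where "\<mu> u = 1/3 * (s u * s u) + \<delta> u" for u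
  have sm\<mu>: "smooth_on V \<mu>" unfolding \<mu>_def
    by (intro smooth_on_add smooth_on_mult smooth_on_const sms sm\<delta> open_V)
  have F1: "F1 u = (3/2) *\<^sub>R h 1 u + s u *\<^sub>R h 0 u" if "u \<in> V" for u
    unfolding h1[OF that] w2 by (simp add: algebra_simps)
  have f: "f u = \<mu> u *\<^sub>R h 0 u + (3/2 * s u) *\<^sub>R h 1 u + (3/2) *\<^sub>R h 2 u" if "u \<in> V" for u
    unfolding h2[OF that] F1[OF that] D2w2[OF that] w2 \<mu>_def
    by (simp add: vec_eq_iff) (simp add: field_simps)
  have fr: "\<langle>h 0 u, h 0 u\<rangle> = 0" "\<langle>h 0 u, f u\<rangle> = 0" "\<langle>h 1 u, h 1 u\<rangle> = 0" "\<langle>h 1 u, f u\<rangle> = 0" "\<langle>h 0 u, h 1 u\<rangle> = 0"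
    "\<langle>h 1 u, F2 u\<rangle> = - 2/3" if u: "u \<in> V" for u
    unfolding h1[OF u] h0 using null_frame_inner[OF frame[OF u]] by (simp_all add: pe_inner_simps)
  have h22: "\<langle>h 2 u, h 2 u\<rangle> = 4/9" if u: "u \<in> V" for u
  proof -
    have sw: "\<langle>f u, h 0 u\<rangle> = 0" "\<langle>f u, h 1 u\<rangle> = 0" "\<langle>h 1 u, h 0 u\<rangle> = 0"
      using fr[OF u] by (metis pe_inner_commute)+
    \<comment> \<open>The vectors \<open>h 0\<close> and \<open>h 1\<close> are null and orthogonal
      to each other and to \<open>f\<close>, so only 2/3 of the unit vector \<open>f\<close>
      contributes to the square; this is the origin of 4/9.\<close>
    have "h 2 u = (2/3) *\<^sub>R f u - s u *\<^sub>R h 1 u - (2/3 * \<mu> u) *\<^sub>R h 0 u"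
      unfolding f[OF u] by (simp add: vec_eq_iff) (simp add: field_simps)
    then show ?thesis
      by (simp only: pe_inner_simps fr[OF u] sw sphere[OF u]) simp
  qed

  define Q :: "real^2 \<Rightarrow> real^2" where "Q u = s u *\<^sub>R axis 1 1 + t u *\<^sub>R axis 2 1" for u
  have Qn: "Q u $ 1 = s u" "Q u $ 2 = t u" for u by (simp_all add: Q_def axis_def)
  have smQ: "smooth_on V Q"
    unfolding Q_def by (intro smooth_on_add smooth_on_scaleR smooth_on_const sms smt open_V)
  have dQ: "dir_deriv Q u Z = dir_deriv s u Z *\<^sub>R axis 1 1 + dir_deriv t u Z *\<^sub>R axis 2 1" if u: "u \<in> V" for u Z
  proof -
    have d: "s differentiable (at u)" "t differentiable (at u)"
        "(\<lambda>u. s u *\<^sub>R axis 1 1 :: real^2) differentiable (at u)" "(\<lambda>u. t u *\<^sub>R axis 2 1 :: real^2) differentiable (at u)"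
      by (intro smooth_on_differentiable[OF _ u] smooth_on_scaleR smooth_on_const sms smt open_V)+
    show ?thesis
      unfolding Q_def by (simp add: dir_deriv_add[OF d(3,4)] dir_deriv_scaleR[OF d(1)] dir_deriv_scaleR[OF d(2)])
  qed
  have dQX: "dir_deriv Q u (X1 u) = axis 1 1" "dir_deriv Q u (X2 u) = \<delta> u *\<^sub>R axis 1 1 + axis 2 1" if "u \<in> V" for u
    using dQ[OF that] D1s[OF that] D1t[OF that] D2t[OF that] by (simp_all add: \<delta>_def)
  have injQ: "inj (dir_deriv Q u)" if u: "u \<in> V" for u
    unfolding linear_injective_0[OF smooth_on_linear_dir_deriv[OF smQ u]]
  proof (intro allI impI)
    fix Z assume Z0: "dir_deriv Q u Z = 0"
    obtain p q where Z: "Z = p *\<^sub>R X1 u + q *\<^sub>R X2 u" using frame_span[OF u] by blast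
    have "dir_deriv Q u Z = p *\<^sub>R axis 1 1 + q *\<^sub>R (\<delta> u *\<^sub>R axis 1 1 + axis 2 1)"
      using smooth_on_linear_dir_deriv[OF smQ u] by (simp only: Z linear_add linear_cmul dQX[OF u])
    then have "p + q * \<delta> u = 0" "q = 0"
      using arg_cong[OF Z0, of "\<lambda>v. v $ 1"] arg_cong[OF Z0, of "\<lambda>v. v $ 2"] by (simp_all add: axis_def)
    then show "Z = 0" by (simp add: Z)
  qed
  obtain U T g where *: "open U" "u0 \<in> U" "U \<subseteq> V" "open T" "homeomorphism U T Q g" "smooth_on T g"
    "\<And>y v. y \<in> T \<Longrightarrow> dir_deriv Q (g y) (dir_deriv g y v) = v"
    using smooth_local_inverse[OF open_V smQ u0 injQ[OF u0]] by blast
  have gV: "g y \<in> V" and Qg: "Q (g y) = y" if "y \<in> T" for y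
    using *(3,5) that by (auto simp: homeomorphism_def)
  have sg: "s (g y) = y $ 1" if "y \<in> T" for y using Qg[OF that] Qn by metis
  have dg: "dir_deriv g y (dir_deriv Q (g y) Z) = Z" if "y \<in> T" for y Z
    using injQ[OF gV[OF that]] *(7)[OF that] by (meson injD)
  have dg1: "dir_deriv g y (axis 1 1) = X1 (g y)" if "y \<in> T" for y
    using dg[OF that, of "X1 (g y)"] by (simp add: dQX[OF gV[OF that]])
  have dg2: "dir_deriv g y (axis 2 1) = X2 (g y) - \<delta> (g y) *\<^sub>R X1 (g y)" if "y \<in> T" for y
  proof -
    have lin: "linear (dir_deriv g y)" by (rule smooth_on_linear_dir_deriv[OF *(6) that])
    show ?thesis
      using dg[OF that, of "X2 (g y)"] dg1[OF that]
      by (simp add: dQX[OF gV[OF that]] linear_add[OF lin] linear_cmul[OF lin] eq_diff_eq add.commute)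
  qed
  have smhg: "smooth_on T (\<lambda>y. h k (g y))" for k
    using gV by (intro smooth_on_compose[OF smh open_V *(4,6)]) auto
  have dhg: "dir_deriv (\<lambda>y. h k (g y)) y v = dir_deriv (h k) (g y) (dir_deriv g y v)" if "y \<in> T" for k y v
    by (rule dir_deriv_compose[OF smooth_on_differentiable[OF smh gV[OF that]] smooth_on_differentiable[OF *(6) that]])

  have Q0: "Q u0 \<in> T" "g (Q u0) = u0" using *(2,5) by (auto simp: homeomorphism_def)
  \<comment> \<open>In a box the second coordinates form an interval, and the horizontal segment
    from any point to the base line \<open>c\<close> stays inside.\<close>
  obtain a b where box: "box a b \<subseteq> T" "Q u0 \<in> box a b"
    using open_contains_box[OF *(4) Q0(1)] by metis
  define W where "W = box a b"
  have W: "open W" "W \<subseteq> T" using box by (auto simp: W_def)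
  have WT: "y \<in> T" if "y \<in> W" for y using W that by blast
  define I where "I = {a$2<..<b$2}"
  have WI: "y $ 2 \<in> I" if "y \<in> W" for y
    using that by (simp add: W_def I_def mem_box_cart)
  define c where "c \<tau> = s u0 *\<^sub>R axis 1 1 + \<tau> *\<^sub>R axis (2::2) (1::real)" for \<tau>
  have cn: "c \<tau> $ 1 = s u0" "c \<tau> $ 2 = \<tau>" for \<tau> by (simp_all add: c_def axis_def)
  have cW: "c \<tau> \<in> W" if "\<tau> \<in> I" for \<tau>
    using that box(2) by (auto simp: W_def I_def mem_box_cart forall_2 cn Qn)
  have oI: "open I" by (simp add: I_def)
  have smc: "smooth_on I c"
    unfolding c_def by (intro smooth_on_add smooth_on_scaleR smooth_on_const smooth_on_ident oI)
  define \<alpha> where "\<alpha> \<tau> = h 0 (g (c \<tau>))" for \<tau>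
  have sm\<alpha>: "smooth_on I \<alpha>"
    unfolding \<alpha>_def using cW WT by (intro smooth_on_compose[OF smhg *(4) oI smc]) auto
  \<comment> \<open>Each \<open>h k\<close> depends on the second coordinate alone. For k = 0 it is
    constant along \<open>X1\<close>, the first coordinate direction. Afterwards the first partial
    derivative is zero by the induction hypothesis, so the second one, taken along
    \<open>X2 - \<delta> X1\<close>, is the derivative along \<open>X2\<close>.\<close>
  have cd: "curve_deriv k \<alpha> (y $ 2) = h k (g y)" if "y \<in> W" for k y
    using that
  proof (induction k arbitrary: y)
    case 0
    let ?e = "(s u0 - y $ 1) *\<^sub>R axis 1 1 :: real^2"
    have e: "y + ?e = c (y $ 2)" by (simp add: vec_eq_iff forall_2 cn axis_def)
    have "c (y $ 2) \<in> W" using cW WI 0 by blast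
    then have "closed_segment y (y + ?e) \<subseteq> T"
      using closed_segment_subset[of y W "y + ?e"] 0 W(2) by (simp add: e W_def)
    moreover have "dir_deriv (\<lambda>y. h 0 (g y)) y ?e = 0" if "y \<in> T" for y
    proof -
      have "dir_deriv (\<lambda>y. h 0 (g y)) y (axis 1 1) = 0"
        by (simp add: dhg[OF that] dg1[OF that] D1h0[OF gV[OF that]])
      then show ?thesis using linear_cmul[OF smooth_on_linear_dir_deriv[OF smhg that]] by simp
    qed
    ultimately have "h 0 (g (y + ?e)) = h 0 (g y)"
      by (intro constant_along_segment[of T "\<lambda>y. h 0 (g y)"] smooth_on_differentiable[OF smhg])
    then show ?case by (simp add: e \<alpha>_def curve_deriv_0)
  next
    case (Suc k)
    note y = Suc.prems
    have lin: "linear (dir_deriv (h k) (g y))" by (rule smooth_on_linear_dir_deriv[OF smh gV[OF WT[OF y]]])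
    have n: "dir_deriv (\<lambda>u::real^2. u $ 2) y v = v $ 2" "(\<lambda>u::real^2. u $ 2) differentiable (at y)" for v
      by (auto intro!: dir_deriv_eqI bounded_linear_imp_has_derivative bounded_linear_imp_differentiable bounded_linear_vec_nth)
    have "dir_deriv (\<lambda>y. h k (g y)) y v = dir_deriv (\<lambda>y. curve_deriv k \<alpha> (y $ 2)) y v" for v
      by (rule dir_deriv_transfer[OF W(1) y]) (simp add: Suc.IH)
    then have "dir_deriv (\<lambda>y. h k (g y)) y v = v$2 *\<^sub>R curve_deriv (Suc k) \<alpha> (y $ 2)" for v
      using dir_deriv_compose[OF smooth_on_differentiable[OF smooth_on_curve_deriv[OF oI sm\<alpha>] WI[OF y]] n(2), of k v]
        dir_deriv_curve_deriv[OF oI sm\<alpha> WI[OF y], of k] by (simp add: n(1))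
    then have eq: "dir_deriv (h k) (g y) (dir_deriv g y v) = v$2 *\<^sub>R curve_deriv (Suc k) \<alpha> (y $ 2)" for v
      using dhg[OF WT[OF y]] by simp
    have ax: "axis (1::2) (1::real) $ 2 = 0" "axis (2::2) (1::real) $ 2 = 1" by (simp_all add: axis_def)
    have "D1 (h k) (g y) = 0"
      using eq[of "axis 1 1"] unfolding dg1[OF WT[OF y]] ax by simp
    moreover have "D2 (h k) (g y) - \<delta> (g y) *\<^sub>R D1 (h k) (g y) = curve_deriv (Suc k) \<alpha> (y $ 2)"
      using eq[of "axis 2 1"] unfolding dg2[OF WT[OF y]] ax by (simp add: linear_diff[OF lin] linear_cmul[OF lin])
    ultimately show ?case by (simp add: hS)
  qed
  have cd': "curve_deriv k \<alpha> \<tau> = h k (g (c \<tau>))" "g (c \<tau>) \<in> V" if "\<tau> \<in> I" for k \<tau>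
    using cd[OF cW[OF that]] gV[OF WT[OF cW[OF that]]] by (simp_all add: cn)
  interpret C: cone_curve I \<alpha>
  proof
    show "\<langle>\<alpha> \<tau>, \<alpha> \<tau>\<rangle> = 0" if "\<tau> \<in> I" for \<tau>
      using fr(1)[OF cd'(2)[OF that]] by (simp add: \<alpha>_def)
    show "\<langle>curve_deriv 1 \<alpha> \<tau>, curve_deriv 1 \<alpha> \<tau>\<rangle> = 0" if "\<tau> \<in> I" for \<tau>
      using fr(3)[OF cd'(2)[OF that]] by (simp only: cd'(1)[OF that])
    show "\<langle>curve_deriv 2 \<alpha> \<tau>, curve_deriv 2 \<alpha> \<tau>\<rangle> = 4/9" if "\<tau> \<in> I" for \<tau>
      using h22[OF cd'(2)[OF that]] by (simp only: cd'(1)[OF that])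
  qed (fact oI sm\<alpha>)+
  have nc: "null_curve I \<alpha>"
    unfolding null_curve_def
  proof (intro conjI ballI oI sm\<alpha> C.null)
    show "is_interval I" unfolding I_def by (rule is_interval_oo)
    show "curve_deriv 1 \<alpha> \<tau> \<noteq> 0" if "\<tau> \<in> I" for \<tau>
    proof
      assume 0: "curve_deriv 1 \<alpha> \<tau> = 0"
      have "h 1 (g (c \<tau>)) = 0" using 0 by (simp only: cd'(1)[OF that])
      then show False using fr(6)[OF cd'(2)[OF that]] by (simp add: pe_inner_simps)
    qed
  qed
  have \<delta>: "\<delta> (g y) = 1/6 * (y$1)\<^sup>2 + 27/40 * \<langle>h 3 (g y), h 3 (g y)\<rangle>" if y: "y \<in> W" for y
  proof -
    let ?u = "g y"
    have u: "?u \<in> V" using gV[OF WT[OF y]] .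
    have d: "\<mu> differentiable (at ?u)" "s differentiable (at ?u)" "h k differentiable (at ?u)"
      "(\<lambda>u. 3/2 * s u) differentiable (at ?u)"
      "(\<lambda>u. \<mu> u *\<^sub>R h 0 u) differentiable (at ?u)" "(\<lambda>u. (3/2 * s u) *\<^sub>R h 1 u) differentiable (at ?u)"
      "(\<lambda>u. (3/2::real) *\<^sub>R h 2 u) differentiable (at ?u)" "(\<lambda>u. \<mu> u *\<^sub>R h 0 u + (3/2 * s u) *\<^sub>R h 1 u) differentiable (at ?u)" for k
      by (intro smooth_on_differentiable[OF _ u] smooth_on_add smooth_on_scaleR smooth_on_mult smooth_on_const sms sm\<mu> smh open_V)+
    have "F2 ?u = D2 (\<lambda>u. \<mu> u *\<^sub>R h 0 u + (3/2 * s u) *\<^sub>R h 1 u + (3/2) *\<^sub>R h 2 u) ?u"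
      by (rule dir_deriv_transfer[OF open_V u f])
    also have "\<dots> = (\<mu> ?u *\<^sub>R D2 (h 0) ?u + D2 \<mu> ?u *\<^sub>R h 0 ?u) + ((3/2 * s ?u) *\<^sub>R D2 (h 1) ?u + (3/2 * \<delta> ?u) *\<^sub>R h 1 ?u) + (3/2) *\<^sub>R D2 (h 2) ?u"
      by (simp only: dir_deriv_add[OF d(8,7)] dir_deriv_add[OF d(5,6)] dir_deriv_scaleR[OF d(1) d(3)] dir_deriv_scaleR[OF d(4) d(3)]
          dir_deriv_scaleR[OF differentiable_const d(3)] dir_deriv_mult[OF differentiable_const d(2)] \<delta>_def) simp
    also have "D2 (h 0) ?u = h 1 ?u" using hS[of 0] by simp
    also have "D2 (h 1) ?u = h 2 ?u" using hS[of 1] by (simp add: numeral_2_eq_2)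
    also have "D2 (h 2) ?u = h 3 ?u" using hS[of 2] by (simp add: eval_nat_numeral)
    finally have F2: "F2 ?u = D2 \<mu> ?u *\<^sub>R h 0 ?u + (\<mu> ?u + 3/2 * \<delta> ?u) *\<^sub>R h 1 ?u + (3/2 * s ?u) *\<^sub>R h 2 ?u + (3/2) *\<^sub>R h 3 ?u"
      by (simp add: algebra_simps)
    have in1: "\<langle>h 0 ?u, h 0 ?u\<rangle> = 0" "\<langle>h 0 ?u, h 1 ?u\<rangle> = 0" "\<langle>h 0 ?u, h 2 ?u\<rangle> = 0" "\<langle>h 0 ?u, h 3 ?u\<rangle> = 0"
      "\<langle>h 1 ?u, h 1 ?u\<rangle> = 0" "\<langle>h 1 ?u, h 2 ?u\<rangle> = 0" "\<langle>h 1 ?u, h 3 ?u\<rangle> = - 4/9" "\<langle>h 2 ?u, h 2 ?u\<rangle> = 4/9" "\<langle>h 2 ?u, h 3 ?u\<rangle> = 0"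
      using C.inner_products[OF WI[OF y]] C.null[OF WI[OF y]] C.unit[OF WI[OF y]] unfolding cd[OF y] by auto
    have in2: "\<langle>h 1 ?u, h 0 ?u\<rangle> = 0" "\<langle>h 2 ?u, h 0 ?u\<rangle> = 0" "\<langle>h 3 ?u, h 0 ?u\<rangle> = 0" "\<langle>h 2 ?u, h 1 ?u\<rangle> = 0"
      "\<langle>h 3 ?u, h 1 ?u\<rangle> = - 4/9" "\<langle>h 3 ?u, h 2 ?u\<rangle> = 0"
      using in1 by (metis pe_inner_commute)+
    have "\<langle>F2 ?u, F2 ?u\<rangle> = 9/4 * (s ?u)\<^sup>2 * (4/9) + 9/4 * \<langle>h 3 ?u, h 3 ?u\<rangle> + 3 * (\<mu> ?u + 3/2 * \<delta> ?u) * (- 4/9)"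
      unfolding F2 pe_inner_simps in1 in2 by (simp add: power2_eq_square algebra_simps)
    \<comment> \<open>As \<open>\<mu>\<close> is \<open>1/3 * s\<^sup>2 + \<delta>\<close>, this
      says that \<open>10/3 * \<delta>\<close> equals 5/9 of the square of \<open>s\<close> plus 9/4
      of the square of \<open>h 3\<close>. Hence the coefficients 1/6 and 27/40, and 1/2 = 1/3 + 1/6
      in the formula of the surface.\<close>
    then have "0 = (s ?u)\<^sup>2 + 9/4 * \<langle>h 3 ?u, h 3 ?u\<rangle> - 4/3 * (\<mu> ?u + 3/2 * \<delta> ?u)"
      using null_frame_inner(4)[OF frame[OF u]] by (simp add: algebra_simps)
    then show ?thesis
      using sg[OF WT[OF y]] by (simp add: \<mu>_def power2_eq_square algebra_simps)
  qed
  note res = homeomorphism_open_restrict[OF *(5,1) W]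
  have "u0 \<in> g ` W" using box(2) Q0(2) unfolding W_def by (metis imageI)
  moreover have "g ` W \<subseteq> V" using res(2) *(3) by blast
  moreover have "smooth_on (g ` W) Q" using smooth_on_subset[OF smQ \<open>g ` W \<subseteq> V\<close>] .
  moreover have "smooth_on W g" using smooth_on_subset[OF *(6) W(2)] .
  moreover have "\<alpha> ` I \<subseteq> light_cone" using C.cone by (auto simp: light_cone_def)
  moreover have "y$2 \<in> I \<and> f (g y) = generated_surface \<alpha> (y$1) (y$2)" if y: "y \<in> W" for y
  proof
    have "\<alpha> (y$2) = h 0 (g y)" using cd[OF y, of 0] by (simp add: curve_deriv_0)
    then show "f (g y) = generated_surface \<alpha> (y$1) (y$2)"
      unfolding generated_surface_def cd[OF y] f[OF gV[OF WT[OF y]]] \<mu>_def \<delta>[OF y] sg[OF WT[OF y]]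
      by (simp add: power2_eq_square)
  qed (rule WI[OF y])
  ultimately show ?thesis
    unfolding generated_near_def using res(1,3) W(1) nc C.unit by blast
qed

text \<open>As \<open>a4\<close> vanishes, the quotient from \<open>ratio_function\<close> is
  constant along \<open>X1\<close>; rescaling the frame by its derivative along \<open>X2\<close>
  normalizes that derivative to 1. Near \<open>u0\<close> this factor is nonzero because
  \<open>b4\<close> is.\<close>

lemma normal_form:
  assumes u0: "u0 \<in> V" and ab: "\<And>u. u \<in> V \<Longrightarrow> a3 u * b4 u = - 2/3" and a40: "\<And>u. u \<in> V \<Longrightarrow> a4 u = 0"
  shows "generated_near V f u0"
proof -
  obtain V0 t P where t: "open V0" "u0 \<in> V0" "V0 \<subseteq> V" "smooth_on V0 t"
    "\<And>u. u \<in> V0 \<Longrightarrow> D1 t u = a4 u * P u" "D2 t u0 = - b4 u0"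
    using ratio_function[OF u0] by blast
  define l where "l = (\<lambda>u. D2 t u)"
  have sml: "smooth_on V0 l"
    unfolding l_def by (intro smooth_on_dir_deriv t smooth_on_subset[OF smooth_frame(2)])
  define V1 where "V1 = {u \<in> V0. l u \<noteq> 0}"
  have V1: "open V1" "V1 \<subseteq> V0" "V1 \<subseteq> V" using open_nonzero[OF t(1) sml] t(3) by (auto simp: V1_def)
  have u1: "u0 \<in> V1" using t(2,6) ab[OF u0] by (auto simp: V1_def l_def)
  have l: "l u \<noteq> 0" "u \<in> V0" "u \<in> V" if "u \<in> V1" for u using that V1 by (auto simp: V1_def)
  interpret M: minimal_frame V1 f "\<lambda>u. l u *\<^sub>R X1 u" "\<lambda>u. inverse (l u) *\<^sub>R X2 u" n3 n4
    by (rule rescale[OF V1(1,3) smooth_on_subset[OF sml V1(2)] l(1)])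
  have h: "\<langle>D1 F1 u, n\<rangle> = \<langle>second_ff f u (X1 u) (X1 u), n\<rangle>" "\<langle>D2 F2 u, n\<rangle> = \<langle>second_ff f u (X2 u) (X2 u), n\<rangle>"
    if "u \<in> V" "n = n3 u \<or> n = n4 u" for u n
    using inner_second_ff[OF that(1) _ that(2)] smooth_frame by auto
  have coeffs: "M.a3 u = l u * l u * a3 u" "M.a4 u = l u * l u * a4 u" "M.b4 u = inverse (l u) * inverse (l u) * b4 u"
    if "u \<in> V1" for u
    unfolding M.a3_def M.a4_def M.b4_def a3_def a4_def b4_def
    using M.inner_second_ff[OF that M.smooth_frame(1), of "n3 u"] M.inner_second_ff[OF that M.smooth_frame(1), of "n4 u"]
      M.inner_second_ff[OF that M.smooth_frame(2), of "n3 u"] h[OF l(3)[OF that], of "n3 u"] h[OF l(3)[OF that], of "n4 u"]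
    by (simp_all add: second_ff_scale[OF l(3)[OF that]] pe_inner_simps)
  have lin: "linear (dir_deriv t u)" if "u \<in> V1" for u
    by (rule smooth_on_linear_dir_deriv[OF t(4) l(2)[OF that]])
  have "generated_near V1 f u0"
  proof (rule M.straightened_normal_form[OF u1, of t])
    show "M.a3 u * M.b4 u = - 2/3" if "u \<in> V1" for u
    proof -
      have "M.a3 u * M.b4 u = (l u * inverse (l u))\<^sup>2 * (a3 u * b4 u)"
        by (simp only: coeffs[OF that] power2_eq_square mult_ac)
      then show ?thesis using ab[OF l(3)[OF that]] l(1)[OF that] by simp
    qed
    show "M.a4 u = 0" if "u \<in> V1" for u
      using a40[OF l(3)[OF that]] by (simp add: coeffs[OF that])
    show "smooth_on V1 t" by (rule smooth_on_subset[OF t(4) V1(2)])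
    show "dir_deriv t u (l u *\<^sub>R X1 u) = 0" if "u \<in> V1" for u
      using t(5)[OF l(2)[OF that]] a40[OF l(3)[OF that]] by (simp add: linear_cmul[OF lin[OF that]])
    show "dir_deriv t u (inverse (l u) *\<^sub>R X2 u) = 1" if "u \<in> V1" for u
      using l(1)[OF that] by (simp add: linear_cmul[OF lin[OF that]] l_def)
  qed
  then show ?thesis using V1(3) by (rule generated_near_mono)
qed

text \<open>If it is \<open>b3\<close> that vanishes, exchanging both pairs of the frame leads back
  to the case of \<open>a4\<close>.\<close>

lemma normal_form_if_product_vanishes:
  assumes u0: "u0 \<in> V" and ab: "\<And>u. u \<in> V \<Longrightarrow> a3 u * b4 u = - 2/3" and 0: "\<And>u. u \<in> V \<Longrightarrow> a4 u * b3 u = 0"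
  shows "generated_near V f u0"
proof -
  have nz: "a3 u * b4 u \<noteq> 0" if "u \<in> V" for u using ab[OF that] by simp
  obtain U where U: "open U" "u0 \<in> U" "U \<subseteq> V" and "(\<forall>u\<in>U. a4 u = 0) \<or> (\<forall>u\<in>U. b3 u = 0)"
    by (rule one_coefficient_vanishes[OF u0 nz 0])
  interpret M: minimal_frame U f X1 X2 n3 n4
    using rescale[OF U(1,3) smooth_on_const[of U 1]] by simp
  interpret S: minimal_frame U f X2 X1 n4 n3 by (rule M.swap12)
  have coeffs: "S.a3 = b4" "S.a4 = b3" "S.b4 = a3"
    by (simp_all add: fun_eq_iff S.a3_def S.a4_def S.b4_def a3_def b3_def b4_def)
  have ab': "a3 u * b4 u = - 2/3" "b4 u * a3 u = - 2/3" if "u \<in> U" for u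
    using ab[of u] U(3) that by (auto simp: mult.commute)
  from \<open>(\<forall>u\<in>U. a4 u = 0) \<or> (\<forall>u\<in>U. b3 u = 0)\<close> have "generated_near U f u0"
  proof
    assume "\<forall>u\<in>U. a4 u = 0"
    then show ?thesis
      by (intro M.normal_form[OF U(2)] ab'(1)) auto
  next
    assume "\<forall>u\<in>U. b3 u = 0"
    then show ?thesis
      by (intro S.normal_form[OF U(2), unfolded coeffs] ab'(2)) auto
  qed
  then show ?thesis using U(3) by (rule generated_near_mono)
qed

text \<open>Exchanging the normals turns the second alternative of
  \<open>constant_curvatures\<close> into the first.\<close>

lemma constant_curvatures_normal_form:
  assumes u0: "u0 \<in> V" and K: "\<And>u. u \<in> V \<Longrightarrow> gauss_curvature f u = K"
    and KD: "\<And>u. u \<in> V \<Longrightarrow> normal_curvature f X1 X2 n3 n4 u = KD" "KD \<noteq> 0"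
  shows "generated_near V f u0"
proof -
  interpret S: minimal_frame V f X1 X2 n4 n3 by (rule swap34)
  have coeffs: "S.a3 = a4" "S.a4 = a3" "S.b3 = b4" "S.b4 = b3"
    by (simp_all add: fun_eq_iff S.a3_def S.a4_def S.b3_def S.b4_def a3_def a4_def b3_def b4_def)
  from constant_curvatures[OF assms] show ?thesis
    using normal_form_if_product_vanishes[OF u0] S.normal_form_if_product_vanishes[OF u0, unfolded coeffs]
    by blast
qed

end

section \<open>Return from coordinates to the surface\<close>

lemma congruent_near_if_generated_near:
  assumes surf: "smooth_surface X \<A>" and par: "parametrization X \<A> V \<psi>"
    and gen: "generated_near V (\<phi> \<circ> \<psi>) u0"
  shows "\<exists>I \<alpha>. null_curve I \<alpha> \<and> \<alpha> ` I \<subseteq> light_cone \<and>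
    (\<forall>t\<in>I. \<langle>curve_deriv 2 \<alpha> t, curve_deriv 2 \<alpha> t\<rangle> = 4/9) \<and>
    congruent_near X \<A> \<phi> (\<psi> u0) (UNIV \<times> I) (generated_surface \<alpha>)"
proof -
  obtain U W I \<alpha> Q and g :: "real^2 \<Rightarrow> real^2" where U: "open U" "u0 \<in> U" "U \<subseteq> V" and W: "open W"
    and hom: "homeomorphism U W Q g" and sm: "smooth_on U Q" "smooth_on W g"
    and \<alpha>: "null_curve I \<alpha>" "\<alpha> ` I \<subseteq> light_cone" "\<forall>t\<in>I. \<langle>curve_deriv 2 \<alpha> t, curve_deriv 2 \<alpha> t\<rangle> = 4/9"
    and x: "\<forall>y\<in>W. y$2 \<in> I \<and> (\<phi> \<circ> \<psi>) (g y) = generated_surface \<alpha> (y$1) (y$2)"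
    using gen unfolding generated_near_def by blast
  have "parametrization X \<A> W (\<psi> \<circ> g)"
    using surf by (intro parametrization_compose[OF par _ U(1,3) W hom sm]) (auto simp: smooth_surface_def)
  moreover have "\<psi> u0 \<in> (\<psi> \<circ> g) ` W"
  proof -
    have "Q u0 \<in> W" "g (Q u0) = u0" using hom U(2) by (auto simp: homeomorphism_def)
    then show ?thesis by (metis comp_apply imageI)
  qed
  moreover have "linear_isometry (\<lambda>v. v)" by (simp add: linear_isometry_def linear_ident)
  ultimately have "congruent_near X \<A> \<phi> (\<psi> u0) (UNIV \<times> I) (generated_surface \<alpha>)"
    unfolding congruent_near_def using x by (intro exI[of _ "\<lambda>v. v"] exI[of _ W] exI[of _ "\<psi> \<circ> g"]) auto
  then show ?thesis using \<alpha> by blast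
qed

theorem theorem3p5:
  fixes X :: "'m topology" and \<A> :: "'m patch set" and \<phi> :: "'m \<Rightarrow> real^5"
  assumes "lorentzian_surface_in_S42 X \<A> \<phi>"
    and "lies_fully X \<phi>"
  shows "(minimal_surface X \<A> \<phi> \<and>
      (\<exists>K. has_constant_gauss_curvature X \<A> \<phi> K) \<and>
      (\<exists>KD. KD \<noteq> 0 \<and> has_constant_normal_curvature X \<A> \<phi> KD)) \<longleftrightarrow>
    (\<forall>p\<in>topspace X. \<exists>I \<alpha>. null_curve I \<alpha> \<and> \<alpha> ` I \<subseteq> light_cone \<and>
      (\<forall>t\<in>I. \<langle>curve_deriv 2 \<alpha> t, curve_deriv 2 \<alpha> t\<rangle> = 4/9) \<and>
      congruent_near X \<A> \<phi> p (UNIV \<times> I)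
        (\<lambda>s t. (1/2 * s\<^sup>2 + 27/40 * \<langle>curve_deriv 3 \<alpha> t, curve_deriv 3 \<alpha> t\<rangle>) *\<^sub>R \<alpha> t
             + (3/2 * s) *\<^sub>R curve_deriv 1 \<alpha> t + (3/2) *\<^sub>R curve_deriv 2 \<alpha> t))"
  (is "?curv \<longleftrightarrow> (\<forall>p\<in>topspace X. \<exists>I \<alpha>. ?gen p I \<alpha>)")
proof -
  have surf: "smooth_surface X \<A>" using assms(1) by (simp add: lorentzian_surface_in_S42_def)
  have gen: "?gen p I \<alpha> \<longleftrightarrow> null_curve I \<alpha> \<and> \<alpha> ` I \<subseteq> light_cone \<and>
      (\<forall>t\<in>I. \<langle>curve_deriv 2 \<alpha> t, curve_deriv 2 \<alpha> t\<rangle> = 4/9) \<and>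
      congruent_near X \<A> \<phi> p (UNIV \<times> I) (generated_surface \<alpha>)" for p I \<alpha>
    unfolding generated_surface_def[abs_def] ..
  show ?thesis
  proof
    assume ?curv
    then obtain K KD where min: "minimal_surface X \<A> \<phi>" and K: "has_constant_gauss_curvature X \<A> \<phi> K"
      and KD: "KD \<noteq> 0" "has_constant_normal_curvature X \<A> \<phi> KD" by blast
    show "\<forall>p\<in>topspace X. \<exists>I \<alpha>. ?gen p I \<alpha>"
    proof
      fix p assume "p \<in> topspace X"
      \<comment> \<open>The null frame used near \<open>p\<close> is the one in which the constant
        normal curvature is expressed.\<close>
      then obtain V \<psi> X1 X2 n3 n4 where par: "parametrization X \<A> V \<psi>" and p: "p \<in> \<psi> ` V"
        and frame: "adapted_frame (\<phi> \<circ> \<psi>) V X1 X2 n3 n4"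
        and nc: "\<And>u. u \<in> V \<Longrightarrow> normal_curvature (\<phi> \<circ> \<psi>) X1 X2 n3 n4 u = KD"
        using KD(2) unfolding has_constant_normal_curvature_def by metis
      interpret P: lorentzian_patch V "\<phi> \<circ> \<psi>"
        by (rule lorentzian_patch_parametrization[OF assms(1) par])
      interpret minimal_frame V "\<phi> \<circ> \<psi>" X1 X2 n3 n4
      proof
        fix u assume u: "u \<in> V"
        have "mean_curvature (\<phi> \<circ> \<psi>) u = - second_ff (\<phi> \<circ> \<psi>) u (X1 u) (X2 u)"
          using frame u by (intro P.mean_curvature_null_basis) (auto simp: adapted_frame_def Let_def first_ff_def)
        then show "second_ff (\<phi> \<circ> \<psi>) u (X1 u) (X2 u) = 0"
          using min par u by (simp add: minimal_surface_def)
      qed (rule frame)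
      obtain u0 where u0: "u0 \<in> V" "p = \<psi> u0" using p by blast
      have "gauss_curvature (\<phi> \<circ> \<psi>) u = K" if "u \<in> V" for u
        using K par that by (simp add: has_constant_gauss_curvature_def)
      then have "generated_near V (\<phi> \<circ> \<psi>) u0"
        using constant_curvatures_normal_form[OF u0(1) _ nc KD(1)] by blast
      then show "\<exists>I \<alpha>. ?gen p I \<alpha>"
        unfolding gen u0(2) by (rule congruent_near_if_generated_near[OF surf par])
    qed
  next
    assume R: "\<forall>p\<in>topspace X. \<exists>I \<alpha>. ?gen p I \<alpha>"
    have local_form: "\<exists>V \<psi> X1 X2 n3 n4. parametrization X \<A> V \<psi> \<and> p \<in> \<psi> ` V \<and> adapted_frame (\<phi> \<circ> \<psi>) V X1 X2 n3 n4 \<and>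
      (\<forall>u\<in>V. mean_curvature (\<phi> \<circ> \<psi>) u = 0 \<and> gauss_curvature (\<phi> \<circ> \<psi>) u = 1/3 \<and>
        normal_curvature (\<phi> \<circ> \<psi>) X1 X2 n3 n4 u = - 2/3)" if "p \<in> topspace X" for p
    proof -
      have "\<exists>I \<alpha>. ?gen p I \<alpha>" using R that by (rule bspec)
      then obtain I \<alpha> where \<alpha>: "null_curve I \<alpha>" "\<alpha> ` I \<subseteq> light_cone"
        "\<And>t. t \<in> I \<Longrightarrow> \<langle>curve_deriv 2 \<alpha> t, curve_deriv 2 \<alpha> t\<rangle> = 4/9"
        "congruent_near X \<A> \<phi> p (UNIV \<times> I) (generated_surface \<alpha>)"
        unfolding gen by (elim exE conjE) (simp only: Ball_def)
      obtain V \<psi> X1 X2 n3 n4 where "parametrization X \<A> V \<psi>" "p \<in> \<psi> ` V" "adapted_frame (\<phi> \<circ> \<psi>) V X1 X2 n3 n4"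
        "\<And>u. u \<in> V \<Longrightarrow> mean_curvature (\<phi> \<circ> \<psi>) u = 0" "\<And>u. u \<in> V \<Longrightarrow> gauss_curvature (\<phi> \<circ> \<psi>) u = 1/3"
        "\<And>u. u \<in> V \<Longrightarrow> normal_curvature (\<phi> \<circ> \<psi>) X1 X2 n3 n4 u = - 2/3"
        using congruent_near_generated_surface[OF assms(1) \<alpha>] by blast
      then show ?thesis by blast
    qed
    \<comment> \<open>The congruence gives the curvatures in one parametrization around each point,
      whereas minimality and constancy of \<open>K\<close> refer to all of them; transition maps
      carry the values over. The normal curvature is stated through a choice of local frames and is
      covered by \<open>local_form\<close>.\<close>
    have curv: "mean_curvature (\<phi> \<circ> \<psi>') u = 0 \<and> gauss_curvature (\<phi> \<circ> \<psi>') u = 1/3"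
      if par': "parametrization X \<A> V' \<psi>'" and u: "u \<in> V'" for V' \<psi>' u
    proof -
      have "topological_patch X (V', \<psi>')" using par' by (simp add: parametrization_def)
      then have "\<psi>' u \<in> topspace X" using topological_patchD(3) openin_subset u by blast
      then obtain V \<psi> where par: "parametrization X \<A> V \<psi>" "\<psi>' u \<in> \<psi> ` V"
        and c: "\<forall>u\<in>V. mean_curvature (\<phi> \<circ> \<psi>) u = 0 \<and> gauss_curvature (\<phi> \<circ> \<psi>) u = 1/3"
        using local_form by metis
      obtain S \<tau> where S: "open S" "u \<in> S" "S \<subseteq> V'" "smooth_on S \<tau>" "\<tau> ` S \<subseteq> V" "\<And>w. w \<in> S \<Longrightarrow> \<psi> (\<tau> w) = \<psi>' w"
        using parametrization_transition[OF surf par(1) par' u par(2)] by metis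
      have eq: "(\<phi> \<circ> \<psi>') w = (\<phi> \<circ> \<psi>) (\<tau> w)" if "w \<in> S" for w using S(6)[OF that] by simp
      have inv: "mean_curvature (\<phi> \<circ> \<psi>') u = mean_curvature (\<phi> \<circ> \<psi>) (\<tau> u)"
        "gauss_curvature (\<phi> \<circ> \<psi>') u = gauss_curvature (\<phi> \<circ> \<psi>) (\<tau> u)"
        by (rule curvatures_reparametrized[OF lorentzian_patch_parametrization[OF assms(1) par(1)]
          lorentzian_patch_parametrization[OF assms(1) par'] S(1,3,2,4,5) eq]; assumption)+
      have "\<tau> u \<in> V" using S(2,5) by blast
      then show ?thesis using inv c by metis
    qed
    have "minimal_surface X \<A> \<phi>" using curv by (simp add: minimal_surface_def)
    moreover have "has_constant_gauss_curvature X \<A> \<phi> (1/3)"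
      using curv by (simp add: has_constant_gauss_curvature_def)
    moreover have "has_constant_normal_curvature X \<A> \<phi> (- 2/3)"
      unfolding has_constant_normal_curvature_def using local_form by metis
    moreover have "- 2/3 \<noteq> (0::real)" by simp
    ultimately show ?curv by blast
  qed
qed

end
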